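(* Let $\varepsilon\in(0,1]$, $0<\mathrm{Bo}<1$, and let $\zeta_0\in\mathbb{A}^0_0$ be a real-valued zero-mean function with $$|\zeta_0|_{0,0}<\frac{\frac{1}{\mathrm{Bo}}-1}{8\varepsilon\left(\frac{1}{\mathrm{Bo}}+1\right)}.$$ Then there exists a global weak solution $\zeta$ of the thin film equation $$\partial_t\zeta+\partial_x\left((1+\varepsilon\zeta)(\partial_x\zeta+\tfrac{1}{\mathrm{Bo}}\partial_x^3\zeta)\right)=0$$ with initial datum $\zeta_0$ (a weak solution on $[0,T]$ for every $T>0$), which becomes instantaneously analytic in a growing strip of the complex plane. More precisely, for every $\nu\in\left[0,\tfrac12(\tfrac{1}{\mathrm{Bo}}-1)\right)$ and every $T>0$, $\zeta\in L^\infty([0,T];\mathbb{A}^0_{\nu t})\cap L^1([0,T];\mathbb{A}^4_{\nu t})$, and for all $t\in[0,T]$, $$|\zeta(t)|_{0,\nu t}+\tfrac{1}{64}\left(\tfrac{1}{\mathrm{Bo}}-1\right)\int_0^t|\zeta(t')|_{4,\nu t'}\,dt'\leq |\zeta_0|_{0,0},\qquad |\zeta(t)|_{0,\nu t}\leq |\zeta_0|_{0,0}\,e^{-\frac{t}{64}\left(\frac{1}{\mathrm{Bo}}-1\right)}.$$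
   Context: Let $\mathbb{T}=\mathbb{R}/2\pi\mathbb{Z}$. For $f\in L^1(\mathbb{T})$, $\widehat f(n)=\frac{1}{2\pi}\int_{\mathbb{T}}f(x)e^{-inx}\,dx$. For $s,\lambda\geq 0$ the Wiener space $\mathbb{A}^s_\lambda$ is the space of $f\in L^1(\mathbb{T})$ with finite norm $|f|_{s,\lambda}:=\sum_{n\in\mathbb{Z}}(1+|n|)^s e^{\lambda|n|}|\widehat f(n)|$. The statement $\zeta\in L^\infty([0,T];\mathbb{A}^0_{\nu t})\cap L^1([0,T];\mathbb{A}^4_{\nu t})$ means $\sup_{t\in[0,T]}|\zeta(t)|_{0,\nu t}<\infty$ and $\int_0^T|\zeta(t)|_{4,\nu t}dt<\infty$. Weak solution: $\zeta\in L^\infty([0,T],L^\infty(\mathbb{T}))\cap L^1([0,T],W^{3,\infty}(\mathbb{T}))$ is a weak solution with initial datum $\zeta_0\in L^\infty(\mathbb{T})$ if for every $\varphi\in C^\infty([0,T]\times\mathbb{T})$ and $t\in[0,T]$, $$\int_{\mathbb{T}}\zeta(t)\varphi(t)\,dx-\int_{\mathbb{T}}\zeta_0\varphi(0)\,dx-\int_0^t\!\!\int_{\mathbb{T}}\zeta\,\partial_t\varphi\,dx\,dt'=\int_0^t\!\!\int_{\mathbb{T}}(1+\varepsilon\zeta)\partial_x\zeta\,\partial_x\varphi\,dx\,dt'+\frac{1}{\mathrm{Bo}}\int_0^t\!\!\int_{\mathbb{T}}(1+\varepsilon\zeta)\partial_x^3\zeta\,\partial_x\varphi\,dx\,dt'.$$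 *)

theory Defs
  imports "HOL-Analysis.Analysis"
begin

text \<open>Functions on the torus R/2piZ are represented as 2pi-periodic functions real => real.
  A time dependent function is  zeta :: real => real => real, zeta t x.\<close>

definition periodic2pi :: "(real \<Rightarrow> real) \<Rightarrow> bool" where
  "periodic2pi f \<longleftrightarrow> (\<forall>x. f (x + 2 * pi) = f x)"

definition fourier_coeff :: "(real \<Rightarrow> real) \<Rightarrow> int \<Rightarrow> complex" where
  "fourier_coeff f n = complex_of_real (1 / (2 * pi)) *
     (LINT x:{0..2*pi}|lborel. complex_of_real (f x) * exp (- \<i> * of_int n * complex_of_real x))"

definition wnorm :: "real \<Rightarrow> real \<Rightarrow> (real \<Rightarrow> real) \<Rightarrow> ennreal" where
  "wnorm s lam f = (\<Sum>\<^sub>\<infinity> n::int. ennreal ((1 + real_of_int \<bar>n\<bar>) powr s * exp (lam * real_of_int \<bar>n\<bar>)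
                                        * cmod (fourier_coeff f n)))"

definition wiener :: "real \<Rightarrow> real \<Rightarrow> (real \<Rightarrow> real) \<Rightarrow> bool" where
  "wiener s lam f \<longleftrightarrow> periodic2pi f \<and> set_integrable lborel {0..2*pi} f \<and> wnorm s lam f < \<infinity>"

definition smooth1 :: "(real \<Rightarrow> real) \<Rightarrow> bool" where
  "smooth1 \<psi> \<longleftrightarrow> (\<forall>k x. ((deriv ^^ k) \<psi>) differentiable (at x))"

definition dt :: "(real \<Rightarrow> real \<Rightarrow> real) \<Rightarrow> real \<Rightarrow> real \<Rightarrow> real" where
  "dt f s x = deriv (\<lambda>s'. f s' x) s"

definition dx :: "(real \<Rightarrow> real \<Rightarrow> real) \<Rightarrow> real \<Rightarrow> real \<Rightarrow> real" where
  "dx f s x = deriv (\<lambda>x'. f s x') x"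

text \<open>C-infinity functions of two variables: every iterated partial derivative
  is (Frechet) differentiable on R^2 (hence all partial derivatives of all orders
  exist and are continuous).\<close>
definition smooth2 :: "(real \<Rightarrow> real \<Rightarrow> real) \<Rightarrow> bool" where
  "smooth2 \<phi> \<longleftrightarrow> (\<forall>ds :: bool list.
     (\<lambda>p. (foldr (\<lambda>b h. if b then dt h else dx h) ds \<phi>) (fst p) (snd p)) differentiable_on UNIV)"

text \<open>Test functions in C^infinity([0,T] x T): smooth on R^2 and 2pi-periodic in x.\<close>
definition test_fun :: "(real \<Rightarrow> real \<Rightarrow> real) \<Rightarrow> bool" where
  "test_fun \<phi> \<longleftrightarrow> smooth2 \<phi> \<and> (\<forall>s. periodic2pi (\<phi> s))"

definition weak_deriv :: "nat \<Rightarrow> (real \<Rightarrow> real) \<Rightarrow> (real \<Rightarrow> real) \<Rightarrow> bool" where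
  "weak_deriv k f g \<longleftrightarrow> set_integrable lborel {0..2*pi} f \<and> set_integrable lborel {0..2*pi} g \<and>
     (\<forall>\<psi>. smooth1 \<psi> \<and> periodic2pi \<psi> \<longrightarrow>
        (LINT x:{0..2*pi}|lborel. f x * (deriv ^^ k) \<psi> x) =
        (-1) ^ k * (LINT x:{0..2*pi}|lborel. g x * \<psi> x))"

text \<open>Weak solution on [0,T] of
  d_t zeta + d_x((1+eps zeta)(d_x zeta + 1/Bo d_x^3 zeta)) = 0  with initial datum zeta0.
  D k is the k-th weak space derivative (D 0 = zeta);
  zeta in L^infty([0,T],L^infty(T)): jointly measurable, essentially bounded;
  zeta in L^1([0,T],W^{3,infty}(T)): the W^{3,infty} norms are dominated by an integrable M.\<close>
definition weak_solution ::
  "real \<Rightarrow> real \<Rightarrow> real \<Rightarrow> (real \<Rightarrow> real) \<Rightarrow> (real \<Rightarrow> real \<Rightarrow> real) \<Rightarrow> bool" where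
  "weak_solution \<epsilon> Bo T \<zeta>0 \<zeta> \<longleftrightarrow>
     (\<forall>t\<in>{0..T}. periodic2pi (\<zeta> t)) \<and>
     (\<lambda>p. \<zeta> (fst p) (snd p)) \<in> borel_measurable lborel \<and>
     (\<exists>C. AE p in lborel. p \<in> {0..T} \<times> UNIV \<longrightarrow> \<bar>\<zeta> (fst p) (snd p)\<bar> \<le> C) \<and>
     (\<exists>D :: nat \<Rightarrow> real \<Rightarrow> real \<Rightarrow> real. \<exists>M :: real \<Rightarrow> real.
        D 0 = \<zeta> \<and>
        (\<forall>k\<le>3. (\<lambda>p. D k (fst p) (snd p)) \<in> borel_measurable lborel) \<and>
        set_integrable lborel {0..T} M \<and>
        (AE t in lborel. t \<in> {0..T} \<longrightarrow>
            (\<forall>k\<le>3. weak_deriv k (\<zeta> t) (D k t)) \<and>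
            (AE x in lborel. \<forall>k\<le>3. \<bar>D k t x\<bar> \<le> M t)) \<and>
        (\<forall>\<phi> t. test_fun \<phi> \<and> t \<in> {0..T} \<longrightarrow>
           (LINT x:{0..2*pi}|lborel. \<zeta> t x * \<phi> t x)
           - (LINT x:{0..2*pi}|lborel. \<zeta>0 x * \<phi> 0 x)
           - (LINT p:{0..t}\<times>{0..2*pi}|lborel. \<zeta> (fst p) (snd p) * dt \<phi> (fst p) (snd p))
           = (LINT p:{0..t}\<times>{0..2*pi}|lborel.
                (1 + \<epsilon> * \<zeta> (fst p) (snd p)) * D 1 (fst p) (snd p) * dx \<phi> (fst p) (snd p))
             + 1 / Bo * (LINT p:{0..t}\<times>{0..2*pi}|lborel.
                (1 + \<epsilon> * \<zeta> (fst p) (snd p)) * D 3 (fst p) (snd p) * dx \<phi> (fst p) (snd p))))"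

end

theory Submission
  imports Defs
begin

text \<open>With \<beta> = 1/Bo the Fourier coefficients of \<zeta> solve
  a_n' = - L_n a_n + \<epsilon> n \<Sum>_m (m - \<beta> m^3) a_(n-m) a_m, where L_n = \<beta> n^4 - n^2 \<ge> (\<beta> - 1) n^4.
  The Picard iterates of the integrated (Duhamel) equation are dominated by the increasing iterates of
  the corresponding equation with all coefficients replaced by their absolute values.  Weighting the
  latter by w_n(t) = exp (\<gamma> t + \<nu> t |n|), which satisfies w_n \<le> w_(n-m) w_m, and using
  |n| |m|^3 \<le> |n-m| |m|^3 + m^4 \<le> (|n-m|^4 + 7 m^4) / 4, one obtains for F = \<Sum> w_n M_n and
  F4 = \<Sum> n^4 w_n M_n the inequality
  F(t) + (\<beta> - 1 - \<gamma> - \<nu>) \<integral> F4 \<le> S0 + 2 \<epsilon> \<beta> \<integral> F F4.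
  Since 2 \<epsilon> \<beta> S0 < (\<beta> - 1) / 4, a continuity argument gives F \<le> S0 and absorbs the last integral.
  Hence the majorants, and with them the Picard iterates, converge; the choice \<gamma> = 0 yields the
  analyticity bound and \<gamma> = (\<beta> - 1) / 64 the exponential decay.  The weak formulation follows
  by integrating by parts in time at fixed x and term by term in x.\<close>

section \<open>Sums over the integers and absolutely convergent Fourier series\<close>

text \<open>The fourth-order norm is controlled only in L^1 in time, so the series may diverge at
  exceptional times. Nonnegative majorants in \<open>ennreal\<close> remove every a priori
  integrability question: the integrated equation, the weighted sums and their limits make sense
  before anything is known to be finite. They also replace a contraction argument in a function
  space: the increments of the Picard iterates are bounded, coefficient by coefficient, by the
  increments of an increasing bounded sequence, whose sum telescopes. Origin of the constants: the
  quadratic estimate has constant 2 \<epsilon> \<beta> and is to cost at most a quarter of the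
  dissipation, whence the 8 = 2 * 4 in the smallness condition. Of the remaining 3/4 (\<beta> - 1)
  the growth rate \<nu> of the strip may take 1/2, which leaves 1/4; comparing (1 + |n|)^4 with n^4
  costs a factor 2^4, whence 1/64. The zero mean enters here: at n = 0 neither this comparison nor
  the absorption of \<gamma> into n^4 is possible.\<close>

lemma infsum_int_ennreal:
  fixes f :: "int \<Rightarrow> ennreal"
  shows "infsum f UNIV = (\<integral>\<^sup>+n. f n \<partial>count_space UNIV)"
proof -
  obtain b :: "nat \<Rightarrow> int" where b: "bij b"
    by (metis bij_int_decode)
  have s: "(\<lambda>n. f (b n)) summable_on UNIV"
    by (rule nonneg_summable_on_complete) simp
  have "infsum f UNIV = infsum (\<lambda>n. f (b n)) UNIV"
    using infsum_reindex_bij_betw[OF b, of f] by simp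
  also have "\<dots> = suminf (\<lambda>n. f (b n))"
    using s has_sum_imp_sums[OF has_sum_infsum[OF s]] sums_unique by blast
  also have "\<dots> = (\<integral>\<^sup>+n. f (b n) \<partial>count_space UNIV)"
    by (rule nn_integral_count_space_nat[symmetric])
  also have "\<dots> = (\<integral>\<^sup>+n. f n \<partial>count_space UNIV)"
    by (rule nn_integral_bij_count_space[OF b])
  finally show ?thesis .
qed

text \<open>The index set is countable, so joint measurability follows from measurability of each
  slice.\<close>

lemma measurable_pair_int [measurable (raw)]:
  assumes "\<And>n::int. (\<lambda>p. f p n) \<in> measurable M N"
  shows "(\<lambda>(p, n). f p n) \<in> measurable (M \<Otimes>\<^sub>M count_space UNIV) N"
  using measurable_pair_measure_countable1[of "UNIV::int set" "\<lambda>(n,p). f p n" M N] assms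
  by (subst measurable_pair_swap_iff) (simp add: split_beta')

lemma sigma_finite_int: "sigma_finite_measure (count_space (UNIV::int set))"
  by (rule sigma_finite_measure_count_space)

lemma pair_sigma_finite_lborel_int: "pair_sigma_finite lborel (count_space (UNIV::int set))"
  by (intro pair_sigma_finite.intro sigma_finite_int lborel.sigma_finite_measure_axioms)

lemma nn_integral_int_swap:
  fixes f :: "'a::euclidean_space \<Rightarrow> int \<Rightarrow> ennreal"
  assumes "\<And>n. (\<lambda>s. f s n) \<in> borel_measurable lborel"
  shows "(\<integral>\<^sup>+n. (\<integral>\<^sup>+s. f s n \<partial>lborel) \<partial>count_space UNIV) = (\<integral>\<^sup>+s. (\<integral>\<^sup>+n. f s n \<partial>count_space UNIV) \<partial>lborel)"
proof -
  interpret pair_sigma_finite "lborel :: 'a measure" "count_space (UNIV::int set)"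
    by (rule pair_sigma_finite_lborel_int)
  show ?thesis
    using measurable_pair_int[of f, OF assms] by (intro Fubini') auto
qed

lemma nn_integral_int_shift:
  fixes f :: "int \<Rightarrow> ennreal"
  shows "(\<integral>\<^sup>+n. f (n - m) \<partial>count_space UNIV) = (\<integral>\<^sup>+n. f n \<partial>count_space UNIV)"
  by (rule nn_integral_bij_count_space) (auto intro: bij_betwI[where g="\<lambda>n. n + m"])

lemma integral_int_shift:
  fixes f :: "int \<Rightarrow> complex"
  shows "(LINT n|count_space UNIV. f (n - m)) = (LINT n|count_space UNIV. f n)"
  by (rule integral_bij_count_space) (auto intro: bij_betwI[where g="\<lambda>n. n + m"])

lemma integral_int_neg:
  fixes f :: "int \<Rightarrow> complex"
  shows "(LINT n|count_space UNIV. f (- n)) = (LINT n|count_space UNIV. f n)"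
  by (rule integral_bij_count_space) (auto intro: bij_betwI[where g="\<lambda>n. - n"])

lemma nn_integral_int_fubini:
  fixes f :: "int \<Rightarrow> int \<Rightarrow> ennreal"
  shows "(\<integral>\<^sup>+n. (\<integral>\<^sup>+m. f n m \<partial>count_space UNIV) \<partial>count_space UNIV)
       = (\<integral>\<^sup>+m. (\<integral>\<^sup>+n. f n m \<partial>count_space UNIV) \<partial>count_space UNIV)"
proof -
  interpret pair_sigma_finite "count_space (UNIV::int set)" "count_space (UNIV::int set)"
    by (intro pair_sigma_finite.intro sigma_finite_int)
  show ?thesis
    by (intro Fubini'[symmetric]) measurable
qed

text \<open>For nonnegative sequences Young's convolution inequality in l^1 is an equality: sum over
  n first and translate. No summability is assumed.\<close>

lemma nn_integral_int_conv:
  fixes f g :: "int \<Rightarrow> ennreal"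
  shows "(\<integral>\<^sup>+n. (\<integral>\<^sup>+m. f (n - m) * g m \<partial>count_space UNIV) \<partial>count_space UNIV)
       = (\<integral>\<^sup>+n. f n \<partial>count_space UNIV) * (\<integral>\<^sup>+m. g m \<partial>count_space UNIV)"
  by (subst nn_integral_int_fubini)
     (simp add: nn_integral_multc nn_integral_cmult nn_integral_int_shift)

text \<open>Sums over the integers are integrals with respect to the counting measure, so that Tonelli, Fubini
  and dominated convergence apply; fser c is 0 where the coefficients are not absolutely summable.\<close>

definition fser :: "(int \<Rightarrow> complex) \<Rightarrow> real \<Rightarrow> complex" where
  "fser c x = (LINT n|count_space UNIV. c n * cis (of_int n * x))"

lemma fser_integrable:
  assumes "integrable (count_space UNIV) c"
  shows "integrable (count_space UNIV) (\<lambda>n. c n * cis (of_int n * x))"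
  by (rule Bochner_Integration.integrable_bound[OF assms]) (auto simp: norm_mult)

lemma measurable_fser [measurable (raw)]:
  assumes [measurable]: "\<And>n. (\<lambda>p. c p n) \<in> borel_measurable M" "X \<in> borel_measurable M"
  shows "(\<lambda>p. fser (c p) (X p)) \<in> borel_measurable M"
proof -
  interpret sigma_finite_measure "count_space (UNIV::int set)" by (rule sigma_finite_int)
  have [measurable]: "cis \<in> borel_measurable borel"
    by (intro borel_measurable_continuous_onI continuous_intros)
  show ?thesis unfolding fser_def by measurable
qed

lemma periodic_fser: "fser c (x + 2 * pi) = fser c x"
proof -
  have "cis (of_int n * (x + 2 * pi)) = cis (of_int n * x)" for n :: int
    by (simp add: distrib_left mult.commute flip: cis_mult)
       (metis cis_multiple_2pi Ints_of_int mult.commute mult.assoc mult.right_neutral)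
  then show ?thesis by (simp add: fser_def)
qed

text \<open>Conjugation and the reflection n -> -n commute with the integral even where it takes its
  default value 0. Hence no summability is required, and the result can be applied at every
  time.\<close>

lemma fser_real:
  assumes "\<And>n. c (- n) = cnj (c n)"
  shows "fser c x = of_real (Re (fser c x))"
proof -
  have "cnj (fser c x) = (LINT n|count_space UNIV. cnj (c n * cis (of_int n * x)))"
    unfolding fser_def by (rule Bochner_Integration.integral_cnj[symmetric])
  also have "\<dots> = (LINT n|count_space UNIV. c (- n) * cis (of_int (- n) * x))"
    by (simp add: assms cis_cnj)
  also have "\<dots> = fser c x"
    unfolding fser_def by (rule integral_int_neg)
  finally show ?thesis by (metis Reals_cnj_iff of_real_Re)
qed

lemma fser_add:
  assumes "integrable (count_space UNIV) c" "integrable (count_space UNIV) d"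
  shows "fser (\<lambda>n. c n + d n) x = fser c x + fser d x"
  unfolding fser_def
  by (simp add: distrib_right Bochner_Integration.integral_add fser_integrable assms)

lemma fser_cmult: "fser (\<lambda>n. k * c n) x = k * fser c x"
  by (simp add: fser_def mult.assoc)

lemma integrable_conv:
  fixes c d :: "int \<Rightarrow> complex"
  assumes "integrable (count_space UNIV) c" "integrable (count_space UNIV) d"
  shows "integrable (count_space UNIV \<Otimes>\<^sub>M count_space UNIV) (\<lambda>(n, m). c (n - m) * d m)"
proof (rule integrableI_bounded)
  interpret sigma_finite_measure "count_space (UNIV::int set)" by (rule sigma_finite_int)
  have "(\<integral>\<^sup>+ p. ennreal (norm (case p of (n, m) \<Rightarrow> c (n - m) * d m)) \<partial>(count_space UNIV \<Otimes>\<^sub>M count_space UNIV))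
     = (\<integral>\<^sup>+n. (\<integral>\<^sup>+m. ennreal (cmod (c (n - m))) * ennreal (cmod (d m)) \<partial>count_space UNIV) \<partial>count_space UNIV)"
    by (subst nn_integral_fst[symmetric]) (simp_all add: norm_mult ennreal_mult)
  also have "\<dots> < \<infinity>"
    using assms nn_integral_int_conv[of "\<lambda>n. ennreal (cmod (c n))" "\<lambda>n. ennreal (cmod (d n))"]
    by (simp add: ennreal_mult_less_top integrable_iff_bounded)
  finally show "(\<integral>\<^sup>+ p. ennreal (norm (case p of (n, m) \<Rightarrow> c (n - m) * d m)) \<partial>(count_space UNIV \<Otimes>\<^sub>M count_space UNIV)) < \<infinity>" .
qed simp

lemma integrable_conv_fst:
  fixes c d :: "int \<Rightarrow> complex"
  assumes "integrable (count_space UNIV) c" "integrable (count_space UNIV) d"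
  shows "integrable (count_space UNIV) (\<lambda>n. LINT m|count_space UNIV. c (n - m) * d m)"
proof -
  interpret pair_sigma_finite "count_space (UNIV::int set)" "count_space (UNIV::int set)"
    by (intro pair_sigma_finite.intro sigma_finite_int)
  show ?thesis using integrable_fst[OF integrable_conv[OF assms]] by simp
qed

text \<open>The Cauchy product: the phases of indices n - m and m multiply to that of n, so a
  translation of the inner sum and Fubini suffice.\<close>

lemma fser_mult:
  assumes "integrable (count_space UNIV) c" "integrable (count_space UNIV) d"
  shows "fser c x * fser d x = fser (\<lambda>n. LINT m|count_space UNIV. c (n - m) * d m) x"
proof -
  interpret pair_sigma_finite "count_space (UNIV::int set)" "count_space (UNIV::int set)"
    by (intro pair_sigma_finite.intro sigma_finite_int)
  let ?c = "\<lambda>n. c n * cis (of_int n * x)" and ?d = "\<lambda>n. d n * cis (of_int n * x)"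
  have "fser c x * fser d x = (LINT m|count_space UNIV. fser c x * ?d m)"
    by (simp add: fser_def[of d])
  also have "\<dots> = (LINT m|count_space UNIV. (LINT n|count_space UNIV. ?c (n - m) * ?d m))"
    by (simp only: integral_mult_left_zero integral_int_shift[of ?c] fser_def)
  also have "\<dots> = (LINT n|count_space UNIV. (LINT m|count_space UNIV. ?c (n - m) * ?d m))"
    using integrable_conv[OF fser_integrable[OF assms(1)] fser_integrable[OF assms(2)]]
    by (intro Fubini_integral) simp
  also have "\<dots> = (LINT n|count_space UNIV. (LINT m|count_space UNIV. c (n - m) * d m * cis (of_int n * x)))"
  proof -
    have "?c (n - m) * ?d m = c (n - m) * d m * cis (of_int n * x)" for n m
      by (simp add: mult_ac cis_mult) (simp add: algebra_simps)
    then show ?thesis by (simp only:)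
  qed
  finally show ?thesis by (simp add: fser_def)
qed

section \<open>Integration of Fourier series over one period\<close>

lemma set_integral_FTC:
  fixes F f :: "real \<Rightarrow> 'a::euclidean_space"
  assumes "a \<le> b" "\<And>x. (F has_vector_derivative f x) (at x)" "continuous_on UNIV f"
  shows "(LINT x:{a..b}|lborel. f x) = F b - F a"
  unfolding set_lebesgue_integral_def
  using assms by (intro integral_FTC_Icc) (auto intro: has_vector_derivative_at_within continuous_on_subset)

lemma set_integrable_continuous:
  fixes f :: "real \<Rightarrow> 'a::euclidean_space"
  assumes "continuous_on UNIV f"
  shows "set_integrable lborel {a..b} f"
  unfolding set_integrable_def
  by (rule borel_integrable_compact) (auto intro: continuous_on_subset[OF assms])

lemma has_vector_derivative_cis_mult:
  "((\<lambda>x. cis (k * x)) has_vector_derivative \<i> * of_real k * cis (k * x)) (at x)"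
  unfolding has_vector_derivative_def
  by (rule has_derivative_eq_rhs) (auto intro!: derivative_eq_intros simp: scaleR_conv_of_real mult_ac)

lemma integral_cis:
  "(LINT x:{0..2*pi}|lborel. cis (of_int k * x)) = (if k = 0 then 2 * of_real pi else 0)"
proof (cases "k = 0")
  case True
  then show ?thesis by (simp add: set_lebesgue_integral_def scaleR_conv_of_real)
next
  case False
  have "((\<lambda>x. 1 / (\<i> * of_int k) * cis (of_int k * x)) has_vector_derivative
      1 / (\<i> * of_int k) * (\<i> * of_real (of_int k) * cis (of_int k * x))) (at x)" for x
    by (intro has_vector_derivative_mult_right has_vector_derivative_cis_mult)
  then have "((\<lambda>x. cis (of_int k * x) / (\<i> * of_int k)) has_vector_derivative cis (of_int k * x)) (at x)" for x
    using False by simp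
  then have "(LINT x:{0..2*pi}|lborel. cis (of_int k * x)) = 
    cis (of_int k * (2*pi)) / (\<i> * of_int k) - cis (of_int k * 0) / (\<i> * of_int k)"
    by (intro set_integral_FTC) (auto intro!: continuous_intros)
  moreover have "cis (of_int k * (2*pi)) = 1"
    using cis_multiple_2pi[of "of_int k"] by (simp add: mult_ac)
  ultimately show ?thesis using False by simp
qed

text \<open>The product |c n| |g x| is integrable over the product measure, so the series may be
  integrated term by term against any integrable g.\<close>

lemma fser_fubini:
  fixes g :: "real \<Rightarrow> complex"
  assumes c: "integrable (count_space UNIV) c" and g: "set_integrable lborel {a..b} g"
  shows "set_integrable lborel {a..b} (\<lambda>x. fser c x * g x)"
    and "(LINT x:{a..b}|lborel. fser c x * g x)
       = (LINT n|count_space UNIV. c n * (LINT x:{a..b}|lborel. cis (of_int n * x) * g x))"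
proof -
  interpret pair_sigma_finite lborel "count_space (UNIV::int set)"
    by (rule pair_sigma_finite_lborel_int)
  have [measurable]: "cis \<in> borel_measurable borel"
    by (intro borel_measurable_continuous_onI continuous_intros)
  let ?F = "\<lambda>(x, n). c n * cis (of_int n * x) * (indicator {a..b} x *\<^sub>R g x)"
  have [measurable]: "(\<lambda>x. indicator {a..b} x *\<^sub>R g x) \<in> borel_measurable borel"
    using borel_measurable_integrable[OF g[unfolded set_integrable_def]] by simp
  have int: "integrable (lborel \<Otimes>\<^sub>M count_space UNIV) ?F"
  proof (rule integrableI_bounded)
    show F [measurable]: "?F \<in> borel_measurable (lborel \<Otimes>\<^sub>M count_space UNIV)" by measurable
    have n: "ennreal (norm (?F (x, n))) = ennreal (norm (c n)) * ennreal (norm (indicator {a..b} x *\<^sub>R g x))" for x n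
      by (simp add: norm_mult flip: ennreal_mult)
    have "(\<integral>\<^sup>+p. ennreal (norm (?F p)) \<partial>(lborel \<Otimes>\<^sub>M count_space UNIV))
        = (\<integral>\<^sup>+x. (\<integral>\<^sup>+n. ennreal (norm (c n)) * ennreal (norm (indicator {a..b} x *\<^sub>R g x)) \<partial>count_space UNIV) \<partial>lborel)"
      unfolding n[symmetric] by (intro M2.nn_integral_fst[symmetric]) measurable
    also have "\<dots> = (\<integral>\<^sup>+n. ennreal (norm (c n)) \<partial>count_space UNIV) * (\<integral>\<^sup>+x. ennreal (norm (indicator {a..b} x *\<^sub>R g x)) \<partial>lborel)"
      by (subst nn_integral_multc, simp, subst nn_integral_cmult) measurable
    also have "\<dots> < \<infinity>"
      using c g unfolding integrable_iff_bounded set_integrable_def by (simp add: ennreal_mult_less_top)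
    finally show "(\<integral>\<^sup>+p. ennreal (norm (?F p)) \<partial>(lborel \<Otimes>\<^sub>M count_space UNIV)) < \<infinity>" .
  qed
  have eq: "(LINT n|count_space UNIV. ?F (x, n)) = indicator {a..b} x *\<^sub>R (fser c x * g x)" for x
    by (simp add: fser_def)
  show "set_integrable lborel {a..b} (\<lambda>x. fser c x * g x)"
    using integrable_fst[OF int] unfolding eq[unfolded prod.case] prod.case set_integrable_def .
  have "(LINT x:{a..b}|lborel. fser c x * g x) = (LINT x|lborel. (LINT n|count_space UNIV. ?F (x, n)))"
    unfolding eq set_lebesgue_integral_def ..
  also have "\<dots> = (LINT n|count_space UNIV. (LINT x|lborel. ?F (x, n)))"
    using int by (intro Fubini_integral[symmetric]) simp
  also have "\<dots> = (LINT n|count_space UNIV. c n * (LINT x:{a..b}|lborel. cis (of_int n * x) * g x))"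
    by (simp add: set_lebesgue_integral_def mult.assoc flip: integral_mult_right_zero)
  finally show "(LINT x:{a..b}|lborel. fser c x * g x)
       = (LINT n|count_space UNIV. c n * (LINT x:{a..b}|lborel. cis (of_int n * x) * g x))" .
qed

lemma fourier_coeff_fser:
  assumes c: "integrable (count_space UNIV) c" and f: "\<And>x. complex_of_real (f x) = fser c x"
  shows "fourier_coeff f n = c n"
proof -
  have "(LINT x:{0..2*pi}|lborel. fser c x * cis (of_int (- n) * x))
     = (LINT m|count_space UNIV. c m * (LINT x:{0..2*pi}|lborel. cis (of_int m * x) * cis (of_int (- n) * x)))"
    by (intro fser_fubini c set_integrable_continuous continuous_intros)
  also have "\<dots> = (LINT m|count_space UNIV. c m * (if m = n then 2 * of_real pi else 0))"
  proof -
    have "cis (of_int m * x) * cis (of_int (- n) * x) = cis (of_int (m - n) * x)" for m x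
      by (simp add: cis_mult algebra_simps)
    then show ?thesis
      by (simp only: integral_cis) simp
  qed
  also have "\<dots> = (LINT m|count_space UNIV. (2 * of_real pi * c n) * of_real (indicator {n} m))"
    by (intro Bochner_Integration.integral_cong) auto
  also have "\<dots> = 2 * of_real pi * c n"
    by (simp del: of_real_indicator)
  finally have "(LINT x:{0..2*pi}|lborel. fser c x * cis (of_int (- n) * x)) = 2 * of_real pi * c n" .
  moreover have "exp (- \<i> * of_int n * complex_of_real x) = cis (of_int (- n) * x)" for x
    by (simp add: cis_conv_exp mult.assoc)
  ultimately show ?thesis
    by (simp only: fourier_coeff_def f) simp
qed

lemma cis_by_parts:
  fixes \<psi> :: "real \<Rightarrow> complex"
  assumes d: "\<And>x. (\<psi> has_vector_derivative \<psi>' x) (at x)" and cont: "continuous_on UNIV \<psi>'"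
    and per: "\<psi> (2 * pi) = \<psi> 0"
  shows "(LINT x:{0..2*pi}|lborel. cis (of_int n * x) * \<psi>' x)
       = - (\<i> * of_int n * (LINT x:{0..2*pi}|lborel. cis (of_int n * x) * \<psi> x))"
proof -
  have [continuous_intros]: "continuous_on UNIV \<psi>"
    using d by (meson continuous_at_imp_continuous_on has_vector_derivative_continuous)
  have dc: "((\<lambda>x. cis (of_int n * x)) has_vector_derivative \<i> * of_int n * cis (of_int n * x)) (at x)" for x
    using has_vector_derivative_cis_mult[of "of_int n" x] by simp
  have "((\<lambda>x. cis (of_int n * x) * \<psi> x) has_vector_derivative
      cis (of_int n * x) * \<psi>' x + \<i> * of_int n * cis (of_int n * x) * \<psi> x) (at x)" for x
    by (rule has_vector_derivative_mult[OF dc d])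
  then have "(LINT x:{0..2*pi}|lborel. cis (of_int n * x) * \<psi>' x + \<i> * of_int n * cis (of_int n * x) * \<psi> x)
     = cis (of_int n * (2*pi)) * \<psi> (2*pi) - cis (of_int n * 0) * \<psi> 0"
    by (intro set_integral_FTC) (auto intro!: continuous_intros cont)
  also have "\<dots> = 0"
    using cis_multiple_2pi[of "of_int n"] per by (simp add: mult_ac)
  finally have "(LINT x:{0..2*pi}|lborel. cis (of_int n * x) * \<psi>' x) +
     (LINT x:{0..2*pi}|lborel. \<i> * of_int n * (cis (of_int n * x) * \<psi> x)) = 0"
    by (subst (asm) set_integral_add)
       (auto intro!: set_integrable_continuous continuous_intros cont simp: mult.assoc)
  then show ?thesis
    by (simp add: eq_neg_iff_add_eq_0)
qed

text \<open>Integration by parts is carried out on each exponential separately. The sum of the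
  series is therefore never differentiated; summability of the coefficients i n c_n takes the place
  of differentiability.\<close>

lemma fser_by_parts:
  fixes \<psi> :: "real \<Rightarrow> complex"
  assumes c: "integrable (count_space UNIV) c" "integrable (count_space UNIV) (\<lambda>n. \<i> * of_int n * c n)"
    and d: "\<And>x. (\<psi> has_vector_derivative \<psi>' x) (at x)" and cont: "continuous_on UNIV \<psi>'"
    and per: "\<psi> (2 * pi) = \<psi> 0"
  shows "(LINT x:{0..2*pi}|lborel. fser c x * \<psi>' x)
       = - (LINT x:{0..2*pi}|lborel. fser (\<lambda>n. \<i> * of_int n * c n) x * \<psi> x)"
proof -
  have "continuous_on UNIV \<psi>"
    using d by (meson continuous_at_imp_continuous_on has_vector_derivative_continuous)
  then have "(LINT x:{0..2*pi}|lborel. fser (\<lambda>n. \<i> * of_int n * c n) x * \<psi> x)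
     = (LINT n|count_space UNIV. \<i> * of_int n * c n * (LINT x:{0..2*pi}|lborel. cis (of_int n * x) * \<psi> x))"
    by (intro fser_fubini c set_integrable_continuous)
  also have "\<dots> = (LINT n|count_space UNIV. - (c n * (LINT x:{0..2*pi}|lborel. cis (of_int n * x) * \<psi>' x)))"
    unfolding cis_by_parts[OF d cont per]
    by (intro Bochner_Integration.integral_cong refl) algebra
  also have "\<dots> = - (LINT x:{0..2*pi}|lborel. fser c x * \<psi>' x)"
    unfolding fser_fubini(2)[OF c(1) set_integrable_continuous[OF cont]] by simp
  finally show ?thesis by simp
qed

section \<open>Duhamel's formula and integration by parts in time\<close>

lemma set_integral_scaleR_const:
  fixes f :: "real \<Rightarrow> real" and c :: "'a::{banach, second_countable_topology}"
  assumes "set_integrable M A f"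
  shows "(LINT t:A|M. f t *\<^sub>R c) = (LINT t:A|M. f t) *\<^sub>R c"
  using integral_scaleR_left[of c M "\<lambda>t. indicator A t * f t"] assms
  by (simp add: set_lebesgue_integral_def set_integrable_def)

text \<open>Exchange of the order of integration over the triangle 0 \<le> s \<le> r \<le> t.
  Duhamel's formula and the integration by parts in time both rest on it, with the kernels exp (- c
  (r - s)) and \<phi>' r.\<close>

lemma triangle_fubini:
  fixes g :: "real \<Rightarrow> complex" and K :: "real \<Rightarrow> real \<Rightarrow> real"
  assumes g: "set_integrable lborel {0..t} g" and K: "continuous_on UNIV (\<lambda>(r, s). K r s)"
  shows "set_integrable lborel {0..t} (\<lambda>r. LINT s:{0..r}|lborel. K r s *\<^sub>R g s)"
    and "(LINT r:{0..t}|lborel. (LINT s:{0..r}|lborel. K r s *\<^sub>R g s))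
       = (LINT s:{0..t}|lborel. (LINT r:{s..t}|lborel. K r s) *\<^sub>R g s)"
proof -
  \<comment> \<open>Nothing is known about g outside the interval; its extension by zero is
    measurable and integrable on the whole line.\<close>
  define G where "G s = indicator {0..t} s *\<^sub>R g s" for s
  have G: "integrable lborel G"
    using g unfolding set_integrable_def G_def .
  have [measurable]: "G \<in> borel_measurable borel"
    using borel_measurable_integrable[OF G] by simp
  have [measurable]: "(\<lambda>(r, s). K r s) \<in> borel_measurable (borel \<Otimes>\<^sub>M borel)"
    using borel_measurable_continuous_onI[OF K] by (simp add: borel_prod)
  have "bounded ((\<lambda>(r, s). K r s) ` ({0..t} \<times> {0..t}))"
    by (intro compact_imp_bounded compact_continuous_image compact_Times continuous_on_subset[OF K]) auto
  then obtain B where "\<forall>x\<in>(\<lambda>(r, s). K r s) ` ({0..t} \<times> {0..t}). norm x \<le> B"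
    unfolding bounded_iff by blast
  then have B: "\<bar>K r s\<bar> \<le> B" if "r \<in> {0..t}" "s \<in> {0..t}" for r s
    using that by force
  let ?F = "\<lambda>(r, s). if 0 \<le> s \<and> s \<le> r \<and> r \<le> t then K r s *\<^sub>R G s else 0"
  have int: "integrable (lborel \<Otimes>\<^sub>M lborel) ?F"
  proof (rule integrableI_bounded)
    show [measurable]: "?F \<in> borel_measurable (lborel \<Otimes>\<^sub>M lborel)" by measurable
    have "(\<integral>\<^sup>+p. ennreal (norm (?F p)) \<partial>(lborel \<Otimes>\<^sub>M lborel))
        = (\<integral>\<^sup>+r. (\<integral>\<^sup>+s. ennreal (norm (?F (r, s))) \<partial>lborel) \<partial>lborel)"
      by (intro lborel.nn_integral_fst[symmetric]) measurable
    also have "\<dots> \<le> (\<integral>\<^sup>+r. (\<integral>\<^sup>+s. (ennreal B * indicator {0..t} r) * ennreal (norm (G s)) \<partial>lborel) \<partial>lborel)"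
    proof (intro nn_integral_mono)
      fix r s
      show "ennreal (norm (?F (r, s))) \<le> (ennreal B * indicator {0..t} r) * ennreal (norm (G s))"
        using B[of r s] order_trans[OF abs_ge_zero B[of r s]]
        by (auto simp: indicator_def simp flip: ennreal_mult intro!: ennreal_leI mult_right_mono)
    qed
    also have "\<dots> = (\<integral>\<^sup>+r. (ennreal B * indicator {0..t} r) \<partial>lborel) * (\<integral>\<^sup>+s. ennreal (norm (G s)) \<partial>lborel)"
      by (subst nn_integral_cmult, simp, subst nn_integral_multc) measurable
    also have "\<dots> < \<infinity>"
      using G unfolding integrable_iff_bounded
      by (simp add: nn_integral_cmult_indicator ennreal_mult_less_top emeasure_lborel_Icc_eq)
    finally show "(\<integral>\<^sup>+p. ennreal (norm (?F p)) \<partial>(lborel \<Otimes>\<^sub>M lborel)) < \<infinity>" .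
  qed
  have eq1: "(LINT s|lborel. ?F (r, s)) = indicator {0..t} r *\<^sub>R (LINT s:{0..r}|lborel. K r s *\<^sub>R g s)" for r
  proof (cases "r \<in> {0..t}")
    case True
    then show ?thesis unfolding set_lebesgue_integral_def G_def
      by (auto simp: indicator_def intro!: Bochner_Integration.integral_cong)
  next
    case False
    then have "(\<lambda>s. ?F (r, s)) = (\<lambda>s. 0)" by auto
    then show ?thesis using False by simp
  qed
  have eq2: "(LINT r|lborel. ?F (r, s)) = indicator {0..t} s *\<^sub>R ((LINT r:{s..t}|lborel. K r s) *\<^sub>R g s)" for s
  proof -
    have "(LINT r|lborel. ?F (r, s)) = (LINT r|lborel. (indicator {s..t} r * K r s) *\<^sub>R (if 0 \<le> s then G s else 0))"
      by (intro Bochner_Integration.integral_cong) (auto simp: indicator_def)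
    also have "\<dots> = (LINT r|lborel. (indicator {s..t} r * K r s)) *\<^sub>R (if 0 \<le> s then G s else 0)"
    proof (rule integral_scaleR_left)
      have "continuous_on UNIV (\<lambda>r. K r s)"
        using continuous_on_compose2[OF K, of UNIV "\<lambda>r. (r, s)"] by (simp add: continuous_on_Pair)
      from set_integrable_continuous[OF this, of s t]
      show "integrable lborel (\<lambda>r. indicator {s..t} r * K r s)"
        by (simp add: set_integrable_def)
    qed
    also have "\<dots> = indicator {0..t} s *\<^sub>R ((LINT r:{s..t}|lborel. K r s) *\<^sub>R g s)"
      by (simp add: G_def set_lebesgue_integral_def indicator_def)
    finally show ?thesis .
  qed
  show "set_integrable lborel {0..t} (\<lambda>r. LINT s:{0..r}|lborel. K r s *\<^sub>R g s)"
    using lborel_pair.integrable_fst[OF int] unfolding eq1[unfolded prod.case] prod.case set_integrable_def .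
  show "(LINT r:{0..t}|lborel. (LINT s:{0..r}|lborel. K r s *\<^sub>R g s))
       = (LINT s:{0..t}|lborel. (LINT r:{s..t}|lborel. K r s) *\<^sub>R g s)"
    using lborel_pair.Fubini_integral[of "\<lambda>r s. ?F (r, s)"] int
    unfolding eq1 eq2 set_lebesgue_integral_def[of _ "{0..t}"] by simp
qed

text \<open>Turns the exponential form into the integrated differential equation without
  differentiating h, as g is merely integrable. Exchanging the integrals produces c \<integral> exp
  (- c (r - s)) dr over [s, t], which is 1 - exp (- c (t - s)), so that the kernels
  recombine.\<close>

lemma duhamel_integral:
  fixes g :: "real \<Rightarrow> complex" and c :: real
  assumes g: "set_integrable lborel {0..t} g" and t: "0 \<le> t"
    and h: "\<And>r. h r = exp (- c * r) *\<^sub>R h0 + (LINT s:{0..r}|lborel. exp (- c * (r - s)) *\<^sub>R g s)"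
  shows "set_integrable lborel {0..t} h"
    and "h t + c *\<^sub>R (LINT r:{0..t}|lborel. h r) = h0 + (LINT s:{0..t}|lborel. g s)"
proof -
  have cont: "continuous_on UNIV (\<lambda>(r, s). exp (- c * (r - s)))"
    by (simp add: case_prod_beta) (intro continuous_intros)
  note tri = triangle_fubini[OF g cont]
  have i1: "set_integrable lborel {0..t} (\<lambda>r. exp (- c * r) *\<^sub>R h0)"
    by (intro set_integrable_continuous continuous_intros)
  show "set_integrable lborel {0..t} h"
    using set_integral_add(1)[OF i1 tri(1)] by (simp add: h[abs_def])
  have ex: "c * (LINT r:{s..t}|lborel. exp (- c * (r - s))) = 1 - exp (- c * (t - s))" if "s \<le> t" for s
  proof -
    have "(LINT r:{s..t}|lborel. c * exp (- c * (r - s))) = - exp (- c * (t - s)) - (- exp (- c * (s - s)))"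
      using that
      by (intro set_integral_FTC) (auto intro!: derivative_eq_intros continuous_intros
          simp flip: has_real_derivative_iff_has_vector_derivative)
    then show ?thesis by simp
  qed
  have "(LINT r:{0..t}|lborel. h r) = (LINT r:{0..t}|lborel. exp (- c * r) *\<^sub>R h0)
      + (LINT s:{0..t}|lborel. (LINT r:{s..t}|lborel. exp (- c * (r - s))) *\<^sub>R g s)"
    using set_integral_add(2)[OF i1 tri(1)] tri(2) by (simp add: h[abs_def])
  moreover have "(LINT r:{0..t}|lborel. exp (- c * r) *\<^sub>R h0) = (LINT r:{0..t}|lborel. exp (- c * r)) *\<^sub>R h0"
    by (intro set_integral_scaleR_const set_integrable_continuous continuous_intros)
  moreover have "c *\<^sub>R (LINT s:{0..t}|lborel. (LINT r:{s..t}|lborel. exp (- c * (r - s))) *\<^sub>R g s)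
     = (LINT s:{0..t}|lborel. g s - exp (- c * (t - s)) *\<^sub>R g s)"
    unfolding set_integral_scaleR_right[symmetric]
    by (intro set_lebesgue_integral_cong) (auto simp only: scaleR_scaleR ex atLeastAtMost_iff scaleR_diff_left scaleR_one, simp)
  \<comment> \<open>Integrability is required to split the integral of the difference; the sign of c
    is unrestricted, hence the bound with |c|.\<close>
  moreover have "set_integrable lborel {0..t} (\<lambda>s. exp (- c * (t - s)) *\<^sub>R g s)"
  proof (rule set_integrable_bound[where f="\<lambda>s. exp (\<bar>c\<bar> * t) *\<^sub>R g s"])
    show "set_integrable lborel {0..t} (\<lambda>s. exp (\<bar>c\<bar> * t) *\<^sub>R g s)"
      using g by (intro set_integrable_scaleR_right) auto
    show "set_borel_measurable lborel {0..t} (\<lambda>s. exp (- c * (t - s)) *\<^sub>R g s)"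
    proof -
      have [measurable]: "(\<lambda>x. indicator {0..t} x *\<^sub>R g x) \<in> borel_measurable borel"
        using borel_measurable_integrable[OF g[unfolded set_integrable_def]] by simp
      have "(\<lambda>s. exp (- c * (t - s)) *\<^sub>R (indicator {0..t} s *\<^sub>R g s)) \<in> borel_measurable borel"
        by measurable
      then show ?thesis by (simp add: set_borel_measurable_def mult.commute)
    qed
    have "- c * (t - s) \<le> \<bar>c\<bar> * t" if "s \<in> {0..t}" for s
    proof -
      have "- c * (t - s) \<le> \<bar>c\<bar> * (t - s)" using that by (intro mult_right_mono) auto
      also have "\<dots> \<le> \<bar>c\<bar> * t" using that by (intro mult_left_mono) auto
      finally show ?thesis .
    qed
    then show "AE x in lborel. x \<in> {0..t} \<longrightarrow> norm (exp (- c * (t - x)) *\<^sub>R g x) \<le> norm (exp (\<bar>c\<bar> * t) *\<^sub>R g x)"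
      by (auto intro!: mult_right_mono)
  qed
  ultimately show "h t + c *\<^sub>R (LINT r:{0..t}|lborel. h r) = h0 + (LINT s:{0..t}|lborel. g s)"
    using ex[of 0] t g
    by (simp add: h scaleR_add_right set_integral_diff algebra_simps flip: scaleR_add_left)
qed

text \<open>Here h is a primitive of an integrable function and need not be differentiable
  everywhere. Writing \<phi> t - \<phi> s as an integral of \<phi>' and exchanging the integrals
  replaces the product rule.\<close>

lemma time_by_parts:
  fixes g :: "real \<Rightarrow> complex" and \<phi> :: "real \<Rightarrow> real"
  assumes g: "set_integrable lborel {0..t} g" and t: "0 \<le> t"
    and h: "\<And>r. r \<in> {0..t} \<Longrightarrow> h r = h0 + (LINT s:{0..r}|lborel. g s)"
    and d: "\<And>s. (\<phi> has_real_derivative \<phi>' s) (at s)" and cont: "continuous_on UNIV \<phi>'"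
  shows "set_integrable lborel {0..t} (\<lambda>r. \<phi>' r *\<^sub>R h r)"
    and "set_integrable lborel {0..t} (\<lambda>s. \<phi> s *\<^sub>R g s)"
    and "\<phi> t *\<^sub>R h t - \<phi> 0 *\<^sub>R h0 - (LINT r:{0..t}|lborel. \<phi>' r *\<^sub>R h r) = (LINT s:{0..t}|lborel. \<phi> s *\<^sub>R g s)"
proof -
  have c\<phi>: "continuous_on UNIV \<phi>"
    using d by (meson DERIV_isCont continuous_at_imp_continuous_on)
  have cont2: "continuous_on UNIV (\<lambda>(r, s). \<phi>' r)"
    by (simp add: case_prod_beta) (intro continuous_intros continuous_on_compose2[OF cont]; simp)
  note tri = triangle_fubini[OF g cont2]
  have i1: "set_integrable lborel {0..t} (\<lambda>r. \<phi>' r *\<^sub>R h0)"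
    by (intro set_integrable_continuous continuous_intros cont)
  have hh: "\<phi>' r *\<^sub>R h r = \<phi>' r *\<^sub>R h0 + (LINT s:{0..r}|lborel. \<phi>' r *\<^sub>R g s)" if "r \<in> {0..t}" for r
    using h[OF that] by (simp add: scaleR_add_right)
  show "set_integrable lborel {0..t} (\<lambda>r. \<phi>' r *\<^sub>R h r)"
    using set_integral_add(1)[OF i1 tri(1)] by (subst set_integrable_cong[OF refl refl hh]) auto
  have ftc: "(LINT r:{s..t}|lborel. \<phi>' r) = \<phi> t - \<phi> s" if "s \<le> t" for s
    using that d by (intro set_integral_FTC cont) (auto simp flip: has_real_derivative_iff_has_vector_derivative)
  show i\<phi>: "set_integrable lborel {0..t} (\<lambda>s. \<phi> s *\<^sub>R g s)"
  proof -
    have "bounded (\<phi> ` {0..t})"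
      by (intro compact_imp_bounded compact_continuous_image continuous_on_subset[OF c\<phi>]) auto
    then obtain B where "\<forall>x\<in>\<phi> ` {0..t}. norm x \<le> B" unfolding bounded_iff by blast
    then have B: "\<bar>\<phi> s\<bar> \<le> B" if "s \<in> {0..t}" for s using that by auto
    have [measurable]: "(\<lambda>x. indicator {0..t} x *\<^sub>R g x) \<in> borel_measurable borel"
      using borel_measurable_integrable[OF g[unfolded set_integrable_def]] by simp
    have [measurable]: "\<phi> \<in> borel_measurable borel"
      by (rule borel_measurable_continuous_onI[OF c\<phi>])
    show ?thesis
    proof (rule set_integrable_bound[where f="\<lambda>s. B *\<^sub>R g s"])
      show "set_integrable lborel {0..t} (\<lambda>s. B *\<^sub>R g s)"
        using g by (intro set_integrable_scaleR_right) auto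
      have "(\<lambda>s. \<phi> s *\<^sub>R (indicator {0..t} s *\<^sub>R g s)) \<in> borel_measurable borel"
        by measurable
      then show "set_borel_measurable lborel {0..t} (\<lambda>s. \<phi> s *\<^sub>R g s)"
        by (simp add: set_borel_measurable_def mult.commute)
      show "AE x in lborel. x \<in> {0..t} \<longrightarrow> norm (\<phi> x *\<^sub>R g x) \<le> norm (B *\<^sub>R g x)"
        using B by (auto intro!: mult_right_mono order_trans[OF B])
    qed
  qed
  have "(LINT s:{0..t}|lborel. (LINT r:{s..t}|lborel. \<phi>' r) *\<^sub>R g s)
     = \<phi> t *\<^sub>R (LINT s:{0..t}|lborel. g s) - (LINT s:{0..t}|lborel. \<phi> s *\<^sub>R g s)"
    using set_integral_diff[OF set_integrable_scaleR_right[OF g, of "\<phi> t"] i\<phi>]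
    by (subst set_lebesgue_integral_cong[where g="\<lambda>s. \<phi> t *\<^sub>R g s - \<phi> s *\<^sub>R g s"])
       (auto simp: ftc scaleR_diff_left)
  moreover have "(LINT r:{0..t}|lborel. \<phi>' r *\<^sub>R h r) = (LINT r:{0..t}|lborel. \<phi>' r *\<^sub>R h0)
      + (LINT s:{0..t}|lborel. (LINT r:{s..t}|lborel. \<phi>' r) *\<^sub>R g s)"
    using set_integral_add(2)[OF i1 tri(1)] tri(2)
    by (subst set_lebesgue_integral_cong[OF _ allI[OF impI[OF hh]]]) auto
  moreover have "(LINT r:{0..t}|lborel. \<phi>' r *\<^sub>R h0) = (\<phi> t - \<phi> 0) *\<^sub>R h0"
    unfolding ftc[OF t, symmetric] by (intro set_integral_scaleR_const set_integrable_continuous cont)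
  ultimately show "\<phi> t *\<^sub>R h t - \<phi> 0 *\<^sub>R h0 - (LINT r:{0..t}|lborel. \<phi>' r *\<^sub>R h r) = (LINT s:{0..t}|lborel. \<phi> s *\<^sub>R g s)"
    using t by (simp add: h algebra_simps)
qed

lemma nn_integral_exp:
  assumes "s \<le> t" "0 \<le> c"
  shows "ennreal (exp (- c * (t - s))) + ennreal c * (\<integral>\<^sup>+r\<in>{s..t}. ennreal (exp (- c * (r - s))) \<partial>lborel) = 1"
proof -
  have "ennreal c * (\<integral>\<^sup>+r\<in>{s..t}. ennreal (exp (- c * (r - s))) \<partial>lborel)
      = (\<integral>\<^sup>+r. ennreal (c * exp (- c * (r - s))) * indicator {s..t} r \<partial>lborel)"
    using assms by (simp add: nn_integral_cmult[symmetric] ennreal_mult mult.assoc)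
  also have "\<dots> = ennreal (- exp (- c * (t - s)) - (- exp (- c * (s - s))))"
    using assms by (intro nn_integral_FTC_Icc) (auto intro!: derivative_eq_intros)
  finally show ?thesis
    using assms by (simp flip: ennreal_plus)
qed

text \<open>The counterpart of \<open>duhamel_integral\<close> for nonnegative functions: Tonelli
  replaces Fubini, both sides may be infinite, and the dissipation stands on the left as a summand
  because nothing can be subtracted. It requires c \<ge> 0.\<close>

lemma nn_duhamel:
  fixes g h :: "real \<Rightarrow> ennreal"
  assumes [measurable]: "g \<in> borel_measurable borel" and c: "0 \<le> c" "0 \<le> t"
    and h: "\<And>r. 0 \<le> r \<Longrightarrow> h r = ennreal (exp (- c * r)) * h0 + (\<integral>\<^sup>+s\<in>{0..r}. ennreal (exp (- c * (r - s))) * g s \<partial>lborel)"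
  shows "h t + ennreal c * (\<integral>\<^sup>+r\<in>{0..t}. h r \<partial>lborel) = h0 + (\<integral>\<^sup>+s\<in>{0..t}. g s \<partial>lborel)"
proof -
  let ?k = "\<lambda>r s. ennreal (exp (- c * (r - s))) * indicator {0..t} r * indicator {..r} s"
  have m [measurable]: "(\<lambda>(r, s). ?k r s) \<in> borel_measurable (borel \<Otimes>\<^sub>M borel)"
    unfolding indicator_def of_bool_def atMost_iff by measurable
  have tri: "(\<integral>\<^sup>+r\<in>{0..t}. (\<integral>\<^sup>+s\<in>{0..r}. ennreal (exp (- c * (r - s))) * g s \<partial>lborel) \<partial>lborel)
     = (\<integral>\<^sup>+s\<in>{0..t}. (\<integral>\<^sup>+r\<in>{s..t}. ennreal (exp (- c * (r - s))) \<partial>lborel) * g s \<partial>lborel)"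
  proof -
    have "(\<integral>\<^sup>+r\<in>{0..t}. (\<integral>\<^sup>+s\<in>{0..r}. ennreal (exp (- c * (r - s))) * g s \<partial>lborel) \<partial>lborel)
       = (\<integral>\<^sup>+r. (\<integral>\<^sup>+s. ?k r s * (g s * indicator {0..t} s) \<partial>lborel) \<partial>lborel)"
      by (intro nn_integral_cong, subst nn_integral_multc[symmetric])
         (auto intro!: nn_integral_cong simp: indicator_def)
    also have "\<dots> = (\<integral>\<^sup>+s. (\<integral>\<^sup>+r. ?k r s * (g s * indicator {0..t} s) \<partial>lborel) \<partial>lborel)"
      by (intro lborel_pair.Fubini') measurable
    also have "\<dots> = (\<integral>\<^sup>+s\<in>{0..t}. (\<integral>\<^sup>+r\<in>{s..t}. ennreal (exp (- c * (r - s))) \<partial>lborel) * g s \<partial>lborel)"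
      by (intro nn_integral_cong, subst mult.assoc, subst nn_integral_multc[symmetric])
         (auto intro!: nn_integral_cong simp: indicator_def)
    finally show ?thesis .
  qed
  have m2 [measurable]: "(\<lambda>r. \<integral>\<^sup>+s\<in>{0..r}. ennreal (exp (- c * (r - s))) * g s \<partial>lborel) \<in> borel_measurable lborel"
    unfolding indicator_def of_bool_def atLeastAtMost_iff by measurable
  have m3 [measurable]: "(\<lambda>s. \<integral>\<^sup>+r\<in>{s..t}. ennreal (exp (- c * (r - s))) \<partial>lborel) \<in> borel_measurable lborel"
    unfolding indicator_def of_bool_def atLeastAtMost_iff by measurable
  have "(\<integral>\<^sup>+r\<in>{0..t}. h r \<partial>lborel) = (\<integral>\<^sup>+r\<in>{0..t}. ennreal (exp (- c * r)) * h0 +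
       (\<integral>\<^sup>+s\<in>{0..r}. ennreal (exp (- c * (r - s))) * g s \<partial>lborel) \<partial>lborel)"
    by (intro nn_integral_cong) (auto simp: h indicator_def)
  also have "\<dots> = (\<integral>\<^sup>+r\<in>{0..t}. ennreal (exp (- c * r)) \<partial>lborel) * h0 +
       (\<integral>\<^sup>+s\<in>{0..t}. (\<integral>\<^sup>+r\<in>{s..t}. ennreal (exp (- c * (r - s))) \<partial>lborel) * g s \<partial>lborel)" (is "?lhs = ?rhs")
  proof -
    have "(\<integral>\<^sup>+r\<in>{0..t}. ennreal (exp (- c * r)) * h0 \<partial>lborel) = (\<integral>\<^sup>+r\<in>{0..t}. ennreal (exp (- c * r)) \<partial>lborel) * h0"
      by (subst nn_integral_multc[symmetric]) (auto simp: mult_ac)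
    moreover have "(\<lambda>r. (\<integral>\<^sup>+s\<in>{0..r}. ennreal (exp (- c * (r - s))) * g s \<partial>lborel) * indicator {0..t} r) \<in> borel_measurable lborel"
      by (intro borel_measurable_times_ennreal m2) simp
    ultimately show "?lhs = ?rhs"
      unfolding distrib_right tri[symmetric] by (subst nn_integral_add) simp_all
  qed
  finally have "h t + ennreal c * (\<integral>\<^sup>+r\<in>{0..t}. h r \<partial>lborel) =
     (ennreal (exp (- c * t)) + ennreal c * (\<integral>\<^sup>+r\<in>{0..t}. ennreal (exp (- c * r)) \<partial>lborel)) * h0 +
     ((\<integral>\<^sup>+s\<in>{0..t}. ennreal (exp (- c * (t - s))) * g s \<partial>lborel) +
      ennreal c * (\<integral>\<^sup>+s\<in>{0..t}. (\<integral>\<^sup>+r\<in>{s..t}. ennreal (exp (- c * (r - s))) \<partial>lborel) * g s \<partial>lborel))"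
    using c by (simp add: h algebra_simps)
  also have "ennreal (exp (- c * t)) + ennreal c * (\<integral>\<^sup>+r\<in>{0..t}. ennreal (exp (- c * r)) \<partial>lborel) = 1"
    using nn_integral_exp[of 0 t c] c by simp
  also have "(\<integral>\<^sup>+s\<in>{0..t}. ennreal (exp (- c * (t - s))) * g s \<partial>lborel) +
      ennreal c * (\<integral>\<^sup>+s\<in>{0..t}. (\<integral>\<^sup>+r\<in>{s..t}. ennreal (exp (- c * (r - s))) \<partial>lborel) * g s \<partial>lborel)
    = (\<integral>\<^sup>+s\<in>{0..t}. (ennreal (exp (- c * (t - s))) + ennreal c * (\<integral>\<^sup>+r\<in>{s..t}. ennreal (exp (- c * (r - s))) \<partial>lborel)) * g s \<partial>lborel)"
  proof -
    let ?X = "\<lambda>s. \<integral>\<^sup>+r\<in>{s..t}. ennreal (exp (- c * (r - s))) \<partial>lborel"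
    have "ennreal c * (\<integral>\<^sup>+s\<in>{0..t}. ?X s * g s \<partial>lborel) = (\<integral>\<^sup>+s. ennreal c * (?X s * g s * indicator {0..t} s) \<partial>lborel)"
      by (intro nn_integral_cmult[symmetric] borel_measurable_times_ennreal m3) simp_all
    moreover have "(\<lambda>s. ennreal c * (?X s * g s * indicator {0..t} s)) \<in> borel_measurable lborel"
      by (intro borel_measurable_times_ennreal m3) simp_all
    ultimately show ?thesis
      by (simp only:, subst nn_integral_add[symmetric]) (simp_all only: distrib_right mult.assoc, measurable)
  qed
  also have "\<dots> = (\<integral>\<^sup>+s\<in>{0..t}. g s \<partial>lborel)"
    using nn_integral_exp[OF _ c(1)] by (intro nn_integral_cong) (auto simp: indicator_def)
  finally show ?thesis by simp
qed

section \<open>A continuity argument\<close>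

text \<open>Only the right-hand side of the assumed inequality is continuous in t; f itself need not be.\<close>

lemma integral_bootstrap:
  fixes f g :: "real \<Rightarrow> real"
  assumes g: "set_integrable lborel {0..T} g" "\<And>s. s \<in> {0..T} \<Longrightarrow> 0 \<le> g s"
    and f: "f \<in> borel_measurable borel" "\<And>s. s \<in> {0..T} \<Longrightarrow> \<bar>f s\<bar> \<le> C"
    and K: "0 < K" "K * S0 < \<delta>"
    and le: "\<And>t. t \<in> {0..T} \<Longrightarrow> f t \<le> S0 + (LINT s:{0..t}|lborel. (K * f s - \<delta>) * g s)"
    and t: "t \<in> {0..T}"
  shows "f t \<le> S0"
proof -
  define h where "h s = (K * f s - \<delta>) * g s" for s
  define \<Psi> where "\<Psi> t = (LINT s:{0..t}|lborel. h s)" for t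
  have h: "set_integrable lborel {0..T} h"
  proof (rule set_integrable_bound[where f="\<lambda>s. (K * C + \<bar>\<delta>\<bar>) * g s"])
    show "set_integrable lborel {0..T} (\<lambda>s. (K * C + \<bar>\<delta>\<bar>) * g s)"
      using g(1) by (intro set_integrable_mult_right) auto
    have [measurable]: "(\<lambda>x. indicator {0..T} x *\<^sub>R g x) \<in> borel_measurable borel"
      using borel_measurable_integrable[OF g(1)[unfolded set_integrable_def]] by simp
    note f(1)[measurable]
    have "(\<lambda>s. (K * f s - \<delta>) * (indicator {0..T} s *\<^sub>R g s)) \<in> borel_measurable borel"
      by measurable
    then show "set_borel_measurable lborel {0..T} h"
      by (simp add: set_borel_measurable_def h_def mult_ac)
    have "\<bar>K * f s - \<delta>\<bar> \<le> \<bar>K * C + \<bar>\<delta>\<bar>\<bar>" if "s \<in> {0..T}" for s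
    proof -
      have "\<bar>K * f s\<bar> \<le> K * C" using f(2)[OF that] K(1) by (simp add: abs_mult)
      then show ?thesis by linarith
    qed
    then show "AE x in lborel. x \<in> {0..T} \<longrightarrow> norm (h x) \<le> norm ((K * C + \<bar>\<delta>\<bar>) * g x)"
      by (auto simp: h_def abs_mult intro!: mult_right_mono)
  qed
  have sub: "set_integrable lborel {0..t} h" if "t \<in> {0..T}" for t
    using that by (intro set_integrable_subset[OF h]) auto
  have cont: "continuous_on {0..T} \<Psi>"
  proof -
    have "h integrable_on {0..T}"
      using set_borel_integral_eq_integral(1)[OF h] .
    then have "continuous_on {0..T} (\<lambda>x. integral {0..x} h)"
      by (rule indefinite_integral_continuous_1)
    then show ?thesis
      using set_borel_integral_eq_integral(2)[OF sub] unfolding \<Psi>_def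
      by (subst continuous_on_cong[OF refl]) auto
  qed
  \<comment> \<open>The endpoint is a null set and may be left out of the hypothesis, so t can later
    be the first bad time itself.\<close>
  have nonpos: "\<Psi> t \<le> 0" if t: "t \<in> {0..T}" and *: "\<And>s. s \<in> {0..<t} \<Longrightarrow> K * f s < \<delta>" for t
  proof -
    have "AE s in lborel. s \<noteq> t"
      by (rule AE_lborel_singleton)
    then have "AE s in lborel. indicator {0..t} s *\<^sub>R h s \<le> 0"
    proof eventually_elim
      case (elim s)
      then show ?case
        using t *[of s] g(2)[of s] by (auto simp: indicator_def h_def intro!: mult_nonpos_nonneg)
    qed
    then have "0 \<le> (LINT s|lborel. - (indicator {0..t} s *\<^sub>R h s))"
      by (intro integral_nonneg_AE) auto
    then show ?thesis
      by (simp add: \<Psi>_def set_lebesgue_integral_def)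
  qed
  have small: "K * f s < \<delta>" if "s \<in> {0..T}" for s
  proof (rule ccontr)
    assume "\<not> K * f s < \<delta>"
    \<comment> \<open>The set of bad times need not be closed, but A contains it and is closed
      because \<Psi> is continuous. At the least element m of A all earlier times are good, so
      \<Psi> m \<le> 0, whereas membership in A forces \<Psi> m \<ge> \<delta> / K - S0 > 0.\<close>
    define A where "A = {s \<in> {0..T}. \<delta> / K - S0 \<le> \<Psi> s}"
    have inA: "s \<in> A" if "s \<in> {0..T}" "\<not> K * f s < \<delta>" for s
    proof -
      have "\<delta> / K \<le> f s" using that K(1) by (simp add: field_simps)
      then show ?thesis using le[OF that(1)] that(1) by (simp add: A_def \<Psi>_def h_def)
    qed
    have "closed A"
      unfolding A_def by (intro continuous_on_closed_Collect_le cont continuous_intros)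
    moreover have "A \<subseteq> {0..T}" by (auto simp: A_def)
    ultimately have "compact A"
      by (meson bounded_closed_interval bounded_subset compact_eq_bounded_closed)
    moreover have "A \<noteq> {}" using inA[OF that] \<open>\<not> K * f s < \<delta>\<close> by auto
    ultimately obtain m where m: "m \<in> A" "\<And>x. x \<in> A \<Longrightarrow> m \<le> x"
      using compact_attains_inf[of A] by blast
    have "\<Psi> m \<le> 0"
      using m inA by (intro nonpos) (force simp: A_def)+
    then have "K * \<Psi> m \<le> 0"
      using K(1) by (simp add: mult_nonneg_nonpos)
    then show False
      using m(1) K by (simp add: A_def field_simps)
  qed
  have "\<Psi> t \<le> 0"
    using small t by (intro nonpos) auto
  then show ?thesis
    using le[OF t] by (simp add: \<Psi>_def h_def)
qed

section \<open>Test functions and uniqueness of Fourier coefficients\<close>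

lemma deriv_smooth2:
  assumes "smooth2 \<phi>"
  shows "continuous_on UNIV (\<lambda>p. \<phi> (fst p) (snd p))"
    and "continuous_on UNIV (\<lambda>p. dt \<phi> (fst p) (snd p))"
    and "continuous_on UNIV (\<lambda>p. dx \<phi> (fst p) (snd p))"
    and "((\<lambda>s. \<phi> s x) has_real_derivative dt \<phi> s x) (at s)"
    and "(\<phi> s has_real_derivative dx \<phi> s x) (at x)"
proof -
  have d: "(\<lambda>p. \<phi> (fst p) (snd p)) differentiable_on UNIV"
    using assms[unfolded smooth2_def, rule_format, of "[]"] by simp
  have "(\<lambda>p. dt \<phi> (fst p) (snd p)) differentiable_on UNIV"
    using assms[unfolded smooth2_def, rule_format, of "[True]"] by simp
  then show "continuous_on UNIV (\<lambda>p. dt \<phi> (fst p) (snd p))"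
    by (rule differentiable_imp_continuous_on)
  have "(\<lambda>p. dx \<phi> (fst p) (snd p)) differentiable_on UNIV"
    using assms[unfolded smooth2_def, rule_format, of "[False]"] by simp
  then show "continuous_on UNIV (\<lambda>p. dx \<phi> (fst p) (snd p))"
    by (rule differentiable_imp_continuous_on)
  show "continuous_on UNIV (\<lambda>p. \<phi> (fst p) (snd p))"
    using d by (rule differentiable_imp_continuous_on)
  obtain D where D: "((\<lambda>p. \<phi> (fst p) (snd p)) has_derivative D) (at (s, x))"
    using d by (auto simp: differentiable_on_def differentiable_def)
  have "((\<lambda>s. (s, x)) has_derivative (\<lambda>h. (h, 0))) (at s)"
    by (auto intro!: derivative_eq_intros)
  from has_derivative_compose[OF this D]
  have "(\<lambda>s. \<phi> s x) differentiable (at s)"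
    by (auto simp: differentiable_def)
  then show "((\<lambda>s. \<phi> s x) has_real_derivative dt \<phi> s x) (at s)"
    unfolding dt_def by (metis DERIV_deriv_iff_real_differentiable)
  have "((\<lambda>x. (s, x)) has_derivative (\<lambda>h. (0, h))) (at x)"
    by (auto intro!: derivative_eq_intros)
  from has_derivative_compose[OF this D]
  have "\<phi> s differentiable (at x)"
    by (auto simp: differentiable_def)
  then show "(\<phi> s has_real_derivative dx \<phi> s x) (at x)"
    unfolding dx_def by (metis DERIV_deriv_iff_real_differentiable)
qed

lemma periodic_deriv:
  assumes "periodic2pi f"
  shows "periodic2pi (deriv f)"
proof -
  have "deriv f (x + 2 * pi) = deriv (\<lambda>y. f (y + 2 * pi)) x" for x
    unfolding deriv_def by (subst DERIV_shift) simp
  then show ?thesis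
    using assms by (simp add: periodic2pi_def)
qed

lemma periodic_deriv_funpow: "periodic2pi f \<Longrightarrow> periodic2pi ((deriv ^^ k) f)"
  by (induction k) (auto intro: periodic_deriv)

text \<open>A periodic function descends to the unit circle. This permits the use of
  Stone-Weierstrass on a compact subset of the complex plane.\<close>

lemma periodic_cis_eq:
  fixes f :: "real \<Rightarrow> real"
  assumes "periodic2pi f" "cis a = cis b"
  shows "f a = f b"
proof -
  have nat: "f (x + of_nat k * (2 * pi)) = f x" for x k
  proof (induction k)
    case (Suc k)
    have "f (x + of_nat (Suc k) * (2 * pi)) = f ((x + of_nat k * (2 * pi)) + 2 * pi)"
      by (simp add: algebra_simps)
    then show ?case using Suc assms(1) by (simp add: periodic2pi_def)
  qed simp
  obtain n :: int where "a = b + of_int n * (2 * pi)"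
  proof -
    have "cos a = cos b" "sin a = sin b"
      using assms(2) by (auto simp: complex_eq_iff)
    then obtain n :: int where "a = b + 2 * pi * of_int n"
      using sin_cos_eq_iff[of a b] by auto
    then show ?thesis using that[of n] by simp
  qed
  then show ?thesis
    using nat[of b "nat n"] nat[of a "nat (- n)"] by (cases "0 \<le> n") auto
qed

text \<open>Arg jumps across the negative real axis, where Arg2pi, which agrees with it modulo 2 pi, is continuous.\<close>

lemma continuous_periodic_circle:
  fixes f :: "real \<Rightarrow> real"
  assumes per: "periodic2pi f" and cont: "continuous_on UNIV f"
  shows "continuous_on (sphere 0 1) (\<lambda>z. f (Arg z))"
proof (rule continuous_at_imp_continuous_on, rule ballI)
  fix z :: complex
  assume z: "z \<in> sphere 0 1"
  have fc: "isCont f x" for x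
    using cont by (simp add: continuous_on_eq_continuous_at)
  have eq: "f (Arg w) = f (Arg2pi w)" if "w \<noteq> 0" for w
  proof (rule periodic_cis_eq[OF per])
    show "cis (Arg w) = cis (Arg2pi w)"
    proof -
      have "w / of_real (cmod w) = of_real (cmod w) * cis (Arg2pi w) / of_real (cmod w)"
        using Arg2pi_eq[of w] by (simp add: cis_conv_exp)
      then show ?thesis using that by (simp add: cis_Arg sgn_eq)
    qed
  qed
  show "isCont (\<lambda>z. f (Arg z)) z"
  proof (cases "z \<in> \<real>\<^sub>\<le>\<^sub>0")
    case False
    then show ?thesis
      by (intro isCont_o2[OF continuous_at_Arg fc])
  next
    case True
    with z have "z \<notin> \<real>\<^sub>\<ge>\<^sub>0"
      by (auto simp: nonneg_Reals_def nonpos_Reals_def)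
    then have "isCont (\<lambda>z. f (Arg2pi z)) z"
      by (intro isCont_o2[OF continuous_at_Arg2pi fc])
    moreover have "\<forall>\<^sub>F w in nhds z. f (Arg2pi w) = f (Arg w)"
    proof -
      have "\<forall>\<^sub>F w in nhds z. w \<in> - {0}"
        using z by (intro eventually_nhds_in_open) auto
      then show ?thesis by eventually_elim (simp add: eq)
    qed
    ultimately show ?thesis
      using isCont_cong[of "\<lambda>z. f (Arg2pi z)" "\<lambda>z. f (Arg z)" z] by simp
  qed
qed

text \<open>As n runs over all integers, the sign in the exponential is immaterial. The condition is
  phrased for all n because this makes it stable under multiplication by trigonometric
  polynomials.\<close>

definition null_coeffs :: "(real \<Rightarrow> real) \<Rightarrow> bool" where
  "null_coeffs g \<longleftrightarrow> set_integrable lborel {0..2*pi} g \<and>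
     (\<forall>n::int. (LINT x:{0..2*pi}|lborel. g x *\<^sub>R cis (of_int n * x)) = 0)"

lemma set_integrable_mult_continuous:
  fixes g :: "real \<Rightarrow> real" and f :: "real \<Rightarrow> 'a::{banach, second_countable_topology}"
  assumes g: "set_integrable lborel {a..b} g" and f: "continuous_on UNIV f"
  shows "set_integrable lborel {a..b} (\<lambda>x. g x *\<^sub>R f x)"
proof -
  have "bounded (f ` {a..b})"
    by (intro compact_imp_bounded compact_continuous_image continuous_on_subset[OF f]) auto
  then obtain B where "\<forall>x\<in>f ` {a..b}. norm x \<le> B" unfolding bounded_iff by blast
  then have B: "norm (f s) \<le> B" if "s \<in> {a..b}" for s using that by auto
  have [measurable]: "(\<lambda>x. indicator {a..b} x *\<^sub>R g x) \<in> borel_measurable borel"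
    using borel_measurable_integrable[OF g[unfolded set_integrable_def]] by simp
  have [measurable]: "f \<in> borel_measurable borel"
    by (rule borel_measurable_continuous_onI[OF f])
  show ?thesis
  proof (rule set_integrable_bound[where f="\<lambda>s. B *\<^sub>R g s"])
    show "set_integrable lborel {a..b} (\<lambda>s. B *\<^sub>R g s)"
      using g by (intro set_integrable_scaleR_right) auto
    have "(\<lambda>s. (indicator {a..b} s *\<^sub>R g s) *\<^sub>R f s) \<in> borel_measurable borel"
      by measurable
    then show "set_borel_measurable lborel {a..b} (\<lambda>s. g s *\<^sub>R f s)"
      by (simp add: set_borel_measurable_def)
    have "\<bar>g x\<bar> * norm (f x) \<le> \<bar>B\<bar> * \<bar>g x\<bar>" if "x \<in> {a..b}" for x
      using B[OF that] mult_right_mono[of "norm (f x)" "\<bar>B\<bar>" "\<bar>g x\<bar>"] by (simp add: mult.commute)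
    then show "AE x in lborel. x \<in> {a..b} \<longrightarrow> norm (g x *\<^sub>R f x) \<le> norm (B *\<^sub>R g x)"
      by (auto simp: abs_mult)
  qed
qed

text \<open>Invariance of the whole class is stronger than the vanishing of one integral, but makes
  the induction work: with g arbitrary, a product of polynomials is two successive multiplications.
  Only the linear case has content; it shifts the index n by 1 in both directions.\<close>

lemma null_coeffs_polynomial:
  fixes p :: "complex \<Rightarrow> real"
  assumes "real_polynomial_function p"
  shows "null_coeffs g \<Longrightarrow> null_coeffs (\<lambda>x. g x * p (cis x))"
  using assms
proof (induction arbitrary: g)
  case (linear p)
  then interpret p: bounded_linear p by simp
  have g: "set_integrable lborel {0..2*pi} g" and
    z: "(LINT x:{0..2*pi}|lborel. g x *\<^sub>R cis (of_int n * x)) = 0" for n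
    using linear(2) by (auto simp: null_coeffs_def)
  have i: "set_integrable lborel {0..2*pi} (\<lambda>x. g x *\<^sub>R cis (of_int n * x))" for n
    by (intro set_integrable_mult_continuous g continuous_intros)
  \<comment> \<open>By real linearity p (cis x) = p 1 cos x + p \<i> sin x; the coefficients come
    from writing cos and sin as combinations of cis x and cis (- x).\<close>
  have eq: "(g x * p (cis x)) *\<^sub>R cis (of_int n * x) =
     (p 1 / 2 - \<i> / 2 * p \<i>) * (g x *\<^sub>R cis (of_int (n + 1) * x)) +
     (p 1 / 2 + \<i> / 2 * p \<i>) * (g x *\<^sub>R cis (of_int (n - 1) * x))" for x n
  proof -
    have "cis x = cos x *\<^sub>R 1 + sin x *\<^sub>R \<i>" by (simp add: complex_eq_iff)
    then have "p (cis x) = cos x * p 1 + sin x * p \<i>"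
      by (simp only: p.add p.scaleR real_scaleR_def)
    moreover have "complex_of_real (cos x) = (cis x + cis (- x)) / 2" "complex_of_real (sin x) = - (\<i> / 2) * (cis x - cis (- x))"
      by (auto simp: complex_eq_iff)
    ultimately have pc: "complex_of_real (p (cis x)) = (cis x + cis (- x)) / 2 * p 1 - (\<i> / 2) * (cis x - cis (- x)) * p \<i>"
      by simp
    have "cis (of_int (n + 1) * x) = cis (of_int n * x) * cis x" "cis (of_int (n - 1) * x) = cis (of_int n * x) * cis (- x)"
      by (simp_all add: cis_mult algebra_simps)
    then show ?thesis
      unfolding scaleR_conv_of_real of_real_mult pc by (simp add: field_simps)
  qed
  have "(LINT x:{0..2*pi}|lborel. (g x * p (cis x)) *\<^sub>R cis (of_int n * x)) = 0" for n
    unfolding eq by (simp only: set_integral_add(2)[OF set_integrable_mult_right[OF i] set_integrable_mult_right[OF i]]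
        set_integral_mult_right z) simp
  moreover have "continuous_on UNIV (\<lambda>x. p (cis x))"
    by (intro p.continuous_on continuous_intros)
  ultimately show ?case
    using set_integrable_mult_continuous[OF g, of "\<lambda>x. p (cis x)"] by (simp add: null_coeffs_def)
next
  case (const c)
  have "(g x * c) *\<^sub>R cis (of_int n * x) = c *\<^sub>R (g x *\<^sub>R cis (of_int n * x))" for x n
    by simp
  with const show ?case
    unfolding null_coeffs_def by (simp only: set_integral_scaleR_right) simp
next
  case (add p q)
  have i: "set_integrable lborel {0..2*pi} (\<lambda>x. (g x * p (cis x)) *\<^sub>R cis (of_int n * x))"
      "set_integrable lborel {0..2*pi} (\<lambda>x. (g x * q (cis x)) *\<^sub>R cis (of_int n * x))" for n
    using add.IH[OF add.prems] by (auto simp only: null_coeffs_def intro!: set_integrable_mult_continuous continuous_intros)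
  from add.IH[OF add.prems] show ?case
    by (simp add: null_coeffs_def distrib_left scaleR_add_left set_integral_add(2)[OF i])
next
  case (mult p q)
  from mult.IH(2)[OF mult.IH(1)[OF mult.prems]] show ?case by (simp add: mult.assoc)
qed

text \<open>By Stone-Weierstrass on the unit circle, trigonometric polynomials approximate f uniformly.\<close>

lemma null_coeffs_integral:
  assumes g: "null_coeffs g" and per: "periodic2pi f" and cont: "continuous_on UNIV f"
  shows "(LINT x:{0..2*pi}|lborel. g x * f x) = 0"
proof -
  have gi: "set_integrable lborel {0..2*pi} g" using g by (simp add: null_coeffs_def)
  let ?N = "LINT x:{0..2*pi}|lborel. \<bar>g x\<bar>"
  have bd: "\<bar>LINT x:{0..2*pi}|lborel. g x * f x\<bar> \<le> e * ?N" if e: "0 < e" for e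
  proof -
    obtain p where p: "real_polynomial_function p" "\<And>z. z \<in> sphere 0 1 \<Longrightarrow> \<bar>f (Arg z) - p z\<bar> < e"
      using Stone_Weierstrass_real_polynomial_function[OF _ continuous_periodic_circle[OF per cont] e] by auto
    have d: "\<bar>f x - p (cis x)\<bar> \<le> e" for x
      using p(2)[of "cis x"] periodic_cis_eq[OF per, of "Arg (cis x)" x] by (simp add: cis_Arg)
    have pc: "continuous_on UNIV (\<lambda>x. p (cis x))"
      by (rule continuous_on_compose2[OF continuous_on_polymonial_function[of p UNIV]])
         (use p(1) in \<open>simp_all add: real_polynomial_function_eq continuous_on_cis\<close>)
    have "null_coeffs (\<lambda>x. g x * p (cis x))"
      by (rule null_coeffs_polynomial[OF p(1) g])
    from this[unfolded null_coeffs_def, THEN conjunct2, rule_format, of 0]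
    have z: "(LINT x:{0..2*pi}|lborel. g x * p (cis x)) = 0"
      by (simp add: scaleR_conv_of_real set_integral_complex_of_real del: of_real_mult)
    have i1: "set_integrable lborel {0..2*pi} (\<lambda>x. g x * f x)"
      using set_integrable_mult_continuous[OF gi cont] by simp
    have i2: "set_integrable lborel {0..2*pi} (\<lambda>x. g x * p (cis x))"
      using set_integrable_mult_continuous[OF gi pc] by simp
    have i3: "set_integrable lborel {0..2*pi} (\<lambda>x. g x * (f x - p (cis x)))"
      using set_integral_diff(1)[OF i1 i2] by (simp add: right_diff_distrib)
    have "(LINT x:{0..2*pi}|lborel. g x * f x) = (LINT x:{0..2*pi}|lborel. g x * (f x - p (cis x)))"
      using set_integral_diff(2)[OF i1 i2] z by (simp add: right_diff_distrib)
    also have "\<bar>\<dots>\<bar> \<le> (LINT x:{0..2*pi}|lborel. \<bar>g x * (f x - p (cis x))\<bar>)"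
      using set_integral_norm_bound[OF i3] by simp
    also have "\<dots> \<le> (LINT x:{0..2*pi}|lborel. e * \<bar>g x\<bar>)"
    proof (intro set_integral_mono)
      show "\<bar>g x * (f x - p (cis x))\<bar> \<le> e * \<bar>g x\<bar>" for x
        using mult_right_mono[OF d[of x], of "\<bar>g x\<bar>"] by (simp add: abs_mult mult.commute)
    qed (intro set_integrable_mult_right set_integrable_abs i3 gi)+
    finally show ?thesis by simp
  qed
  moreover have "0 \<le> ?N"
    unfolding set_lebesgue_integral_def by (intro Bochner_Integration.integral_nonneg) simp
  ultimately have "\<bar>LINT x:{0..2*pi}|lborel. g x * f x\<bar> \<le> 0 + e" if "0 < e" for e
  proof -
    \<comment> \<open>\<open>?N\<close> may vanish, hence the denominator
      \<open>?N + 1\<close>.\<close>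
    have "e / (?N + 1) * ?N \<le> e"
      using \<open>0 \<le> ?N\<close> that by (simp add: field_simps)
    then show ?thesis
      using bd[of "e / (?N + 1)"] \<open>0 \<le> ?N\<close> that by simp
  qed
  then have "\<bar>LINT x:{0..2*pi}|lborel. g x * f x\<bar> \<le> 0"
    by (rule field_le_epsilon)
  then show ?thesis by simp
qed

section \<open>Majorants\<close>

text \<open>Young's inequality with exponents 4 and 4/3 in polynomial form: the difference of the
  two sides has the double root a = b, and the cofactor is nonnegative for a, b \<ge> 0.\<close>

lemma four_mult_cube_le:
  fixes a b :: real
  assumes "0 \<le> a" "0 \<le> b"
  shows "4 * (a * b ^ 3) \<le> a ^ 4 + 3 * b ^ 4"
proof -
  have "0 \<le> (a - b)\<^sup>2 * (a\<^sup>2 + 2 * a * b + 3 * b\<^sup>2)"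
    using assms by simp
  also have "\<dots> = a ^ 4 + 3 * b ^ 4 - 4 * (a * b ^ 3)"
    by algebra
  finally show ?thesis by simp
qed

lemma one_le_abs_int: "n \<noteq> 0 \<Longrightarrow> 1 \<le> \<bar>real_of_int n\<bar>"
  by (simp flip: of_int_abs)

text \<open>Integrality lets lower powers of the frequency be absorbed into n^4. The condition 0 < i
  is for n = 0, where a zeroth power would be 1.\<close>

lemma abs_le_pow_int:
  assumes "i \<le> j" "0 < i"
  shows "\<bar>real_of_int n\<bar> ^ i \<le> \<bar>real_of_int n\<bar> ^ j"
  using one_le_abs_int[of n] assms by (cases "n = 0") (auto intro: power_increasing simp: power_0_left)

text \<open>The instance takes \<beta> = 1/Bo and for z the Fourier coefficients of the datum;
  \<open>z_0\<close> expresses its zero mean and \<open>z_minus\<close> that it is real-valued. The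
  estimates see the datum only through these coefficients.\<close>

locale thin_film =
  fixes \<beta> \<epsilon> S0 :: real and z :: "int \<Rightarrow> complex"
  assumes beta: "1 < \<beta>" and eps: "0 < \<epsilon>" and z_0: "z 0 = 0" and z_minus: "\<And>n. z (- n) = cnj (z n)"
    and z_sum: "(\<integral>\<^sup>+n. ennreal (cmod (z n)) \<partial>count_space UNIV) = ennreal S0"
    and S0_nonneg: "0 \<le> S0" and S0_small: "S0 < (\<beta> - 1) / (8 * \<epsilon> * (\<beta> + 1))"
begin

definition symb :: "int \<Rightarrow> real" where
  "symb n = \<beta> * of_int n ^ 4 - of_int n ^ 2"

definition coef :: "int \<Rightarrow> int \<Rightarrow> real" where
  "coef n m = \<epsilon> * of_int n * (of_int m - \<beta> * of_int m ^ 3)"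

text \<open>Majorants live in ennreal, where no integrability has to be known in advance.\<close>

primrec maj :: "nat \<Rightarrow> int \<Rightarrow> real \<Rightarrow> ennreal" where
  "maj 0 n t = 0"
| "maj (Suc k) n t = ennreal (exp (- symb n * t)) * ennreal (cmod (z n)) +
     (\<integral>\<^sup>+s\<in>{0..t}. ennreal (exp (- symb n * (t - s))) *
        (\<integral>\<^sup>+m. ennreal \<bar>coef n m\<bar> * (maj k (n - m) s * maj k m s) \<partial>count_space UNIV) \<partial>lborel)"

lemma symb_ge: "(\<beta> - 1) * of_int n ^ 4 \<le> symb n"
  using abs_le_pow_int[of 2 4 n] by (simp add: symb_def algebra_simps)

lemma coef_le: "\<bar>coef n m\<bar> \<le> \<epsilon> * \<beta> / 4 * (of_int (n - m) ^ 4 + 7 * of_int m ^ 4)"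
proof -
  let ?n = "\<bar>real_of_int n\<bar>" and ?m = "\<bar>real_of_int m\<bar>" and ?k = "\<bar>real_of_int (n - m)\<bar>"
  \<comment> \<open>The second-order part m and the fourth-order part - \<beta> m^3 have opposite
    signs, and the latter is the larger one in modulus. So the factor is \<beta> instead of the
    \<beta> + 1 that the triangle inequality would give.\<close>
  have "?m \<le> ?m ^ 3" using abs_le_pow_int[of 1 3 m] by simp
  also have "\<dots> \<le> \<beta> * ?m ^ 3" using beta mult_right_mono[of 1 \<beta> "?m ^ 3"] by simp
  finally have m: "?m \<le> \<beta> * ?m ^ 3" .
  have "\<bar>of_int m - \<beta> * of_int m ^ 3\<bar> \<le> \<beta> * ?m ^ 3"
  proof (cases "0 \<le> m")
    case True
    then show ?thesis using m by simp
  next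
    case False
    then have "real_of_int m = - ?m" by simp
    then show ?thesis using m by (simp add: power3_eq_cube)
  qed
  then have "\<bar>coef n m\<bar> \<le> (\<epsilon> * \<beta>) * (?n * ?m ^ 3)"
    using eps mult_left_mono[of "\<bar>of_int m - \<beta> * of_int m ^ 3\<bar>" "\<beta> * ?m ^ 3" "\<epsilon> * ?n"]
    by (simp add: coef_def abs_mult mult_ac)
  also have "?n * ?m ^ 3 \<le> (?k + ?m) * ?m ^ 3"
    by (intro mult_right_mono) auto
  also have "(?k + ?m) * ?m ^ 3 = ?k * ?m ^ 3 + ?m ^ 4"
    by (simp add: distrib_right power_Suc[symmetric] numeral_eq_Suc)
  also have "\<dots> \<le> (?k ^ 4 + 7 * ?m ^ 4) / 4"
    using four_mult_cube_le[of ?k ?m] by simp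
  finally show ?thesis
    using eps beta by (simp add: mult_left_mono del: of_int_diff)
qed

lemma measurable_maj [measurable]: "maj k n \<in> borel_measurable borel"
proof (induction k arbitrary: n)
  case 0
  have "maj 0 n = (\<lambda>_. 0)" by auto
  then show ?case by simp
next
  case (Suc k)
  note Suc[measurable]
  interpret sigma_finite_measure "count_space (UNIV::int set)" by (rule sigma_finite_int)
  have [measurable]: "(\<lambda>s. \<integral>\<^sup>+m. ennreal \<bar>coef n m\<bar> * (maj k (n - m) s * maj k m s) \<partial>count_space UNIV) \<in> borel_measurable borel"
    by measurable
  show ?case
    unfolding maj.simps[abs_def] indicator_def of_bool_def atLeastAtMost_iff by measurable
qed

lemma maj_mono: "maj k n t \<le> maj (Suc k) n t"
proof (induction k arbitrary: n t)
  case (Suc k)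
  show ?case
    unfolding maj.simps(2)[of "Suc k" n t] maj.simps(2)[of k n t]
    by (intro add_left_mono nn_integral_mono mult_right_mono mult_left_mono mult_mono Suc) (simp_all del: maj.simps)
qed simp

text \<open>Conservation of mass: \<open>coef n m\<close> carries the factor n of the divergence, so
  no mode feeds the zero mode, which starts at 0.\<close>

lemma maj_zero: "maj k 0 t = 0"
  by (cases k) (auto simp: z_0 coef_def)

definition wgt :: "real \<Rightarrow> real \<Rightarrow> int \<Rightarrow> real \<Rightarrow> real" where
  "wgt \<nu> \<gamma> n t = exp (t * (\<gamma> + \<nu> * \<bar>of_int n\<bar>))"

text \<open>The weight wgt is submultiplicative in n for t, \<gamma>, \<nu> \<ge> 0, as needed for convolutions.\<close>

definition wsum :: "real \<Rightarrow> real \<Rightarrow> nat \<Rightarrow> real \<Rightarrow> ennreal" where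
  "wsum \<nu> \<gamma> k t = (\<integral>\<^sup>+n. ennreal (wgt \<nu> \<gamma> n t) * maj k n t \<partial>count_space UNIV)"

definition wsum4 :: "real \<Rightarrow> real \<Rightarrow> nat \<Rightarrow> real \<Rightarrow> ennreal" where
  "wsum4 \<nu> \<gamma> k t = (\<integral>\<^sup>+n. ennreal (of_int n ^ 4) * (ennreal (wgt \<nu> \<gamma> n t) * maj k n t) \<partial>count_space UNIV)"

lemma measurable_wsum [measurable]:
  "wsum \<nu> \<gamma> k \<in> borel_measurable borel" "wsum4 \<nu> \<gamma> k \<in> borel_measurable borel"
proof -
  interpret sigma_finite_measure "count_space (UNIV::int set)" by (rule sigma_finite_int)
  show "wsum \<nu> \<gamma> k \<in> borel_measurable borel" "wsum4 \<nu> \<gamma> k \<in> borel_measurable borel"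
    unfolding wsum_def[abs_def] wsum4_def[abs_def] wgt_def by measurable
qed

text \<open>Multiplication by the weight turns a Duhamel formula of rate \<open>symb n\<close> into
  one of rate \<open>symb n - \<gamma> - \<nu> * \<bar>n\<bar>\<close>. Growth of the weight thus
  appears as a loss of dissipation, and the result is still an equality.\<close>

lemma wgt_maj_energy:
  assumes c: "0 \<le> symb n - \<gamma> - \<nu> * \<bar>of_int n\<bar>" and t: "0 \<le> t"
  shows "ennreal (wgt \<nu> \<gamma> n t) * maj (Suc k) n t
      + ennreal (symb n - \<gamma> - \<nu> * \<bar>of_int n\<bar>) * (\<integral>\<^sup>+r\<in>{0..t}. ennreal (wgt \<nu> \<gamma> n r) * maj (Suc k) n r \<partial>lborel)
    = ennreal (cmod (z n)) + (\<integral>\<^sup>+s\<in>{0..t}. ennreal (wgt \<nu> \<gamma> n s) *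
        (\<integral>\<^sup>+m. ennreal \<bar>coef n m\<bar> * (maj k (n - m) s * maj k m s) \<partial>count_space UNIV) \<partial>lborel)"
proof (rule nn_duhamel[OF _ c t])
  interpret sigma_finite_measure "count_space (UNIV::int set)" by (rule sigma_finite_int)
  let ?Q = "\<lambda>s. \<integral>\<^sup>+m. ennreal \<bar>coef n m\<bar> * (maj k (n - m) s * maj k m s) \<partial>count_space UNIV"
  let ?c = "symb n - \<gamma> - \<nu> * \<bar>of_int n\<bar>"
  have [measurable]: "?Q \<in> borel_measurable borel" by measurable
  have [measurable]: "wgt \<nu> \<gamma> n \<in> borel_measurable borel" unfolding wgt_def[abs_def] by measurable
  show "(\<lambda>s. ennreal (wgt \<nu> \<gamma> n s) * ?Q s) \<in> borel_measurable borel" by measurable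
  fix r :: real
  assume "0 \<le> r"
  have 1: "ennreal (wgt \<nu> \<gamma> n r) * ennreal (exp (- symb n * r)) = ennreal (exp (- ?c * r))"
    by (simp add: wgt_def exp_add[symmetric] algebra_simps flip: ennreal_mult)
  have 2: "ennreal (wgt \<nu> \<gamma> n r) * ennreal (exp (- symb n * (r - s))) =
      ennreal (exp (- ?c * (r - s))) * ennreal (wgt \<nu> \<gamma> n s)" for s
    by (simp add: wgt_def exp_add[symmetric] algebra_simps flip: ennreal_mult)
  have "ennreal (wgt \<nu> \<gamma> n r) * maj (Suc k) n r = ennreal (exp (- ?c * r)) * ennreal (cmod (z n)) +
     (\<integral>\<^sup>+s. ennreal (wgt \<nu> \<gamma> n r) * (ennreal (exp (- symb n * (r - s))) * ?Q s * indicator {0..r} s) \<partial>lborel)"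
    by (simp only: maj.simps distrib_left 1[symmetric] mult.assoc) (subst nn_integral_cmult, measurable)
  also have "(\<lambda>s. ennreal (wgt \<nu> \<gamma> n r) * (ennreal (exp (- symb n * (r - s))) * ?Q s * indicator {0..r} s))
     = (\<lambda>s. ennreal (exp (- ?c * (r - s))) * (ennreal (wgt \<nu> \<gamma> n s) * ?Q s) * indicator {0..r} s)"
    by (simp only: mult.assoc[symmetric] 2)
  finally show "ennreal (wgt \<nu> \<gamma> n r) * maj (Suc k) n r = ennreal (exp (- ?c * r)) * ennreal (cmod (z n)) +
     (\<integral>\<^sup>+s\<in>{0..r}. ennreal (exp (- ?c * (r - s))) * (ennreal (wgt \<nu> \<gamma> n s) * ?Q s) \<partial>lborel)" .
qed

text \<open>The sequence g is arbitrary because the estimate serves twice: with weights for the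
  iterates \<open>maj k\<close>, and with trivial weight for the limit \<open>Maj\<close> when the
  time derivative is bounded.\<close>

lemma wgt_conv_le:
  fixes g :: "int \<Rightarrow> ennreal"
  assumes "0 \<le> \<nu>" "0 \<le> \<gamma>" "0 \<le> s"
  shows "(\<integral>\<^sup>+n. ennreal (wgt \<nu> \<gamma> n s) *
        (\<integral>\<^sup>+m. ennreal \<bar>coef n m\<bar> * (g (n - m) * g m) \<partial>count_space UNIV) \<partial>count_space UNIV)
     \<le> ennreal (2 * \<epsilon> * \<beta>) * ((\<integral>\<^sup>+n. ennreal (wgt \<nu> \<gamma> n s) * g n \<partial>count_space UNIV) *
       (\<integral>\<^sup>+n. ennreal (of_int n ^ 4) * (ennreal (wgt \<nu> \<gamma> n s) * g n) \<partial>count_space UNIV))"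
proof -
  let ?W = "(\<integral>\<^sup>+n. ennreal (wgt \<nu> \<gamma> n s) * g n \<partial>count_space UNIV)"
  let ?W4 = "(\<integral>\<^sup>+n. ennreal (of_int n ^ 4) * (ennreal (wgt \<nu> \<gamma> n s) * g n) \<partial>count_space UNIV)"
  define A where "A n = ennreal (wgt \<nu> \<gamma> n s) * g n" for n
  define B where "B n = ennreal (of_int n ^ 4) * A n" for n
  have w: "wgt \<nu> \<gamma> n s \<le> wgt \<nu> \<gamma> (n - m) s * wgt \<nu> \<gamma> m s" for n m
  proof -
    have "\<nu> * \<bar>of_int n\<bar> \<le> \<nu> * (\<bar>of_int (n - m)\<bar> + \<bar>of_int m\<bar>)"
      using assms by (intro mult_left_mono) auto
    then have "s * (\<gamma> + \<nu> * \<bar>of_int n\<bar>) \<le> s * ((\<gamma> + \<nu> * \<bar>of_int (n - m)\<bar>) + (\<gamma> + \<nu> * \<bar>of_int m\<bar>))"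
      using assms by (intro mult_left_mono) (auto simp: distrib_left)
    then show ?thesis
      by (simp add: wgt_def exp_add[symmetric] distrib_left)
  qed
  have le: "ennreal (wgt \<nu> \<gamma> n s) * (ennreal \<bar>coef n m\<bar> * (g (n - m) * g m))
      \<le> ennreal (\<epsilon> * \<beta> / 4) * (B (n - m) * A m) + ennreal (\<epsilon> * \<beta> / 4 * 7) * (A (n - m) * B m)" for n m
  proof -
    have "wgt \<nu> \<gamma> n s * \<bar>coef n m\<bar> \<le> (wgt \<nu> \<gamma> (n - m) s * wgt \<nu> \<gamma> m s) *
        (\<epsilon> * \<beta> / 4 * (of_int (n - m) ^ 4 + 7 * of_int m ^ 4))"
      by (intro mult_mono w coef_le) (auto simp: wgt_def)
    then have "ennreal (wgt \<nu> \<gamma> n s * \<bar>coef n m\<bar>) \<le> ennreal (wgt \<nu> \<gamma> (n - m) s) * ennreal (wgt \<nu> \<gamma> m s) *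
        (ennreal (\<epsilon> * \<beta> / 4) * ennreal (of_int (n - m) ^ 4) + ennreal (\<epsilon> * \<beta> / 4 * 7) * ennreal (of_int m ^ 4))"
      using eps beta
      by (auto simp: wgt_def algebra_simps simp del: of_int_diff simp flip: ennreal_mult ennreal_plus intro!: ennreal_leI)
    from mult_right_mono[OF this, of "g (n - m) * g m"]
    show ?thesis
      by (simp add: ennreal_mult wgt_def A_def B_def algebra_simps del: of_int_diff)
  qed
  have "(\<integral>\<^sup>+n. ennreal (wgt \<nu> \<gamma> n s) *
        (\<integral>\<^sup>+m. ennreal \<bar>coef n m\<bar> * (g (n - m) * g m) \<partial>count_space UNIV) \<partial>count_space UNIV)
     \<le> (\<integral>\<^sup>+n. (\<integral>\<^sup>+m. ennreal (\<epsilon> * \<beta> / 4) * (B (n - m) * A m) + ennreal (\<epsilon> * \<beta> / 4 * 7) * (A (n - m) * B m) \<partial>count_space UNIV) \<partial>count_space UNIV)"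
    by (subst nn_integral_cmult[symmetric], simp) (intro nn_integral_mono le)
  also have "\<dots> = ennreal (\<epsilon> * \<beta> / 4) * (?W4 * ?W) + ennreal (\<epsilon> * \<beta> / 4 * 7) * (?W * ?W4)"
  proof -
    have ws: "?W = (\<integral>\<^sup>+n. A n \<partial>count_space UNIV)" "?W4 = (\<integral>\<^sup>+n. B n \<partial>count_space UNIV)"
      by (simp_all add: A_def B_def)
    show ?thesis
      by (simp add: ws nn_integral_add nn_integral_cmult nn_integral_int_conv)
  qed
  also have "\<dots> = (ennreal (\<epsilon> * \<beta> / 4) + ennreal (\<epsilon> * \<beta> / 4 * 7)) * (?W * ?W4)"
    by (simp only: distrib_right mult.commute[of "?W4"])
  \<comment> \<open>The shares 1/4 and 7/4, according to whether n^4 falls on the first or the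
    second factor of the convolution, add up to 2.\<close>
  also have "ennreal (\<epsilon> * \<beta> / 4) + ennreal (\<epsilon> * \<beta> / 4 * 7) = ennreal (2 * \<epsilon> * \<beta>)"
    using eps beta by (simp flip: ennreal_plus)
  finally show ?thesis .
qed

text \<open>Summing the energy identities over n. The right-hand side contains the previous iterate
  only, so this is a recursion in k and not yet a closed inequality.\<close>

lemma wsum_energy:
  assumes nu: "0 \<le> \<nu>" "0 \<le> \<gamma>" "\<gamma> + \<nu> \<le> \<beta> - 1" and t: "0 \<le> t"
  shows "wsum \<nu> \<gamma> (Suc k) t + ennreal (\<beta> - 1 - \<gamma> - \<nu>) * (\<integral>\<^sup>+r\<in>{0..t}. wsum4 \<nu> \<gamma> (Suc k) r \<partial>lborel)
    \<le> ennreal S0 + ennreal (2 * \<epsilon> * \<beta>) * (\<integral>\<^sup>+s\<in>{0..t}. wsum \<nu> \<gamma> k s * wsum4 \<nu> \<gamma> k s \<partial>lborel)"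
proof -
  interpret sigma_finite_measure "count_space (UNIV::int set)" by (rule sigma_finite_int)
  let ?\<delta> = "\<beta> - 1 - \<gamma> - \<nu>"
  let ?A = "\<lambda>n r. ennreal (wgt \<nu> \<gamma> n r) * maj (Suc k) n r"
  let ?Q = "\<lambda>n s. \<integral>\<^sup>+m. ennreal \<bar>coef n m\<bar> * (maj k (n - m) s * maj k m s) \<partial>count_space UNIV"
  have [measurable]: "?Q n \<in> borel_measurable borel" for n by measurable
  have [measurable]: "wgt \<nu> \<gamma> n \<in> borel_measurable borel" for n unfolding wgt_def[abs_def] by measurable
  have [measurable]: "maj (Suc k) n \<in> borel_measurable borel" for n by (rule measurable_maj)
  have c: "?\<delta> * of_int n ^ 4 \<le> symb n - \<gamma> - \<nu> * \<bar>of_int n\<bar>" if "n \<noteq> 0" for n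
  proof -
    have "1 \<le> real_of_int n ^ 4" "\<bar>of_int n\<bar> \<le> real_of_int n ^ 4"
      using abs_le_pow_int[of 1 4 n] one_le_abs_int[OF that] by auto
    then have "\<gamma> * 1 \<le> \<gamma> * real_of_int n ^ 4" "\<nu> * \<bar>of_int n\<bar> \<le> \<nu> * real_of_int n ^ 4"
      using nu by (intro mult_left_mono; simp)+
    then show ?thesis using symb_ge[of n] by (simp add: algebra_simps)
  qed
  have n: "?A n t + ennreal ?\<delta> * (ennreal (of_int n ^ 4) * (\<integral>\<^sup>+r\<in>{0..t}. ?A n r \<partial>lborel))
     \<le> ennreal (cmod (z n)) + (\<integral>\<^sup>+s\<in>{0..t}. ennreal (wgt \<nu> \<gamma> n s) * ?Q n s \<partial>lborel)" for n
  \<comment> \<open>At n = 0 the dissipation cannot pay for \<gamma>, but there the majorant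
    vanishes.\<close>
  proof (cases "n = 0")
    case True
    then show ?thesis unfolding True maj_zero by (simp add: z_0)
  next
    case False
    have "0 \<le> ?\<delta> * of_int n ^ 4" using nu by simp
    with c[OF False] have "0 \<le> symb n - \<gamma> - \<nu> * \<bar>of_int n\<bar>" by linarith
    from wgt_maj_energy[OF this t, of k, symmetric]
    show ?thesis
      using c[OF False] nu
      by (simp only: mult.assoc[symmetric] ennreal_mult[symmetric] add_left_mono) 
         (auto intro!: add_left_mono mult_right_mono ennreal_leI simp flip: ennreal_mult simp del: maj.simps)
  qed
  have "wsum \<nu> \<gamma> (Suc k) t + ennreal ?\<delta> * (\<integral>\<^sup>+r\<in>{0..t}. wsum4 \<nu> \<gamma> (Suc k) r \<partial>lborel)
    = (\<integral>\<^sup>+n. ?A n t + ennreal ?\<delta> * (ennreal (of_int n ^ 4) * (\<integral>\<^sup>+r\<in>{0..t}. ?A n r \<partial>lborel)) \<partial>count_space UNIV)"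
  proof -
    have "(\<integral>\<^sup>+r\<in>{0..t}. wsum4 \<nu> \<gamma> (Suc k) r \<partial>lborel)
       = (\<integral>\<^sup>+r. (\<integral>\<^sup>+n. ennreal (of_int n ^ 4) * ?A n r * indicator {0..t} r \<partial>count_space UNIV) \<partial>lborel)"
      unfolding wsum4_def by (simp only: nn_integral_multc[OF borel_measurable_count_space])
    also have "\<dots> = (\<integral>\<^sup>+n. (\<integral>\<^sup>+r. ennreal (of_int n ^ 4) * ?A n r * indicator {0..t} r \<partial>lborel) \<partial>count_space UNIV)"
      by (rule nn_integral_int_swap[symmetric]) measurable
    also have "\<dots> = (\<integral>\<^sup>+n. ennreal (of_int n ^ 4) * (\<integral>\<^sup>+r\<in>{0..t}. ?A n r \<partial>lborel) \<partial>count_space UNIV)"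
      by (intro nn_integral_cong, simp only: mult.assoc) (rule nn_integral_cmult, measurable)
    finally show ?thesis
      by (simp add: wsum_def nn_integral_add nn_integral_cmult del: maj.simps)
  qed
  also have "\<dots> \<le> (\<integral>\<^sup>+n. ennreal (cmod (z n)) + (\<integral>\<^sup>+s\<in>{0..t}. ennreal (wgt \<nu> \<gamma> n s) * ?Q n s \<partial>lborel) \<partial>count_space UNIV)"
    by (intro nn_integral_mono n)
  also have "\<dots> = ennreal S0 + (\<integral>\<^sup>+n. (\<integral>\<^sup>+s\<in>{0..t}. ennreal (wgt \<nu> \<gamma> n s) * ?Q n s \<partial>lborel) \<partial>count_space UNIV)"
    by (simp add: nn_integral_add z_sum)
  also have "(\<integral>\<^sup>+n. (\<integral>\<^sup>+s\<in>{0..t}. ennreal (wgt \<nu> \<gamma> n s) * ?Q n s \<partial>lborel) \<partial>count_space UNIV)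
    = (\<integral>\<^sup>+s\<in>{0..t}. (\<integral>\<^sup>+n. ennreal (wgt \<nu> \<gamma> n s) * ?Q n s \<partial>count_space UNIV) \<partial>lborel)"
    by (subst nn_integral_int_swap) (simp_all add: nn_integral_multc)
  also have "\<dots> \<le> (\<integral>\<^sup>+s\<in>{0..t}. ennreal (2 * \<epsilon> * \<beta>) * (wsum \<nu> \<gamma> k s * wsum4 \<nu> \<gamma> k s) \<partial>lborel)"
    using nu by (intro nn_integral_mono) (auto simp: indicator_def wsum_def wsum4_def intro!: wgt_conv_le)
  also have "\<dots> = ennreal (2 * \<epsilon> * \<beta>) * (\<integral>\<^sup>+s\<in>{0..t}. wsum \<nu> \<gamma> k s * wsum4 \<nu> \<gamma> k s \<partial>lborel)"
    by (simp only: mult.assoc[of "ennreal (2 * \<epsilon> * \<beta>)"]) (rule nn_integral_cmult, measurable)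
  finally show ?thesis by (simp add: add_left_mono)
qed

end

section \<open>The continuity argument for extended-real functions\<close>

lemma nn_integral_enn2real:
  fixes G :: "real \<Rightarrow> ennreal"
  assumes [measurable]: "G \<in> borel_measurable borel" and fin: "(\<integral>\<^sup>+s\<in>A. G s \<partial>lborel) < top" and [measurable]: "A \<in> sets borel"
  shows "set_integrable lborel A (\<lambda>s. enn2real (G s))"
    and "(\<integral>\<^sup>+s\<in>A. G s \<partial>lborel) = ennreal (LINT s:A|lborel. enn2real (G s))"
    and "AE s in lborel. s \<in> A \<longrightarrow> G s < top"
proof -
  have "AE s in lborel. G s * indicator A s \<noteq> \<infinity>"
    using fin by (intro nn_integral_noteq_infinite) auto
  then show ae: "AE s in lborel. s \<in> A \<longrightarrow> G s < top"
    by eventually_elim (auto simp: less_top)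
  have eq: "(\<integral>\<^sup>+s\<in>A. G s \<partial>lborel) = (\<integral>\<^sup>+s. ennreal (indicator A s *\<^sub>R enn2real (G s)) \<partial>lborel)"
    using ae by (intro nn_integral_cong_AE) (auto simp: indicator_def)
  show int: "set_integrable lborel A (\<lambda>s. enn2real (G s))"
    unfolding set_integrable_def
    using fin eq by (intro integrableI_nonneg) auto
  show "(\<integral>\<^sup>+s\<in>A. G s \<partial>lborel) = ennreal (LINT s:A|lborel. enn2real (G s))"
    unfolding eq set_lebesgue_integral_def
    using int by (intro nn_integral_eq_integral) (auto simp: set_integrable_def)
qed

text \<open>Finiteness of F and of the integral of G has to be known beforehand, since an infinite
  right-hand side makes the inequality void; its size does not enter the conclusion. The inequality
  is used twice, first for F \<le> S0 and then to keep the part \<delta> - K S0 of the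
  dissipation.\<close>

lemma nn_integral_bootstrap:
  fixes F G :: "real \<Rightarrow> ennreal"
  assumes [measurable]: "F \<in> borel_measurable borel" "G \<in> borel_measurable borel"
    and F: "\<And>t. t \<in> {0..T} \<Longrightarrow> F t \<le> ennreal C"
    and G: "(\<integral>\<^sup>+s\<in>{0..T}. G s \<partial>lborel) < top"
    and K: "0 < K" "0 \<le> S0" "K * S0 < \<delta>"
    and le: "\<And>t. t \<in> {0..T} \<Longrightarrow> F t + ennreal \<delta> * (\<integral>\<^sup>+s\<in>{0..t}. G s \<partial>lborel)
        \<le> ennreal S0 + ennreal K * (\<integral>\<^sup>+s\<in>{0..t}. F s * G s \<partial>lborel)"
    and t: "t \<in> {0..T}"
  shows "F t + ennreal (\<delta> - K * S0) * (\<integral>\<^sup>+s\<in>{0..t}. G s \<partial>lborel) \<le> ennreal S0"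
proof -
  define f g where "f s = enn2real (F s)" and "g s = enn2real (G s)" for s
  have [measurable]: "f \<in> borel_measurable borel" "g \<in> borel_measurable borel"
    unfolding f_def[abs_def] g_def[abs_def] by measurable
  have Ff: "F s = ennreal (f s)" if "s \<in> {0..T}" for s
    using le_less_trans[OF F[OF that] ennreal_less_top] by (simp add: f_def)
  have nonneg: "0 \<le> f s" "0 \<le> g s" for s
    by (simp_all add: f_def g_def)
  have fC: "\<bar>f s\<bar> \<le> \<bar>C\<bar>" if "s \<in> {0..T}" for s
  proof -
    have "ennreal (f s) \<le> ennreal \<bar>C\<bar>"
      using order_trans[OF F[OF that] ennreal_leI[OF abs_ge_self]] unfolding Ff[OF that] .
    then show ?thesis using nonneg by simp
  qed
  have G': "(\<integral>\<^sup>+s\<in>{0..t}. G s \<partial>lborel) < top" if "t \<in> {0..T}" for t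
  proof -
    have "(\<integral>\<^sup>+s\<in>{0..t}. G s \<partial>lborel) \<le> (\<integral>\<^sup>+s\<in>{0..T}. G s \<partial>lborel)"
      using that by (intro nn_integral_mono mult_left_mono) (auto simp: indicator_def)
    then show ?thesis using G by (rule le_less_trans)
  qed
  have gi: "set_integrable lborel {0..t} g" and
    G_eq: "(\<integral>\<^sup>+s\<in>{0..t}. G s \<partial>lborel) = ennreal (LINT s:{0..t}|lborel. g s)" if "t \<in> {0..T}" for t
    using nn_integral_enn2real[OF _ G'[OF that]] unfolding g_def by auto
  have fgi: "set_integrable lborel {0..t} (\<lambda>s. f s * g s)" if "t \<in> {0..T}" for t
  proof (rule set_integrable_bound[OF set_integrable_mult_right[OF gi[OF that], of "\<bar>C\<bar>"]])
    show "set_borel_measurable lborel {0..t} (\<lambda>s. f s * g s)"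
      unfolding set_borel_measurable_def by measurable
    show "AE x in lborel. x \<in> {0..t} \<longrightarrow> norm (f x * g x) \<le> norm (\<bar>C\<bar> * g x)"
      using that fC by (auto simp: abs_mult intro!: mult_right_mono)
  qed
  have FG_eq: "(\<integral>\<^sup>+s\<in>{0..t}. F s * G s \<partial>lborel) = ennreal (LINT s:{0..t}|lborel. f s * g s)" if "t \<in> {0..T}" for t
  proof -
    have "AE s in lborel. s \<in> {0..t} \<longrightarrow> G s < top"
      using nn_integral_enn2real(3)[OF _ G'[OF that]] by simp
    then have "AE s in lborel. F s * G s * indicator {0..t} s = ennreal (indicator {0..t} s *\<^sub>R (f s * g s))"
    proof eventually_elim
      case (elim s)
      then show ?case
        using that Ff[of s] nonneg by (cases "s \<in> {0..t}") (simp_all add: g_def ennreal_mult)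
    qed
    then have "(\<integral>\<^sup>+s\<in>{0..t}. F s * G s \<partial>lborel) = (\<integral>\<^sup>+s. ennreal (indicator {0..t} s *\<^sub>R (f s * g s)) \<partial>lborel)"
      by (rule nn_integral_cong_AE)
    also have "\<dots> = ennreal (LINT s:{0..t}|lborel. f s * g s)"
      unfolding set_lebesgue_integral_def
      using fgi[OF that] by (intro nn_integral_eq_integral) (auto simp: set_integrable_def f_def g_def)
    finally show ?thesis .
  qed
  have g_nonneg: "0 \<le> (LINT s:{0..t}|lborel. g s)" for t
    unfolding set_lebesgue_integral_def g_def by (intro Bochner_Integration.integral_nonneg) simp
  have fg_nonneg: "0 \<le> (LINT s:{0..t}|lborel. f s * g s)" for t
    unfolding set_lebesgue_integral_def f_def g_def by (intro Bochner_Integration.integral_nonneg) simp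
  have \<delta>: "0 < \<delta>" using le_less_trans[OF mult_nonneg_nonneg[OF less_imp_le[OF K(1)] K(2)] K(3)] .
  have re: "f t + \<delta> * (LINT s:{0..t}|lborel. g s) \<le> S0 + K * (LINT s:{0..t}|lborel. f s * g s)" if "t \<in> {0..T}" for t
    using le[OF that] K \<delta> g_nonneg[of t] fg_nonneg[of t]
    by (simp add: Ff[OF that] G_eq[OF that] FG_eq[OF that] nonneg flip: ennreal_mult ennreal_plus)
  have le': "f t \<le> S0 + (LINT s:{0..t}|lborel. (K * f s - \<delta>) * g s)" if "t \<in> {0..T}" for t
  proof -
    have "(LINT s:{0..t}|lborel. (K * f s - \<delta>) * g s) = (LINT s:{0..t}|lborel. K * (f s * g s) - \<delta> * g s)"
      by (simp add: algebra_simps)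
    also have "\<dots> = K * (LINT s:{0..t}|lborel. f s * g s) - \<delta> * (LINT s:{0..t}|lborel. g s)"
      using fgi[OF that] gi[OF that] by (subst set_integral_diff) auto
    finally show ?thesis using re[OF that] by simp
  qed
  have T: "T \<in> {0..T}" using t by auto
  have f: "f s \<le> S0" if "s \<in> {0..T}" for s
    by (rule integral_bootstrap[OF gi[OF T] nonneg(2) _ fC K(1,3) le' that]) measurable
  \<comment> \<open>Second use of the inequality: with f \<le> S0 the quadratic term becomes K S0
    times the integral of g and is absorbed on the left.\<close>
  have "(LINT s:{0..t}|lborel. f s * g s) \<le> (LINT s:{0..t}|lborel. S0 * g s)"
    using f t by (intro set_integral_mono fgi[OF t] set_integrable_mult_right gi[OF t])
      (auto intro!: mult_right_mono simp: g_def)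
  then have "K * (LINT s:{0..t}|lborel. f s * g s) \<le> K * (S0 * (LINT s:{0..t}|lborel. g s))"
    using K by (intro mult_left_mono) auto
  then have "f t + (\<delta> - K * S0) * (LINT s:{0..t}|lborel. g s) \<le> S0"
    using re[OF t] by (simp add: algebra_simps)
  then have "ennreal (f t + (\<delta> - K * S0) * (LINT s:{0..t}|lborel. g s)) \<le> ennreal S0"
    by (rule ennreal_leI)
  then show ?thesis
    using K g_nonneg[of t] by (simp add: Ff[OF t] G_eq[OF t] ennreal_mult nonneg)
qed

section \<open>Uniform bounds and the limit of the majorants\<close>

context thin_film
begin

text \<open>The smallness condition in the form in which it is used: \<beta> + 1 is weakened to
  \<beta> and the factor 8 is split as 4 * 2.\<close>

lemma small: "2 * \<epsilon> * \<beta> * S0 < (\<beta> - 1) / 4"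
proof -
  have "S0 * (8 * \<epsilon> * (\<beta> + 1)) < \<beta> - 1"
    using S0_small eps beta by (simp add: pos_less_divide_eq)
  moreover have "8 * \<epsilon> * \<beta> * S0 \<le> S0 * (8 * \<epsilon> * (\<beta> + 1))"
    using eps beta S0_nonneg by (simp add: algebra_simps)
  ultimately show ?thesis by simp
qed

lemma wsum_mono: "wsum \<nu> \<gamma> k t \<le> wsum \<nu> \<gamma> (Suc k) t" "wsum4 \<nu> \<gamma> k t \<le> wsum4 \<nu> \<gamma> (Suc k) t"
  unfolding wsum_def wsum4_def by (intro nn_integral_mono mult_left_mono maj_mono; simp)+

text \<open>A purely qualitative bound whose constant may grow with k: each iterate is estimated by
  the finite quantities of its predecessor. It only serves to start the continuity argument, and the
  strict inequality makes the dissipation constant positive.\<close>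

lemma wsum_finite:
  assumes nu: "0 \<le> \<nu>" "0 \<le> \<gamma>" "\<gamma> + \<nu> < \<beta> - 1"
  shows "\<exists>C. (\<forall>t\<in>{0..T}. wsum \<nu> \<gamma> k t \<le> ennreal C) \<and> (\<integral>\<^sup>+r\<in>{0..T}. wsum4 \<nu> \<gamma> k r \<partial>lborel) < top"
proof (induction k)
  case 0
  show ?case by (simp add: wsum_def wsum4_def)
next
  case (Suc k)
  then obtain C where C: "\<And>t. t \<in> {0..T} \<Longrightarrow> wsum \<nu> \<gamma> k t \<le> ennreal C"
    and fin: "(\<integral>\<^sup>+r\<in>{0..T}. wsum4 \<nu> \<gamma> k r \<partial>lborel) < top" by blast
  define D where "D = ennreal S0 + ennreal (2 * \<epsilon> * \<beta>) * (ennreal C * (\<integral>\<^sup>+r\<in>{0..T}. wsum4 \<nu> \<gamma> k r \<partial>lborel))"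
  have D: "D < top"
    using fin by (simp add: D_def ennreal_mult_less_top)
  have le: "wsum \<nu> \<gamma> (Suc k) t + ennreal (\<beta> - 1 - \<gamma> - \<nu>) * (\<integral>\<^sup>+r\<in>{0..t}. wsum4 \<nu> \<gamma> (Suc k) r \<partial>lborel) \<le> D"
    if t: "t \<in> {0..T}" for t
  proof -
    have "(\<integral>\<^sup>+s\<in>{0..t}. wsum \<nu> \<gamma> k s * wsum4 \<nu> \<gamma> k s \<partial>lborel) \<le> (\<integral>\<^sup>+s. ennreal C * (wsum4 \<nu> \<gamma> k s * indicator {0..T} s) \<partial>lborel)"
      using t C by (intro nn_integral_mono) (auto simp: indicator_def intro!: mult_right_mono)
    also have "\<dots> = ennreal C * (\<integral>\<^sup>+r\<in>{0..T}. wsum4 \<nu> \<gamma> k r \<partial>lborel)"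
      by (rule nn_integral_cmult) measurable
    finally show ?thesis
      using t nu unfolding D_def
      by (intro order_trans[OF wsum_energy] add_left_mono mult_left_mono) auto
  qed
  show ?case
  proof (intro exI[of _ "enn2real D"] conjI ballI)
    fix t assume "t \<in> {0..T}"
    then show "wsum \<nu> \<gamma> (Suc k) t \<le> ennreal (enn2real D)"
      using D order_trans[OF add_increasing2[OF zero_le order_refl] le] by simp
  next
    show "(\<integral>\<^sup>+r\<in>{0..T}. wsum4 \<nu> \<gamma> (Suc k) r \<partial>lborel) < top"
    proof (cases "0 \<le> T")
      case True
      have "ennreal (\<beta> - 1 - \<gamma> - \<nu>) * (\<integral>\<^sup>+r\<in>{0..T}. wsum4 \<nu> \<gamma> (Suc k) r \<partial>lborel) \<le> D"
        using order_trans[OF add_increasing[OF zero_le order_refl] le[of T]] True by simp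
      then have "ennreal (\<beta> - 1 - \<gamma> - \<nu>) * (\<integral>\<^sup>+r\<in>{0..T}. wsum4 \<nu> \<gamma> (Suc k) r \<partial>lborel) < top"
        using D by (rule le_less_trans)
      then show ?thesis
        using nu by (auto simp: ennreal_mult_less_top)
    qed simp
  qed
qed

text \<open>The smallness of S0 costs a quarter of the dissipation constant \<beta> - 1.\<close>

lemma wsum_bound:
  assumes nu: "0 \<le> \<nu>" "0 \<le> \<gamma>" "\<gamma> + \<nu> < 3 / 4 * (\<beta> - 1)" and t: "0 \<le> t"
  shows "wsum \<nu> \<gamma> k t + ennreal (3 / 4 * (\<beta> - 1) - \<gamma> - \<nu>) * (\<integral>\<^sup>+r\<in>{0..t}. wsum4 \<nu> \<gamma> k r \<partial>lborel) \<le> ennreal S0"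
proof (cases k)
  case 0
  then show ?thesis by (simp add: wsum_def wsum4_def)
next
  case (Suc j)
  define \<delta> where "\<delta> = \<beta> - 1 - \<gamma> - \<nu>"
  have \<delta>: "2 * \<epsilon> * \<beta> * S0 < \<delta>"
    using small nu by (simp add: \<delta>_def field_simps)
  have nu': "\<gamma> + \<nu> < \<beta> - 1" using nu beta by (simp add: field_simps)
  obtain C where C: "\<And>s. s \<in> {0..t} \<Longrightarrow> wsum \<nu> \<gamma> (Suc j) s \<le> ennreal C"
    and fin: "(\<integral>\<^sup>+r\<in>{0..t}. wsum4 \<nu> \<gamma> (Suc j) r \<partial>lborel) < top"
    using wsum_finite[OF nu(1,2) nu', of t "Suc j"] by blast
  have "wsum \<nu> \<gamma> (Suc j) t + ennreal (\<delta> - (2 * \<epsilon> * \<beta>) * S0) * (\<integral>\<^sup>+r\<in>{0..t}. wsum4 \<nu> \<gamma> (Suc j) r \<partial>lborel) \<le> ennreal S0"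
  proof (rule nn_integral_bootstrap[OF _ _ C fin _ S0_nonneg \<delta>])
    fix s assume s: "s \<in> {0..t}"
    have "wsum \<nu> \<gamma> (Suc j) s + ennreal \<delta> * (\<integral>\<^sup>+r\<in>{0..s}. wsum4 \<nu> \<gamma> (Suc j) r \<partial>lborel)
      \<le> ennreal S0 + ennreal (2 * \<epsilon> * \<beta>) * (\<integral>\<^sup>+r\<in>{0..s}. wsum \<nu> \<gamma> j r * wsum4 \<nu> \<gamma> j r \<partial>lborel)"
      unfolding \<delta>_def using nu nu' s by (intro wsum_energy) auto
    \<comment> \<open>Monotonicity in k closes the recursion: with iterate j replaced by the larger
      iterate \<open>Suc j\<close>, the inequality involves a single pair of functions, and the
      continuity argument applies to each iterate on its own.\<close>
    also have "\<dots> \<le> ennreal S0 + ennreal (2 * \<epsilon> * \<beta>) * (\<integral>\<^sup>+r\<in>{0..s}. wsum \<nu> \<gamma> (Suc j) r * wsum4 \<nu> \<gamma> (Suc j) r \<partial>lborel)"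
      by (intro add_left_mono mult_left_mono nn_integral_mono mult_right_mono mult_mono wsum_mono) auto
    finally show "wsum \<nu> \<gamma> (Suc j) s + ennreal \<delta> * (\<integral>\<^sup>+r\<in>{0..s}. wsum4 \<nu> \<gamma> (Suc j) r \<partial>lborel)
      \<le> ennreal S0 + ennreal (2 * \<epsilon> * \<beta>) * (\<integral>\<^sup>+r\<in>{0..s}. wsum \<nu> \<gamma> (Suc j) r * wsum4 \<nu> \<gamma> (Suc j) r \<partial>lborel)" .
  qed (use eps beta t in auto)
  moreover have "ennreal (3 / 4 * (\<beta> - 1) - \<gamma> - \<nu>) \<le> ennreal (\<delta> - (2 * \<epsilon> * \<beta>) * S0)"
    using small by (intro ennreal_leI) (simp add: \<delta>_def field_simps)
  ultimately show ?thesis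
    unfolding Suc by (elim order_trans[rotated]) (intro add_left_mono mult_right_mono; simp)
qed

text \<open>One dominating function for all Picard iterates and for their limit.\<close>

definition Maj :: "int \<Rightarrow> real \<Rightarrow> ennreal" where
  "Maj n t = (SUP k. maj k n t)"

lemma measurable_Maj [measurable]: "Maj n \<in> borel_measurable borel"
  unfolding Maj_def[abs_def] by measurable

lemma maj_le_Maj: "maj k n t \<le> Maj n t"
  unfolding Maj_def by (rule SUP_upper) simp

lemma incseq_maj: "incseq (\<lambda>k. maj k n t)"
  by (rule incseq_SucI) (rule maj_mono)

text \<open>The bound is uniform in k, so monotone convergence in n and in time carries it to the
  limit; the two suprema may be added because both sequences increase.\<close>

lemma Maj_bound:
  assumes nu: "0 \<le> \<nu>" "0 \<le> \<gamma>" "\<gamma> + \<nu> < 3 / 4 * (\<beta> - 1)" and t: "0 \<le> t"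
  shows "(\<integral>\<^sup>+n. ennreal (wgt \<nu> \<gamma> n t) * Maj n t \<partial>count_space UNIV) + ennreal (3 / 4 * (\<beta> - 1) - \<gamma> - \<nu>) *
      (\<integral>\<^sup>+r\<in>{0..t}. (\<integral>\<^sup>+n. ennreal (of_int n ^ 4) * (ennreal (wgt \<nu> \<gamma> n r) * Maj n r) \<partial>count_space UNIV) \<partial>lborel) \<le> ennreal S0"
proof -
  have i1: "incseq (\<lambda>k. wsum \<nu> \<gamma> k t)"
    by (rule incseq_SucI) (rule wsum_mono)
  have i3: "incseq (\<lambda>k. ennreal (3 / 4 * (\<beta> - 1) - \<gamma> - \<nu>) * (\<integral>\<^sup>+r\<in>{0..t}. wsum4 \<nu> \<gamma> k r \<partial>lborel))"
    by (intro incseq_SucI mult_left_mono nn_integral_mono mult_right_mono wsum_mono) simp_all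
  have 1: "(\<integral>\<^sup>+n. ennreal (wgt \<nu> \<gamma> n t) * Maj n t \<partial>count_space UNIV) = (SUP k. wsum \<nu> \<gamma> k t)"
    unfolding wsum_def Maj_def SUP_mult_left_ennreal
  proof (rule nn_integral_monotone_convergence_SUP)
    show "incseq (\<lambda>k n. ennreal (wgt \<nu> \<gamma> n t) * maj k n t)"
      by (intro incseq_SucI le_funI mult_left_mono maj_mono) simp
  qed simp
  have 2: "(\<integral>\<^sup>+n. ennreal (of_int n ^ 4) * (ennreal (wgt \<nu> \<gamma> n s) * Maj n s) \<partial>count_space UNIV) = (SUP k. wsum4 \<nu> \<gamma> k s)" for s
    unfolding wsum4_def Maj_def SUP_mult_left_ennreal
  proof (rule nn_integral_monotone_convergence_SUP)
    show "incseq (\<lambda>k n. ennreal (of_int n ^ 4) * (ennreal (wgt \<nu> \<gamma> n s) * maj k n s))"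
      by (intro incseq_SucI le_funI mult_left_mono maj_mono) simp_all
  qed simp
  have 3: "(\<integral>\<^sup>+r\<in>{0..t}. (SUP k. wsum4 \<nu> \<gamma> k r) \<partial>lborel) = (SUP k. \<integral>\<^sup>+r\<in>{0..t}. wsum4 \<nu> \<gamma> k r \<partial>lborel)"
    unfolding SUP_mult_right_ennreal
  proof (rule nn_integral_monotone_convergence_SUP)
    show "incseq (\<lambda>k r. wsum4 \<nu> \<gamma> k r * indicator {0..t} r)"
      by (intro incseq_SucI le_funI mult_right_mono wsum_mono) simp
  qed measurable
  have "(SUP k. wsum \<nu> \<gamma> k t) + (SUP k. ennreal (3 / 4 * (\<beta> - 1) - \<gamma> - \<nu>) * (\<integral>\<^sup>+r\<in>{0..t}. wsum4 \<nu> \<gamma> k r \<partial>lborel)) \<le> ennreal S0"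
    unfolding ennreal_SUP_add[OF i1 i3, symmetric]
    by (rule SUP_least) (rule wsum_bound[OF nu t])
  then show ?thesis
    unfolding 1 2 3 SUP_mult_left_ennreal .
qed

lemma Maj_sum: "0 \<le> t \<Longrightarrow> (\<integral>\<^sup>+n. Maj n t \<partial>count_space UNIV) \<le> ennreal S0"
  using order_trans[OF add_increasing2[OF zero_le order_refl] Maj_bound[of 0 0 t]] beta by (simp add: wgt_def)

lemma Maj_le: "0 \<le> t \<Longrightarrow> Maj n t \<le> ennreal S0"
  using order_trans[OF nn_integral_ge_point[of n UNIV "\<lambda>n. Maj n t"] Maj_sum] by simp

lemma Maj_zero: "Maj 0 t = 0"
  by (simp add: Maj_def maj_zero)

lemma Maj_sum4:
  assumes "0 \<le> t"
  shows "(\<integral>\<^sup>+r\<in>{0..t}. (\<integral>\<^sup>+n. ennreal (of_int n ^ 4) * Maj n r \<partial>count_space UNIV) \<partial>lborel) < top"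
proof -
  have "ennreal (3 / 4 * (\<beta> - 1)) * (\<integral>\<^sup>+r\<in>{0..t}. (\<integral>\<^sup>+n. ennreal (of_int n ^ 4) * Maj n r \<partial>count_space UNIV) \<partial>lborel) \<le> ennreal S0"
    using order_trans[OF add_increasing[OF zero_le order_refl] Maj_bound[of 0 0 t]] beta assms by (simp add: wgt_def)
  then have "ennreal (3 / 4 * (\<beta> - 1)) * (\<integral>\<^sup>+r\<in>{0..t}. (\<integral>\<^sup>+n. ennreal (of_int n ^ 4) * Maj n r \<partial>count_space UNIV) \<partial>lborel) < top"
    by (rule le_less_trans) simp
  then show ?thesis
    using beta by (auto simp: ennreal_mult_less_top)
qed

end

section \<open>The Picard iteration\<close>

text \<open>The product rule for differences, a' (b' - b) + (a' - a) b, matched term by term with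
  the splitting M' (N' - N) + (M' - M) N of the majorants.\<close>

lemma ennreal_mult_diff_bound:
  fixes a b a' b' :: complex and M N M' N' :: ennreal
  assumes "ennreal (cmod (a' - a)) + M \<le> M'" "ennreal (cmod (b' - b)) + N \<le> N'"
    and "ennreal (cmod a') \<le> M'" "ennreal (cmod b) \<le> N"
  shows "ennreal (cmod (a' * b' - a * b)) + M * N \<le> M' * N'"
proof -
  have "a' * b' - a * b = a' * (b' - b) + (a' - a) * b" by (simp add: algebra_simps)
  then have "cmod (a' * b' - a * b) \<le> cmod a' * cmod (b' - b) + cmod (a' - a) * cmod b"
    using norm_triangle_ineq[of "a' * (b' - b)" "(a' - a) * b"] by (simp add: norm_mult)
  then have "ennreal (cmod (a' * b' - a * b)) \<le> ennreal (cmod a') * ennreal (cmod (b' - b)) + ennreal (cmod (a' - a)) * ennreal (cmod b)"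
    by (simp flip: ennreal_mult ennreal_plus add: ennreal_leI)
  also have "\<dots> \<le> M' * ennreal (cmod (b' - b)) + ennreal (cmod (a' - a)) * N"
    using assms by (intro add_mono mult_mono) auto
  finally have "ennreal (cmod (a' * b' - a * b)) + M * N \<le> M' * ennreal (cmod (b' - b)) + (ennreal (cmod (a' - a)) + M) * N"
    by (simp add: distrib_right add.assoc add_right_mono)
  also have "\<dots> \<le> M' * ennreal (cmod (b' - b)) + M' * N"
    using assms by (intro add_mono mult_mono) auto
  also have "\<dots> \<le> M' * N'"
    unfolding distrib_left[symmetric] using assms(2) by (rule mult_left_mono) simp
  finally show ?thesis .
qed

lemma SUP_mult_incseq:
  fixes a b :: "nat \<Rightarrow> ennreal"
  assumes "incseq a" "incseq b"
  shows "(SUP k. a k) * (SUP k. b k) = (SUP k. a k * b k)"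
proof (rule antisym)
  show "(SUP k. a k) * (SUP k. b k) \<le> (SUP k. a k * b k)"
    unfolding SUP_mult_right_ennreal unfolding SUP_mult_left_ennreal
  proof (intro SUP_least)
    fix i j
    have "a i * b j \<le> a (max i j) * b (max i j)"
      by (intro mult_mono incseqD[OF assms(1)] incseqD[OF assms(2)]) auto
    also have "\<dots> \<le> (SUP k. a k * b k)" by (rule SUP_upper) simp
    finally show "a i * b j \<le> (SUP k. a k * b k)" .
  qed
  show "(SUP k. a k * b k) \<le> (SUP k. a k) * (SUP k. b k)"
    by (intro SUP_least mult_mono SUP_upper) auto
qed

context thin_film
begin

definition kern :: "int \<Rightarrow> real \<Rightarrow> real \<times> int \<Rightarrow> real" where
  "kern n t p = indicator {0..t} (fst p) * exp (- symb n * (t - fst p)) * coef n (snd p)"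

text \<open>Polymorphic because the same product is formed from complex iterates and from
  \<open>ennreal\<close> majorants.\<close>

abbreviation (input) quad :: "(int \<Rightarrow> real \<Rightarrow> 'b::times) \<Rightarrow> int \<Rightarrow> real \<times> int \<Rightarrow> 'b" where
  "quad f n p \<equiv> f (n - snd p) (fst p) * f (snd p) (fst p)"

text \<open>The time integral and the convolution sum form a single integral over a product measure, which makes
  it well defined as soon as its absolute value has finite integral.\<close>

primrec pic :: "nat \<Rightarrow> int \<Rightarrow> real \<Rightarrow> complex" where
  "pic 0 n t = 0"
| "pic (Suc k) n t = exp (- symb n * t) *\<^sub>R z n + (LINT p|(lborel \<Otimes>\<^sub>M count_space UNIV). kern n t p *\<^sub>R quad (pic k) n p)"

lemma measurable_quad:
  fixes f :: "int \<Rightarrow> real \<Rightarrow> 'b::{second_countable_topology, real_normed_algebra}"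
  assumes "\<And>m. f m \<in> borel_measurable borel"
  shows "quad f n \<in> borel_measurable (lborel \<Otimes>\<^sub>M count_space UNIV)"
proof -
  have "(\<lambda>(s, m). f (n - m) s * f m s) \<in> borel_measurable (lborel \<Otimes>\<^sub>M count_space UNIV)"
    by (rule measurable_pair_int, rule borel_measurable_times) (simp_all add: assms)
  then show ?thesis by (simp only: split_beta')
qed

lemma measurable_quad_ennreal:
  fixes f :: "int \<Rightarrow> real \<Rightarrow> ennreal"
  assumes "\<And>m. f m \<in> borel_measurable borel"
  shows "quad f n \<in> borel_measurable (lborel \<Otimes>\<^sub>M count_space UNIV)"
proof -
  have "(\<lambda>(s, m). f (n - m) s * f m s) \<in> borel_measurable (lborel \<Otimes>\<^sub>M count_space UNIV)"
    by (rule measurable_pair_int, rule borel_measurable_times_ennreal) (simp_all add: assms)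
  then show ?thesis by (simp only: split_beta')
qed

lemma measurable_kern: "kern n t \<in> borel_measurable (lborel \<Otimes>\<^sub>M count_space UNIV)"
proof -
  have "(\<lambda>(s, m). kern n t (s, m)) \<in> borel_measurable (lborel \<Otimes>\<^sub>M count_space UNIV)"
    by (rule measurable_pair_int) (simp add: kern_def)
  then show ?thesis by (simp only: case_prod_eta)
qed

lemma measurable_kern_quad:
  fixes g :: "int \<Rightarrow> real \<Rightarrow> ennreal"
  assumes "\<And>m. g m \<in> borel_measurable borel"
  shows "(\<lambda>p. ennreal \<bar>kern n t p\<bar> * quad g n p) \<in> borel_measurable (lborel \<Otimes>\<^sub>M count_space UNIV)"
  by (intro borel_measurable_times_ennreal measurable_quad_ennreal[OF assms] measurable_compose[OF measurable_kern]) simp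

lemma sigma_finite_lborel_int: "sigma_finite_measure (lborel \<Otimes>\<^sub>M count_space (UNIV :: int set) :: (real \<times> int) measure)"
  by (rule sigma_finite_pair_measure[OF lborel.sigma_finite_measure_axioms sigma_finite_int])

lemma measurable_pic [measurable]: "pic k n \<in> borel_measurable borel"
proof (induction k arbitrary: n)
  case 0
  have "pic 0 n = (\<lambda>_. 0)" by auto
  then show ?case by simp
next
  case (Suc k)
  let ?N = "lborel \<Otimes>\<^sub>M count_space UNIV :: (real \<times> int) measure"
  interpret P: sigma_finite_measure ?N
    by (rule sigma_finite_lborel_int)
  \<comment> \<open>For the parametrised integral the kernel must be measurable jointly in t and the
    integration variables; the condition s \<le> t couples them.\<close>
  have "(\<lambda>(t, s). indicator {0..t} s * exp (- symb n * (t - s))) \<in> borel_measurable (borel \<Otimes>\<^sub>M borel)"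
    unfolding indicator_def of_bool_def atLeastAtMost_iff by measurable
  moreover have "(\<lambda>q. (fst q, fst (snd q))) \<in> measurable (borel \<Otimes>\<^sub>M ?N) (borel \<Otimes>\<^sub>M borel)"
    by (intro measurable_Pair measurable_fst measurable_compose[OF measurable_snd]) simp
  ultimately have 1: "(\<lambda>q. case (fst q, fst (snd q)) of (t, s) \<Rightarrow> indicator {0..t} s * exp (- symb n * (t - s))) \<in> borel_measurable (borel \<Otimes>\<^sub>M ?N)"
    by (rule measurable_compose[rotated])
  have 2: "(\<lambda>q. coef n (snd (snd q))) \<in> borel_measurable (borel \<Otimes>\<^sub>M ?N)"
    by (rule measurable_compose[OF measurable_snd], rule measurable_compose[OF measurable_snd]) simp
  have 3: "(\<lambda>q. quad (pic k) n (snd q)) \<in> borel_measurable (borel \<Otimes>\<^sub>M ?N)"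
    by (rule measurable_compose[OF measurable_snd measurable_quad[OF Suc]])
  have "(\<lambda>q. ((case (fst q, fst (snd q)) of (t, s) \<Rightarrow> indicator {0..t} s * exp (- symb n * (t - s)))
      * coef n (snd (snd q))) *\<^sub>R quad (pic k) n (snd q)) \<in> borel_measurable (borel \<Otimes>\<^sub>M ?N)"
    by (rule borel_measurable_scaleR[OF borel_measurable_times[OF 1 2] 3])
  then have "(\<lambda>(t, p). kern n t p *\<^sub>R quad (pic k) n p) \<in> borel_measurable (borel \<Otimes>\<^sub>M ?N)"
    by (simp add: split_beta' kern_def)
  then have "(\<lambda>t. LINT p|?N. kern n t p *\<^sub>R quad (pic k) n p) \<in> borel_measurable borel"
    by (rule P.borel_measurable_lebesgue_integral)
  moreover have "(\<lambda>t. exp (- symb n * t) *\<^sub>R z n) \<in> borel_measurable borel"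
    by measurable
  ultimately show ?case
    unfolding pic.simps[abs_def] by (rule borel_measurable_add[rotated])
qed

text \<open>The iterated integrals of \<open>maj\<close> suit the energy estimate, the product
  measure of \<open>pic\<close> suits Bochner integrability; Tonelli lets the two be
  compared.\<close>

lemma maj_Suc_prod:
  "maj (Suc k) n t = ennreal (exp (- symb n * t)) * ennreal (cmod (z n)) +
     (\<integral>\<^sup>+p. ennreal \<bar>kern n t p\<bar> * quad (maj k) n p \<partial>(lborel \<Otimes>\<^sub>M count_space UNIV))"
proof -
  interpret sigma_finite_measure "count_space (UNIV::int set)" by (rule sigma_finite_int)
  have "(\<integral>\<^sup>+p. ennreal \<bar>kern n t p\<bar> * quad (maj k) n p \<partial>(lborel \<Otimes>\<^sub>M count_space UNIV))
     = (\<integral>\<^sup>+s. (\<integral>\<^sup>+m. ennreal \<bar>kern n t (s, m)\<bar> * (maj k (n - m) s * maj k m s) \<partial>count_space UNIV) \<partial>lborel)"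
    using nn_integral_fst[OF measurable_kern_quad[where g="maj k" and n=n and t=t, OF measurable_maj]] by simp
  also have "\<dots> = (\<integral>\<^sup>+s\<in>{0..t}. ennreal (exp (- symb n * (t - s))) *
        (\<integral>\<^sup>+m. ennreal \<bar>coef n m\<bar> * (maj k (n - m) s * maj k m s) \<partial>count_space UNIV) \<partial>lborel)"
  proof (intro nn_integral_cong)
    fix s
    have "ennreal \<bar>kern n t (s, m)\<bar> * (maj k (n - m) s * maj k m s) =
        ennreal (exp (- symb n * (t - s))) * indicator {0..t} s * (ennreal \<bar>coef n m\<bar> * (maj k (n - m) s * maj k m s))" for m
      by (cases "s \<in> {0..t}") (simp_all add: kern_def abs_mult ennreal_mult mult.assoc)
    then have "(\<integral>\<^sup>+m. ennreal \<bar>kern n t (s, m)\<bar> * (maj k (n - m) s * maj k m s) \<partial>count_space UNIV)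
       = ennreal (exp (- symb n * (t - s))) * indicator {0..t} s *
        (\<integral>\<^sup>+m. ennreal \<bar>coef n m\<bar> * (maj k (n - m) s * maj k m s) \<partial>count_space UNIV)"
      by (simp only:) (rule nn_integral_cmult, simp)
    then show "(\<integral>\<^sup>+m. ennreal \<bar>kern n t (s, m)\<bar> * (maj k (n - m) s * maj k m s) \<partial>count_space UNIV)
       = ennreal (exp (- symb n * (t - s))) *
        (\<integral>\<^sup>+m. ennreal \<bar>coef n m\<bar> * (maj k (n - m) s * maj k m s) \<partial>count_space UNIV) * indicator {0..t} s"
      by (simp only: mult.assoc mult.commute[of "indicator {0..t} s"])
  qed
  finally show ?thesis by (simp only: maj.simps)
qed

text \<open>For each k the integral is a summand of \<open>maj (Suc k) n t\<close>, hence at most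
  S0, and monotone convergence passes to the limit. It supplies the integrable bound behind every
  integral of the iteration.\<close>

lemma Maj_kern_finite:
  assumes t: "0 \<le> t"
  shows "(\<integral>\<^sup>+p. ennreal \<bar>kern n t p\<bar> * quad Maj n p \<partial>(lborel \<Otimes>\<^sub>M count_space UNIV)) < \<infinity>"
proof -
  have "quad Maj n p = (SUP k. quad (maj k) n p)" for p
    unfolding Maj_def by (intro SUP_mult_incseq incseq_maj)
  then have "(\<integral>\<^sup>+p. ennreal \<bar>kern n t p\<bar> * quad Maj n p \<partial>(lborel \<Otimes>\<^sub>M count_space UNIV))
     = (\<integral>\<^sup>+p. (SUP k. ennreal \<bar>kern n t p\<bar> * quad (maj k) n p) \<partial>(lborel \<Otimes>\<^sub>M count_space UNIV))"
    by (simp only: SUP_mult_left_ennreal)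
  also have "\<dots> = (SUP k. (\<integral>\<^sup>+p. ennreal \<bar>kern n t p\<bar> * quad (maj k) n p \<partial>(lborel \<Otimes>\<^sub>M count_space UNIV)))"
    by (intro nn_integral_monotone_convergence_SUP incseq_SucI le_funI mult_left_mono mult_mono maj_mono
        measurable_kern_quad measurable_maj) (simp_all del: maj.simps)
  also have "\<dots> \<le> ennreal S0"
  proof (rule SUP_least)
    fix k
    have "(\<integral>\<^sup>+p. ennreal \<bar>kern n t p\<bar> * quad (maj k) n p \<partial>(lborel \<Otimes>\<^sub>M count_space UNIV)) \<le> maj (Suc k) n t"
      unfolding maj_Suc_prod by (rule add_increasing[OF zero_le order_refl])
    also have "\<dots> \<le> ennreal S0"
      by (rule order_trans[OF maj_le_Maj Maj_le[OF t]])
    finally show "(\<integral>\<^sup>+p. ennreal \<bar>kern n t p\<bar> * quad (maj k) n p \<partial>(lborel \<Otimes>\<^sub>M count_space UNIV)) \<le> ennreal S0" .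
  qed
  finally show ?thesis by (rule le_less_trans) simp
qed

text \<open>Shared by the iterates and their limit, so that integrability of the quadratic term is
  proved once for both.\<close>

definition dominated :: "(int \<Rightarrow> real \<Rightarrow> complex) \<Rightarrow> bool" where
  "dominated f \<longleftrightarrow> (\<forall>m. f m \<in> borel_measurable borel) \<and> (\<forall>m s. 0 \<le> s \<longrightarrow> ennreal (cmod (f m s)) \<le> Maj m s)"

lemma dominatedD:
  assumes "dominated f"
  shows "f m \<in> borel_measurable borel" "0 \<le> s \<Longrightarrow> ennreal (cmod (f m s)) \<le> Maj m s"
  using assms by (auto simp: dominated_def)

lemma kern_quad_le:
  assumes "\<And>m s. 0 \<le> s \<Longrightarrow> ennreal (cmod (f m s)) \<le> g m s"
  shows "ennreal (cmod (kern n t p *\<^sub>R quad f n p)) \<le> ennreal \<bar>kern n t p\<bar> * quad g n p"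
proof (cases "0 \<le> fst p")
  case True
  then show ?thesis
    using assms by (auto simp: norm_mult ennreal_mult intro!: mult_left_mono mult_mono)
qed (simp add: kern_def)

lemma dominated_integrable:
  assumes f: "dominated f" and t: "0 \<le> t"
  shows "integrable (lborel \<Otimes>\<^sub>M count_space UNIV) (\<lambda>p. kern n t p *\<^sub>R quad f n p)"
proof (rule integrableI_bounded)
  show "(\<lambda>p. kern n t p *\<^sub>R quad f n p) \<in> borel_measurable (lborel \<Otimes>\<^sub>M count_space UNIV)"
    by (rule borel_measurable_scaleR[OF measurable_kern measurable_quad[OF dominatedD(1)[OF f]]])
  show "(\<integral>\<^sup>+p. ennreal (cmod (kern n t p *\<^sub>R quad f n p)) \<partial>(lborel \<Otimes>\<^sub>M count_space UNIV)) < \<infinity>"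
    by (rule le_less_trans[OF nn_integral_mono Maj_kern_finite[OF t, of n]])
       (rule kern_quad_le[OF dominatedD(2)[OF f]])
qed

lemma pic_bound:
  assumes t: "0 \<le> t"
  shows "ennreal (cmod (pic k n t)) \<le> maj k n t"
  using t
proof (induction k arbitrary: n t)
  case (Suc k)
  \<comment> \<open>The induction hypothesis yields integrability of the quadratic term as well as
    its size.\<close>
  have d: "dominated (pic k)"
    unfolding dominated_def by (intro conjI allI impI order_trans[OF Suc.IH maj_le_Maj] measurable_pic)
  have "ennreal (cmod (pic (Suc k) n t)) \<le> ennreal (cmod (exp (- symb n * t) *\<^sub>R z n)) +
     ennreal (cmod (LINT p|(lborel \<Otimes>\<^sub>M count_space UNIV). kern n t p *\<^sub>R quad (pic k) n p))"
    by (simp only: pic.simps ennreal_plus[symmetric] norm_ge_zero ennreal_leI norm_triangle_ineq)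
  also have "\<dots> \<le> maj (Suc k) n t"
    unfolding maj_Suc_prod
  proof (rule add_mono)
    show "ennreal (cmod (exp (- symb n * t) *\<^sub>R z n)) \<le> ennreal (exp (- symb n * t)) * ennreal (cmod (z n))"
      by (simp add: ennreal_mult)
    have "ennreal (cmod (LINT p|(lborel \<Otimes>\<^sub>M count_space UNIV). kern n t p *\<^sub>R quad (pic k) n p))
      \<le> (\<integral>\<^sup>+p. ennreal (cmod (kern n t p *\<^sub>R quad (pic k) n p)) \<partial>(lborel \<Otimes>\<^sub>M count_space UNIV))"
      by (rule integral_norm_bound_ennreal[OF dominated_integrable[OF d Suc.prems]])
    also have "\<dots> \<le> (\<integral>\<^sup>+p. ennreal \<bar>kern n t p\<bar> * quad (maj k) n p \<partial>(lborel \<Otimes>\<^sub>M count_space UNIV))"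
      by (intro nn_integral_mono kern_quad_le Suc.IH)
    finally show "ennreal (cmod (LINT p|(lborel \<Otimes>\<^sub>M count_space UNIV). kern n t p *\<^sub>R quad (pic k) n p))
      \<le> (\<integral>\<^sup>+p. ennreal \<bar>kern n t p\<bar> * quad (maj k) n p \<partial>(lborel \<Otimes>\<^sub>M count_space UNIV))" .
  qed
  finally show ?case .
qed simp

lemma dominated_pic: "dominated (pic k)"
  unfolding dominated_def by (intro conjI allI impI order_trans[OF pic_bound maj_le_Maj] measurable_pic)

text \<open>The increments of the Picard iterates are bounded by those of the majorants; written as a sum because
  subtraction in ennreal truncates.\<close>

lemma pic_diff_bound:
  assumes t: "0 \<le> t"
  shows "ennreal (cmod (pic (Suc k) n t - pic k n t)) + maj k n t \<le> maj (Suc k) n t"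
  using t
proof (induction k arbitrary: n t)
  case 0
  then show ?case using pic_bound[of t "Suc 0" n] by simp
next
  case (Suc k)
  note int = dominated_integrable[OF dominated_pic Suc.prems]
  let ?N = "lborel \<Otimes>\<^sub>M count_space UNIV :: (real \<times> int) measure"
  have m: "(\<lambda>p. ennreal \<bar>kern n t p\<bar> * quad (maj k) n p) \<in> borel_measurable ?N"
    by (rule measurable_kern_quad[OF measurable_maj])
  have m2: "(\<lambda>p. ennreal (cmod (kern n t p *\<^sub>R quad (pic (Suc k)) n p - kern n t p *\<^sub>R quad (pic k) n p))) \<in> borel_measurable ?N"
    by (intro measurable_compose[OF borel_measurable_diff[OF borel_measurable_integrable[OF int] borel_measurable_integrable[OF int]]]) simp
  have "pic (Suc (Suc k)) n t - pic (Suc k) n t =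
     (LINT p|?N. kern n t p *\<^sub>R quad (pic (Suc k)) n p - kern n t p *\<^sub>R quad (pic k) n p)"
    unfolding pic.simps(2)[of "Suc k" n t] pic.simps(2)[of k n t]
    by (subst Bochner_Integration.integral_diff[OF int int]) (simp del: pic.simps)
  then have "ennreal (cmod (pic (Suc (Suc k)) n t - pic (Suc k) n t)) \<le>
     (\<integral>\<^sup>+p. ennreal (cmod (kern n t p *\<^sub>R quad (pic (Suc k)) n p - kern n t p *\<^sub>R quad (pic k) n p)) \<partial>?N)"
    by (simp only:) (intro integral_norm_bound_ennreal Bochner_Integration.integrable_diff int)
  then have "ennreal (cmod (pic (Suc (Suc k)) n t - pic (Suc k) n t)) + maj (Suc k) n t \<le>
     ennreal (exp (- symb n * t)) * ennreal (cmod (z n)) +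
     (\<integral>\<^sup>+p. ennreal (cmod (kern n t p *\<^sub>R quad (pic (Suc k)) n p - kern n t p *\<^sub>R quad (pic k) n p))
        + ennreal \<bar>kern n t p\<bar> * quad (maj k) n p \<partial>?N)"
    unfolding maj_Suc_prod[of k n t] nn_integral_add[OF m2 m]
    by (simp only: add.left_commute[of "ennreal (cmod (_ - _))"] add_mono order_refl)
  also have "\<dots> \<le> maj (Suc (Suc k)) n t"
    unfolding maj_Suc_prod[of "Suc k" n t]
  proof (intro add_left_mono nn_integral_mono)
    fix p :: "real \<times> int"
    show "ennreal (cmod (kern n t p *\<^sub>R quad (pic (Suc k)) n p - kern n t p *\<^sub>R quad (pic k) n p))
        + ennreal \<bar>kern n t p\<bar> * quad (maj k) n p \<le> ennreal \<bar>kern n t p\<bar> * quad (maj (Suc k)) n p"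
    proof (cases "0 \<le> fst p")
      case True
      have "ennreal (cmod (kern n t p *\<^sub>R quad (pic (Suc k)) n p - kern n t p *\<^sub>R quad (pic k) n p))
         = ennreal \<bar>kern n t p\<bar> * ennreal (cmod (quad (pic (Suc k)) n p - quad (pic k) n p))"
        by (simp only: scaleR_diff_right[symmetric] norm_scaleR ennreal_mult norm_ge_zero abs_ge_zero)
      moreover have "ennreal (cmod (quad (pic (Suc k)) n p - quad (pic k) n p)) + quad (maj k) n p \<le> quad (maj (Suc k)) n p"
        by (intro ennreal_mult_diff_bound Suc.IH pic_bound True)
      ultimately show ?thesis
        by (simp only: distrib_left[symmetric] mult_left_mono zero_le)
    qed (simp add: kern_def)
  qed
  finally show ?case .
qed

section \<open>The limit of the iterates and its integral equation\<close>

definition sol :: "int \<Rightarrow> real \<Rightarrow> complex" where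
  "sol n t = lim (\<lambda>k. pic k n t)"

text \<open>The partial sums of the moduli of the increments telescope against the majorants and
  stay below S0, so the series of increments converges absolutely.\<close>

lemma pic_tendsto:
  assumes t: "0 \<le> t"
  shows "(\<lambda>k. pic k n t) \<longlonglongrightarrow> sol n t"
proof -
  have "ennreal (\<Sum>j<k. cmod (pic (Suc j) n t - pic j n t)) \<le> maj k n t" for k
  proof (induction k)
    case (Suc k)
    have "ennreal (\<Sum>j<Suc k. cmod (pic (Suc j) n t - pic j n t))
       = ennreal (cmod (pic (Suc k) n t - pic k n t)) + ennreal (\<Sum>j<k. cmod (pic (Suc j) n t - pic j n t))"
      by (simp add: sum_nonneg add.commute del: pic.simps flip: ennreal_plus)
    also have "\<dots> \<le> maj (Suc k) n t"
      using Suc by (intro order_trans[OF add_left_mono pic_diff_bound[OF t]])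
    finally show ?case .
  qed simp
  then have "ennreal (\<Sum>j<k. cmod (pic (Suc j) n t - pic j n t)) \<le> ennreal S0" for k
    using order_trans[OF maj_le_Maj Maj_le[OF t]] order_trans by blast
  then have "summable (\<lambda>j. cmod (pic (Suc j) n t - pic j n t))"
    using S0_nonneg by (intro summableI_nonneg_bounded[where x=S0]) auto
  then have "summable (\<lambda>j. pic (Suc j) n t - pic j n t)"
    by (rule summable_norm_cancel)
  then have "convergent (\<lambda>k. \<Sum>j<k. pic (Suc j) n t - pic j n t)"
    by (simp only: summable_iff_convergent)
  then have "convergent (\<lambda>k. pic k n t)"
    by (simp only: sum_lessThan_telescope[of "\<lambda>k. pic k n t"] pic.simps(1) diff_zero)
  then show ?thesis
    unfolding sol_def by (rule convergent_LIMSEQ_iff[THEN iffD1])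
qed

lemma measurable_sol [measurable]: "sol n \<in> borel_measurable borel"
  unfolding sol_def[abs_def] by measurable

lemma dominated_sol: "dominated sol"
  unfolding dominated_def
proof (intro conjI allI impI)
  fix m and s :: real
  assume s: "0 \<le> s"
  have "(\<lambda>k. ennreal (cmod (pic k m s))) \<longlonglongrightarrow> ennreal (cmod (sol m s))"
    by (intro tendsto_ennrealI tendsto_norm pic_tendsto s)
  then show "ennreal (cmod (sol m s)) \<le> Maj m s"
    by (rule LIMSEQ_le_const2) (use dominatedD(2)[OF dominated_pic s] in auto)
qed simp

lemma sol_eq:
  assumes t: "0 \<le> t"
  shows "sol n t = exp (- symb n * t) *\<^sub>R z n + (LINT p|(lborel \<Otimes>\<^sub>M count_space UNIV). kern n t p *\<^sub>R quad sol n p)"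
proof (rule LIMSEQ_unique)
  let ?N = "lborel \<Otimes>\<^sub>M count_space UNIV :: (real \<times> int) measure"
  show "(\<lambda>k. pic (Suc k) n t) \<longlonglongrightarrow> sol n t"
    using pic_tendsto[OF t] by (rule LIMSEQ_Suc)
  let ?w = "\<lambda>p. enn2real (ennreal \<bar>kern n t p\<bar> * quad Maj n p)"
  have mw: "(\<lambda>p. ennreal \<bar>kern n t p\<bar> * quad Maj n p) \<in> borel_measurable ?N"
    by (rule measurable_kern_quad[OF measurable_Maj])
  \<comment> \<open>Finite everywhere and not just almost everywhere: for nonnegative times
    \<open>Maj\<close> is at most S0, and for negative times the kernel vanishes. So passing to real
    values loses nothing.\<close>
  have fin: "ennreal \<bar>kern n t p\<bar> * quad Maj n p < top" for p
  proof (cases "0 \<le> fst p")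
    case True
    then have "Maj m (fst p) < top" for m
      using le_less_trans[OF Maj_le ennreal_less_top] by blast
    then show ?thesis by (simp add: ennreal_mult_less_top)
  qed (simp add: kern_def)
  have "(\<lambda>k. LINT p|?N. kern n t p *\<^sub>R quad (pic k) n p) \<longlonglongrightarrow> (LINT p|?N. kern n t p *\<^sub>R quad sol n p)"
  proof (rule integral_dominated_convergence[where w="?w"])
    show "(\<lambda>p. kern n t p *\<^sub>R quad sol n p) \<in> borel_measurable ?N"
      using dominated_integrable[OF dominated_sol t] by (rule borel_measurable_integrable)
    show "(\<lambda>p. kern n t p *\<^sub>R quad (pic k) n p) \<in> borel_measurable ?N" for k
      using dominated_integrable[OF dominated_pic t] by (rule borel_measurable_integrable)
    show "integrable ?N ?w"
    proof (rule integrableI_nonneg)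
      show "?w \<in> borel_measurable ?N" by (rule measurable_compose[OF mw]) simp
      show "(\<integral>\<^sup>+p. ennreal (?w p) \<partial>?N) < \<infinity>"
        using Maj_kern_finite[OF t, of n] by (simp only: ennreal_enn2real[OF fin])
    qed simp
    show "AE p in ?N. (\<lambda>k. kern n t p *\<^sub>R quad (pic k) n p) \<longlonglongrightarrow> kern n t p *\<^sub>R quad sol n p"
    proof (intro AE_I2)
      fix p :: "real \<times> int"
      show "(\<lambda>k. kern n t p *\<^sub>R quad (pic k) n p) \<longlonglongrightarrow> kern n t p *\<^sub>R quad sol n p"
        by (cases "0 \<le> fst p") (auto intro!: tendsto_intros pic_tendsto simp: kern_def)
    qed
    show "AE p in ?N. norm (kern n t p *\<^sub>R quad (pic k) n p) \<le> ?w p" for k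
    proof (intro AE_I2)
      fix p :: "real \<times> int"
      have "ennreal (cmod (kern n t p *\<^sub>R quad (pic k) n p)) \<le> ennreal (?w p)"
        unfolding ennreal_enn2real[OF fin] by (rule kern_quad_le[OF dominatedD(2)[OF dominated_pic]])
      then show "norm (kern n t p *\<^sub>R quad (pic k) n p) \<le> ?w p"
        by (simp del: norm_scaleR norm_mult)
    qed
  qed
  then show "(\<lambda>k. pic (Suc k) n t) \<longlonglongrightarrow> exp (- symb n * t) *\<^sub>R z n + (LINT p|?N. kern n t p *\<^sub>R quad sol n p)"
    by (simp only: pic.simps) (intro tendsto_intros)
qed

text \<open>At times where summability in m fails this is 0 by default, which is harmless for upper
  bounds on its modulus.\<close>

definition conv :: "int \<Rightarrow> real \<Rightarrow> complex" where
  "conv n s = (LINT m|count_space UNIV. of_real (coef n m) * (sol (n - m) s * sol m s))"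

lemma dominated_iterated:
  assumes f: "dominated f" and t: "0 \<le> t"
  shows "(LINT p|(lborel \<Otimes>\<^sub>M count_space UNIV). kern n t p *\<^sub>R quad f n p) = (LINT s:{0..t}|lborel. exp (- symb n * (t - s)) *\<^sub>R
      (LINT m|count_space UNIV. of_real (coef n m) * (f (n - m) s * f m s)))"
proof -
  interpret pair_sigma_finite lborel "count_space (UNIV::int set)"
    by (rule pair_sigma_finite_lborel_int)
  have "(LINT p|(lborel \<Otimes>\<^sub>M count_space UNIV). kern n t p *\<^sub>R quad f n p)
     = (LINT s|lborel. (LINT m|count_space UNIV. kern n t (s, m) *\<^sub>R (f (n - m) s * f m s)))"
    using integral_fst'[OF dominated_integrable[OF f t, of n]] by simp
  also have "(\<lambda>s. LINT m|count_space UNIV. kern n t (s, m) *\<^sub>R (f (n - m) s * f m s)) =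
     (\<lambda>s. indicator {0..t} s *\<^sub>R exp (- symb n * (t - s)) *\<^sub>R
      (LINT m|count_space UNIV. of_real (coef n m) * (f (n - m) s * f m s)))"
    by (simp add: kern_def scaleR_conv_of_real mult.assoc flip: integral_scaleR_right)
  finally show ?thesis by (simp add: set_lebesgue_integral_def)
qed

lemma coef_minus: "coef (- n) (- m) = coef n m"
  by (simp add: coef_def algebra_simps)

text \<open>\<open>coef\<close> is real and even under simultaneous reflection of both indices, and
  \<open>symb\<close> is even, so the Hermitian symmetry of the datum propagates. This is what makes
  the solution real-valued.\<close>

lemma pic_minus: "0 \<le> t \<Longrightarrow> pic k (- n) t = cnj (pic k n t)"
proof (induction k arbitrary: n t)
  case (Suc k)
  have "(LINT m|count_space UNIV. of_real (coef (- n) m) * (pic k (- n - m) s * pic k m s)) =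
      cnj (LINT m|count_space UNIV. of_real (coef n m) * (pic k (n - m) s * pic k m s))" if "0 \<le> s" for s
  proof -
    have "of_real (coef (- n) (- m)) * (pic k (- n - - m) s * pic k (- m) s) =
        cnj (of_real (coef n m) * (pic k (n - m) s * pic k m s))" for m
      using Suc.IH[OF that, of "n - m"] Suc.IH[OF that, of m] coef_minus[of n m] by simp
    then show ?thesis
      using integral_int_neg[of "\<lambda>m. of_real (coef (- n) m) * (pic k (- n - m) s * pic k m s)"] 
      by (simp only: Bochner_Integration.integral_cnj)
  qed
  then show ?case
    unfolding pic.simps(2) dominated_iterated[OF dominated_pic Suc.prems] 
    by (auto simp: symb_def z_minus set_lebesgue_integral_def indicator_def 
        simp flip: Bochner_Integration.integral_cnj intro!: Bochner_Integration.integral_cong)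
qed simp

lemma sol_minus: "0 \<le> t \<Longrightarrow> sol (- n) t = cnj (sol n t)"
  unfolding sol_def[of "- n"] by (intro limI) (simp add: pic_minus pic_tendsto tendsto_cnj)

end

section \<open>The weak formulation\<close>

text \<open>Without summability the right-hand side is infinite, so the bound holds for all
  coefficients.\<close>

lemma norm_fser_le_nn: "ennreal (cmod (fser c x)) \<le> (\<integral>\<^sup>+n. ennreal (cmod (c n)) \<partial>count_space UNIV)"
proof (cases "integrable (count_space UNIV) c")
  case True
  have "ennreal (cmod (fser c x)) \<le> (\<integral>\<^sup>+n. ennreal (cmod (c n * cis (of_int n * x))) \<partial>count_space UNIV)"
    unfolding fser_def by (rule integral_norm_bound_ennreal[OF fser_integrable[OF True]])
  then show ?thesis by (simp add: norm_mult)
next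
  case False
  then show ?thesis by (simp add: integrable_iff_bounded not_less top_unique)
qed

lemma integrable_int_iff:
  fixes c :: "int \<Rightarrow> complex"
  shows "integrable (count_space UNIV) c \<longleftrightarrow> (\<integral>\<^sup>+n. ennreal (cmod (c n)) \<partial>count_space UNIV) < top"
  by (simp add: integrable_iff_bounded)

lemma fser_by_parts_iter:
  fixes \<psi> :: "real \<Rightarrow> real"
  assumes \<psi>: "smooth1 \<psi>" "periodic2pi \<psi>"
    and c: "\<And>j. j \<le> k \<Longrightarrow> integrable (count_space UNIV) (\<lambda>n. (\<i> * of_int n) ^ j * c n)"
  shows "(LINT x:{0..2*pi}|lborel. fser c x * of_real ((deriv ^^ k) \<psi> x))
       = (- 1) ^ k * (LINT x:{0..2*pi}|lborel. fser (\<lambda>n. (\<i> * of_int n) ^ k * c n) x * of_real (\<psi> x))"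
  using c
proof (induction k arbitrary: c)
  case (Suc k)
  let ?c = "\<lambda>n. \<i> * of_int n * c n"
  have d: "((deriv ^^ j) \<psi> has_real_derivative (deriv ^^ Suc j) \<psi> x) (at x)" for j x
    using \<psi>(1) by (simp add: smooth1_def DERIV_deriv_iff_real_differentiable)
  have "(LINT x:{0..2*pi}|lborel. fser c x * of_real ((deriv ^^ Suc k) \<psi> x))
     = - (LINT x:{0..2*pi}|lborel. fser ?c x * of_real ((deriv ^^ k) \<psi> x))"
  proof (rule fser_by_parts)
    show "integrable (count_space UNIV) c" using Suc.prems[of 0] by simp
    show "integrable (count_space UNIV) ?c" using Suc.prems[of 1] by simp
    show "((\<lambda>x. complex_of_real ((deriv ^^ k) \<psi> x)) has_vector_derivative of_real ((deriv ^^ Suc k) \<psi> x)) (at x)" for x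
      by (rule has_vector_derivative_of_real[OF d])
    show "continuous_on UNIV (\<lambda>x. complex_of_real ((deriv ^^ Suc k) \<psi> x))"
      by (intro continuous_on_of_real continuous_at_imp_continuous_on ballI DERIV_isCont[OF d])
    show "complex_of_real ((deriv ^^ k) \<psi> (2 * pi)) = of_real ((deriv ^^ k) \<psi> 0)"
      using periodic_deriv_funpow[OF \<psi>(2), of k] by (simp add: periodic2pi_def) (metis add_0)
  qed
  also have "(LINT x:{0..2*pi}|lborel. fser ?c x * of_real ((deriv ^^ k) \<psi> x))
     = (- 1) ^ k * (LINT x:{0..2*pi}|lborel. fser (\<lambda>n. (\<i> * of_int n) ^ k * ?c n) x * of_real (\<psi> x))"
  proof (rule Suc.IH)
    fix j assume "j \<le> k"
    then show "integrable (count_space UNIV) (\<lambda>n. (\<i> * of_int n) ^ j * ?c n)"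
      using Suc.prems[of "Suc j"] by (simp add: mult_ac)
  qed
  also have "(\<lambda>n. (\<i> * of_int n) ^ k * ?c n) = (\<lambda>n. (\<i> * of_int n) ^ Suc k * c n)"
    by (simp add: mult_ac)
  finally show ?case by simp
qed simp

lemma Re_set_integral:
  assumes "set_integrable M A f"
  shows "Re (LINT x:A|M. f x) = (LINT x:A|M. Re (f x))"
  using assms unfolding set_lebesgue_integral_def set_integrable_def
  by (subst Bochner_Integration.integral_Re[symmetric]) simp_all

lemma set_integrable_Re:
  assumes "set_integrable M A f"
  shows "set_integrable M A (\<lambda>x. Re (f x))"
  using integrable_Re[OF assms[unfolded set_integrable_def]] by (simp add: set_integrable_def)

text \<open>The space-time integrands are bounded uniformly in x by an integrable function of time;
  over a bounded range of x this gives integrability on the rectangle.\<close>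

lemma set_integrable_prod_bound:
  fixes f :: "real \<Rightarrow> real \<Rightarrow> real" and G :: "real \<Rightarrow> ennreal"
  assumes f: "(\<lambda>p. f (fst p) (snd p)) \<in> borel_measurable borel" and [measurable]: "G \<in> borel_measurable borel"
    and G: "(\<integral>\<^sup>+s\<in>{a..b}. G s \<partial>lborel) < top"
    and le: "\<And>s x. s \<in> {a..b} \<Longrightarrow> x \<in> {c..d} \<Longrightarrow> ennreal \<bar>f s x\<bar> \<le> G s"
  shows "set_integrable lborel ({a..b} \<times> {c..d}) (\<lambda>p. f (fst p) (snd p))"
  unfolding set_integrable_def
proof (rule integrableI_bounded)
  note f[measurable]
  have [measurable]: "{a..b} \<times> {c..d} \<in> sets borel"
    by (intro borel_closed closed_Times) auto
  show "(\<lambda>p. indicator ({a..b} \<times> {c..d}) p *\<^sub>R f (fst p) (snd p)) \<in> borel_measurable lborel"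
    by simp
  have "(\<integral>\<^sup>+p. ennreal (norm (indicator ({a..b} \<times> {c..d}) p *\<^sub>R f (fst p) (snd p))) \<partial>lborel)
     \<le> (\<integral>\<^sup>+p. (G (fst p) * indicator {a..b} (fst p)) * indicator {c..d} (snd p) \<partial>(lborel \<Otimes>\<^sub>M lborel))"
    unfolding lborel_prod using le by (intro nn_integral_mono) (auto simp: indicator_def)
  also have "\<dots> = (\<integral>\<^sup>+s. (\<integral>\<^sup>+x. (G s * indicator {a..b} s) * indicator {c..d} x \<partial>lborel) \<partial>lborel)"
    by (subst lborel.nn_integral_fst[symmetric]) simp_all
  also have "\<dots> = (\<integral>\<^sup>+s\<in>{a..b}. G s \<partial>lborel) * emeasure lborel {c..d}"
    by (simp add: nn_integral_cmult nn_integral_multc)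
  also have "\<dots> < \<infinity>"
    using G by (simp add: ennreal_mult_less_top emeasure_lborel_Icc_eq)
  finally show "(\<integral>\<^sup>+p. ennreal (norm (indicator ({a..b} \<times> {c..d}) p *\<^sub>R f (fst p) (snd p))) \<partial>lborel) < \<infinity>" .
qed

lemma set_integral_prod:
  fixes f :: "real \<Rightarrow> real \<Rightarrow> real"
  assumes "set_integrable lborel ({a..b} \<times> {c..d}) (\<lambda>p. f (fst p) (snd p))"
  shows "(LINT p:{a..b}\<times>{c..d}|lborel. f (fst p) (snd p)) = (LINT s:{a..b}|lborel. LINT x:{c..d}|lborel. f s x)"
    and "(LINT p:{a..b}\<times>{c..d}|lborel. f (fst p) (snd p)) = (LINT x:{c..d}|lborel. LINT s:{a..b}|lborel. f s x)"
    and "set_integrable lborel {c..d} (\<lambda>x. LINT s:{a..b}|lborel. f s x)"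
    and "set_integrable lborel {a..b} (\<lambda>s. LINT x:{c..d}|lborel. f s x)"
proof -
  let ?F = "\<lambda>(s, x). indicator {a..b} s *\<^sub>R indicator {c..d} x *\<^sub>R f s x"
  have F: "(\<lambda>p. indicator ({a..b} \<times> {c..d}) p *\<^sub>R f (fst p) (snd p)) = ?F"
    by (auto simp: indicator_def)
  have int: "integrable (lborel \<Otimes>\<^sub>M lborel) ?F"
    using assms unfolding set_integrable_def F lborel_prod .
  show 1: "(LINT p:{a..b}\<times>{c..d}|lborel. f (fst p) (snd p)) = (LINT s:{a..b}|lborel. LINT x:{c..d}|lborel. f s x)"
    unfolding set_lebesgue_integral_def F using lborel_pair.integral_fst'[OF int]
    by (simp add: lborel_prod)
  have *: "(LINT s|lborel. ?F (s, x)) = indicator {c..d} x *\<^sub>R (LINT s:{a..b}|lborel. f s x)" for x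
  proof -
    have "(\<lambda>s. ?F (s, x)) = (\<lambda>s. indicator {c..d} x *\<^sub>R (indicator {a..b} s *\<^sub>R f s x))"
      by (simp add: mult.left_commute)
    then show ?thesis by (simp add: set_lebesgue_integral_def)
  qed
  show "set_integrable lborel {c..d} (\<lambda>x. LINT s:{a..b}|lborel. f s x)"
    using lborel_pair.integrable_snd[OF int] unfolding *[unfolded prod.case] prod.case set_integrable_def .
  have **: "(LINT x|lborel. ?F (s, x)) = indicator {a..b} s *\<^sub>R (LINT x:{c..d}|lborel. f s x)" for s
    by (simp add: set_lebesgue_integral_def)
  show "set_integrable lborel {a..b} (\<lambda>s. LINT x:{c..d}|lborel. f s x)"
    using lborel_pair.integrable_fst[OF int] unfolding **[unfolded prod.case] prod.case set_integrable_def .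
  have "(LINT s|lborel. LINT x|lborel. ?F (s, x)) = (LINT x|lborel. LINT s|lborel. ?F (s, x))"
    using lborel_pair.Fubini_integral[of "\<lambda>s x. ?F (s, x)"] int by simp
  also have "\<dots> = (LINT x:{c..d}|lborel. LINT s:{a..b}|lborel. f s x)"
    unfolding * by (simp add: set_lebesgue_integral_def)
  finally show "(LINT p:{a..b}\<times>{c..d}|lborel. f (fst p) (snd p)) = (LINT x:{c..d}|lborel. LINT s:{a..b}|lborel. f s x)"
    unfolding 1 by (simp add: set_lebesgue_integral_def)
qed

lemma continuous_bounded_rectangle:
  fixes f :: "real \<Rightarrow> real \<Rightarrow> real"
  assumes "continuous_on UNIV (\<lambda>p. f (fst p) (snd p))"
  obtains B where "0 \<le> B" "\<And>s x. s \<in> {a..b} \<Longrightarrow> x \<in> {c..d} \<Longrightarrow> \<bar>f s x\<bar> \<le> B"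
proof -
  have "bounded ((\<lambda>p. f (fst p) (snd p)) ` ({a..b} \<times> {c..d}))"
    by (intro compact_imp_bounded compact_continuous_image compact_Times continuous_on_subset[OF assms]) auto
  then obtain B where B: "\<forall>x\<in>(\<lambda>p. f (fst p) (snd p)) ` ({a..b} \<times> {c..d}). norm x \<le> B"
    unfolding bounded_iff by blast
  have "\<bar>f s x\<bar> \<le> \<bar>B\<bar>" if "s \<in> {a..b}" "x \<in> {c..d}" for s x
    using B that by force
  then show ?thesis using that[of "\<bar>B\<bar>"] by auto
qed

section \<open>Space derivatives and the equation for the Fourier coefficients\<close>

context thin_film
begin

text \<open>Integrable in time, hence finite at almost every time. It bounds the space derivatives
  up to order 4 uniformly in x and, up to a constant, the time derivative; finiteness of
  \<open>Maj4 s\<close> is the working condition for a good time s.\<close>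

definition Maj4 :: "real \<Rightarrow> ennreal" where
  "Maj4 s = (\<integral>\<^sup>+n. ennreal (of_int n ^ 4) * Maj n s \<partial>count_space UNIV)"

lemma measurable_Maj4 [measurable]: "Maj4 \<in> borel_measurable borel"
proof -
  interpret sigma_finite_measure "count_space (UNIV::int set)" by (rule sigma_finite_int)
  show ?thesis unfolding Maj4_def[abs_def] by measurable
qed

lemma Maj4_integral: "0 \<le> t \<Longrightarrow> (\<integral>\<^sup>+s\<in>{0..t}. Maj4 s \<partial>lborel) < top"
  using Maj_sum4 by (simp add: Maj4_def)

lemma Maj4_cmult_integral: "0 \<le> t \<Longrightarrow> (\<integral>\<^sup>+s\<in>{0..t}. ennreal C * Maj4 s \<partial>lborel) < top"
  using Maj4_integral[of t] by (subst mult.assoc, subst nn_integral_cmult) (auto simp: ennreal_mult_less_top)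

lemma norm_sol_le: "0 \<le> s \<Longrightarrow> ennreal (cmod (sol n s)) \<le> Maj n s"
  by (rule dominatedD(2)[OF dominated_sol])

lemma sol_zero: "0 \<le> s \<Longrightarrow> sol 0 s = 0"
  using norm_sol_le[of s 0] by (simp add: Maj_zero)

lemma sol_summable: "0 \<le> s \<Longrightarrow> integrable (count_space UNIV) (\<lambda>n. sol n s)"
  unfolding integrable_int_iff
  by (rule le_less_trans[OF nn_integral_mono[OF norm_sol_le] le_less_trans[OF Maj_sum ennreal_less_top]])

lemma z_summable: "integrable (count_space UNIV) z"
  unfolding integrable_int_iff z_sum by simp

lemma sol_pow_sum:
  assumes "k \<le> 4" "0 \<le> s"
  shows "(\<integral>\<^sup>+n. ennreal (cmod ((\<i> * of_int n) ^ k * sol n s)) \<partial>count_space UNIV) \<le> Maj4 s"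
  unfolding Maj4_def
proof (rule nn_integral_mono)
  fix n :: int
  show "ennreal (cmod ((\<i> * of_int n) ^ k * sol n s)) \<le> ennreal (of_int n ^ 4) * Maj n s"
  proof (cases "n = 0")
    \<comment> \<open>The zero mean matters here: for k = 0 the term at n = 0 is not controlled by
      n^4.\<close>
    case True
    then show ?thesis using sol_zero[OF assms(2)] by simp
  next
    case False
    have "\<bar>real_of_int n\<bar> ^ k \<le> \<bar>real_of_int n\<bar> ^ 4"
      using assms one_le_abs_int[OF False] by (intro power_increasing) auto
    then have "ennreal (\<bar>real_of_int n\<bar> ^ k) * ennreal (cmod (sol n s)) \<le> ennreal (of_int n ^ 4) * Maj n s"
      using norm_sol_le[OF assms(2), of n] by (intro mult_mono ennreal_leI) auto
    then show ?thesis
      by (simp add: norm_mult norm_power ennreal_mult)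
  qed
qed

lemma sol_pow_summable:
  assumes "Maj4 s < top" "k \<le> 4" "0 \<le> s"
  shows "integrable (count_space UNIV) (\<lambda>n. (\<i> * of_int n) ^ k * sol n s)"
  unfolding integrable_int_iff using sol_pow_sum[OF assms(2,3)] assms(1) by (rule le_less_trans)

text \<open>drv k is the k-th space derivative of the solution drv 0.\<close>

definition drv :: "nat \<Rightarrow> real \<Rightarrow> real \<Rightarrow> real" where
  "drv k t x = Re (fser (\<lambda>n. (\<i> * of_int n) ^ k * sol n t) x)"

lemma measurable_drv: "(\<lambda>p. drv k (fst p) (snd p)) \<in> borel_measurable borel"
proof -
  have [measurable]: "(\<lambda>p. fser (\<lambda>n. (\<i> * of_int n) ^ k * sol n (fst p)) (snd p)) \<in> borel_measurable (borel \<Otimes>\<^sub>M borel)"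
    by (rule measurable_fser) measurable
  show ?thesis
    unfolding drv_def borel_prod[symmetric] by measurable
qed

lemma drv_periodic: "periodic2pi (drv k t)"
  by (simp add: periodic2pi_def drv_def periodic_fser)

lemma drv_real:
  assumes "0 \<le> s"
  shows "complex_of_real (drv k s x) = fser (\<lambda>n. (\<i> * of_int n) ^ k * sol n s) x"
  unfolding drv_def
  by (rule fser_real[symmetric]) (simp add: sol_minus[OF assms])

lemma drv_0_le:
  assumes "0 \<le> s"
  shows "\<bar>drv 0 s x\<bar> \<le> S0"
proof -
  have "ennreal \<bar>drv 0 s x\<bar> \<le> ennreal (cmod (fser (\<lambda>n. sol n s) x))"
    unfolding drv_def by (simp add: abs_Re_le_cmod ennreal_leI)
  also have "\<dots> \<le> (\<integral>\<^sup>+n. ennreal (cmod (sol n s)) \<partial>count_space UNIV)"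
    by (rule norm_fser_le_nn)
  also have "\<dots> \<le> ennreal S0"
    by (rule order_trans[OF nn_integral_mono[OF norm_sol_le[OF assms]] Maj_sum[OF assms]])
  finally show ?thesis using S0_nonneg by simp
qed

lemma drv_le:
  assumes "0 \<le> s" "k \<le> 4"
  shows "ennreal \<bar>drv k s x\<bar> \<le> Maj4 s"
proof -
  have "ennreal \<bar>drv k s x\<bar> \<le> ennreal (cmod (fser (\<lambda>n. (\<i> * of_int n) ^ k * sol n s) x))"
    unfolding drv_def by (simp add: abs_Re_le_cmod ennreal_leI)
  also have "\<dots> \<le> Maj4 s"
    by (rule order_trans[OF norm_fser_le_nn sol_pow_sum[OF assms(2,1)]])
  finally show ?thesis .
qed

text \<open>At a good time up to four factors i n keep the coefficients summable, so the derivatives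
  of the test function are moved one by one onto the series; real parts are taken at the
  end.\<close>

lemma weak_deriv_drv:
  assumes good: "Maj4 s < top" and s: "0 \<le> s" and k: "k \<le> 4"
  shows "weak_deriv k (drv 0 s) (drv k s)"
  unfolding weak_deriv_def
proof (intro conjI allI impI)
  have int: "set_integrable lborel {0..2*pi} (\<lambda>x. fser (\<lambda>n. (\<i> * of_int n) ^ j * sol n s) x * of_real (\<psi> x))"
    if "j \<le> 4" "continuous_on UNIV \<psi>" for j and \<psi> :: "real \<Rightarrow> real"
    by (intro fser_fubini sol_pow_summable[OF good that(1) s] set_integrable_continuous continuous_on_of_real that)
  have i1: "set_integrable lborel {0..2*pi} (drv j s)" if "j \<le> 4" for j
    using set_integrable_Re[OF int[OF that, of "\<lambda>_. 1"]] by (simp add: drv_def[abs_def])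
  then show "set_integrable lborel {0..2*pi} (drv 0 s)" "set_integrable lborel {0..2*pi} (drv k s)"
    using k by auto
  fix \<psi> assume \<psi>: "smooth1 \<psi> \<and> periodic2pi \<psi>"
  have cont: "continuous_on UNIV ((deriv ^^ j) \<psi>)" for j
  proof (intro continuous_at_imp_continuous_on ballI)
    fix x
    have "(deriv ^^ j) \<psi> differentiable (at x)" using \<psi> by (simp add: smooth1_def)
    then show "isCont ((deriv ^^ j) \<psi>) x" by (rule differentiable_imp_continuous_within)
  qed
  have "(LINT x:{0..2*pi}|lborel. fser (\<lambda>n. sol n s) x * of_real ((deriv ^^ k) \<psi> x))
       = (- 1) ^ k * (LINT x:{0..2*pi}|lborel. fser (\<lambda>n. (\<i> * of_int n) ^ k * sol n s) x * of_real (\<psi> x))"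
    using \<psi> sol_pow_summable[OF good _ s] k by (intro fser_by_parts_iter) auto
  moreover have Re_mult: "Re (of_real a * w) = a * Re w" for a w by simp
  ultimately have "Re (LINT x:{0..2*pi}|lborel. fser (\<lambda>n. sol n s) x * of_real ((deriv ^^ k) \<psi> x))
       = Re (of_real ((- 1) ^ k) * (LINT x:{0..2*pi}|lborel. fser (\<lambda>n. (\<i> * of_int n) ^ k * sol n s) x * of_real (\<psi> x)))"
    by simp
  then show "(LINT x:{0..2*pi}|lborel. drv 0 s x * (deriv ^^ k) \<psi> x) = (- 1) ^ k * (LINT x:{0..2*pi}|lborel. drv k s x * \<psi> x)"
    unfolding Re_mult
    using Re_set_integral[OF int[of 0 "(deriv ^^ k) \<psi>"]] Re_set_integral[OF int[OF k, of \<psi>]] cont[of k] cont[of 0]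
    by (simp add: drv_def)
qed

text \<open>rate n is the time derivative of sol n.\<close>

definition rate :: "int \<Rightarrow> real \<Rightarrow> complex" where
  "rate n s = conv n s - of_real (symb n) * sol n s"

lemma measurable_conv [measurable]: "conv n \<in> borel_measurable borel"
proof -
  interpret sigma_finite_measure "count_space (UNIV::int set)" by (rule sigma_finite_int)
  have "(\<lambda>(s, m). complex_of_real (coef n m) * (sol (n - m) s * sol m s)) \<in> borel_measurable (borel \<Otimes>\<^sub>M count_space UNIV)"
    by (rule measurable_pair_int) measurable
  then show ?thesis
    unfolding conv_def[abs_def] by (rule borel_measurable_lebesgue_integral)
qed

lemma measurable_rate [measurable]: "rate n \<in> borel_measurable borel"
  unfolding rate_def[abs_def] by measurable

lemma conv_sum:
  assumes s: "0 \<le> s"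
  shows "(\<integral>\<^sup>+n. ennreal (cmod (conv n s)) \<partial>count_space UNIV) \<le> ennreal (2 * \<epsilon> * \<beta> * S0) * Maj4 s"
proof -
  have 1: "ennreal (cmod (conv n s)) \<le> (\<integral>\<^sup>+m. ennreal \<bar>coef n m\<bar> * (Maj (n - m) s * Maj m s) \<partial>count_space UNIV)" for n
  proof -
    have "ennreal (cmod (conv n s)) \<le> (\<integral>\<^sup>+m. ennreal (cmod (of_real (coef n m) * (sol (n - m) s * sol m s))) \<partial>count_space UNIV)"
    proof (cases "integrable (count_space UNIV) (\<lambda>m. of_real (coef n m) * (sol (n - m) s * sol m s))")
      case True
      then show ?thesis unfolding conv_def by (rule integral_norm_bound_ennreal)
    next
      case False
      then show ?thesis by (simp add: conv_def not_integrable_integral_eq)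
    qed
    also have "\<dots> \<le> (\<integral>\<^sup>+m. ennreal \<bar>coef n m\<bar> * (Maj (n - m) s * Maj m s) \<partial>count_space UNIV)"
      by (intro nn_integral_mono) (auto simp: norm_mult ennreal_mult intro!: mult_left_mono mult_mono norm_sol_le s)
    finally show ?thesis .
  qed
  have "(\<integral>\<^sup>+n. ennreal (cmod (conv n s)) \<partial>count_space UNIV) \<le> (\<integral>\<^sup>+n. ennreal (wgt 0 0 n s) *
      (\<integral>\<^sup>+m. ennreal \<bar>coef n m\<bar> * (Maj (n - m) s * Maj m s) \<partial>count_space UNIV) \<partial>count_space UNIV)"
    using 1 by (intro nn_integral_mono) (simp add: wgt_def)
  also have "\<dots> \<le> ennreal (2 * \<epsilon> * \<beta>) * ((\<integral>\<^sup>+n. ennreal (wgt 0 0 n s) * Maj n s \<partial>count_space UNIV) *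
      (\<integral>\<^sup>+n. ennreal (of_int n ^ 4) * (ennreal (wgt 0 0 n s) * Maj n s) \<partial>count_space UNIV))"
    by (rule wgt_conv_le[OF _ _ s]) simp_all
  also have "\<dots> \<le> ennreal (2 * \<epsilon> * \<beta>) * (ennreal S0 * Maj4 s)"
    using Maj_sum[OF s] by (intro mult_left_mono mult_mono) (simp_all add: wgt_def Maj4_def)
  also have "\<dots> = ennreal (2 * \<epsilon> * \<beta> * S0) * Maj4 s"
    using eps beta S0_nonneg by (simp add: ennreal_mult mult.assoc)
  finally show ?thesis .
qed

lemma rate_sum:
  assumes s: "0 \<le> s"
  shows "(\<integral>\<^sup>+n. ennreal (cmod (rate n s)) \<partial>count_space UNIV) \<le> ennreal (2 * \<epsilon> * \<beta> * S0 + \<beta>) * Maj4 s"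
proof -
  have 1: "ennreal (cmod (rate n s)) \<le> ennreal (cmod (conv n s)) + ennreal \<beta> * (ennreal (of_int n ^ 4) * Maj n s)" for n
  proof -
    have "0 \<le> symb n"
      using symb_ge[of n] beta by (meson mult_nonneg_nonneg order_trans diff_ge_0_iff_ge less_imp_le zero_le_even_power even_numeral)
    moreover have "symb n \<le> \<beta> * of_int n ^ 4" by (simp add: symb_def)
    ultimately have "cmod (of_real (symb n) * sol n s) \<le> \<beta> * of_int n ^ 4 * cmod (sol n s)"
      by (simp add: norm_mult mult_right_mono)
    then have "cmod (rate n s) \<le> cmod (conv n s) + \<beta> * (of_int n ^ 4 * cmod (sol n s))"
      unfolding rate_def using norm_triangle_ineq4[of "conv n s" "of_real (symb n) * sol n s"] by (simp add: mult.assoc)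
    then have "ennreal (cmod (rate n s)) \<le> ennreal (cmod (conv n s)) + ennreal \<beta> * (ennreal (of_int n ^ 4) * ennreal (cmod (sol n s)))"
      using beta by (simp add: ennreal_leI flip: ennreal_mult ennreal_plus)
    also have "\<dots> \<le> ennreal (cmod (conv n s)) + ennreal \<beta> * (ennreal (of_int n ^ 4) * Maj n s)"
      by (intro add_left_mono mult_left_mono norm_sol_le s) auto
    finally show ?thesis .
  qed
  have "(\<integral>\<^sup>+n. ennreal (cmod (rate n s)) \<partial>count_space UNIV) \<le>
     (\<integral>\<^sup>+n. ennreal (cmod (conv n s)) \<partial>count_space UNIV) + ennreal \<beta> * Maj4 s"
    unfolding Maj4_def by (subst nn_integral_cmult[symmetric], simp, subst nn_integral_add[symmetric]) (simp_all add: nn_integral_mono 1)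
  also have "\<dots> \<le> ennreal (2 * \<epsilon> * \<beta> * S0) * Maj4 s + ennreal \<beta> * Maj4 s"
    by (intro add_right_mono conv_sum s)
  also have "\<dots> = ennreal (2 * \<epsilon> * \<beta> * S0 + \<beta>) * Maj4 s"
    using eps beta S0_nonneg by (simp add: distrib_right)
  finally show ?thesis .
qed

lemma set_integrable_dominated:
  fixes g :: "real \<Rightarrow> complex"
  assumes m: "g \<in> borel_measurable borel" and t: "0 \<le> t"
    and le: "\<And>s. s \<in> {0..t} \<Longrightarrow> ennreal (cmod (g s)) \<le> ennreal C * Maj4 s"
  shows "set_integrable lborel {0..t} g"
  unfolding set_integrable_def
proof (rule integrableI_bounded)
  show "(\<lambda>x. indicator {0..t} x *\<^sub>R g x) \<in> borel_measurable lborel"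
    using m by simp
  have "(\<integral>\<^sup>+s. ennreal (norm (indicator {0..t} s *\<^sub>R g s)) \<partial>lborel) \<le> (\<integral>\<^sup>+s\<in>{0..t}. ennreal C * Maj4 s \<partial>lborel)"
    using le by (intro nn_integral_mono) (auto simp: indicator_def)
  also have "\<dots> < \<infinity>" using Maj4_cmult_integral[OF t] by simp
  finally show "(\<integral>\<^sup>+s. ennreal (norm (indicator {0..t} s *\<^sub>R g s)) \<partial>lborel) < \<infinity>" .
qed

lemma nn_integral_point: "f n \<le> (\<integral>\<^sup>+n. f n \<partial>count_space UNIV)" for f :: "int \<Rightarrow> ennreal"
  by (rule nn_integral_ge_point) simp

text \<open>Stands in for the differential equation of each mode: a primitive of an integrable rate
  is all that testing in time requires.\<close>

lemma sol_integral:
  assumes t: "0 \<le> t"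
  shows "sol n t = z n + (LINT s:{0..t}|lborel. rate n s)"
proof -
  have c: "set_integrable lborel {0..t} (conv n)"
    by (rule set_integrable_dominated[OF measurable_conv t order_trans[OF nn_integral_point conv_sum]]) auto
  \<comment> \<open>\<open>duhamel_integral\<close> asks for the formula at every real r, while
    \<open>sol_eq\<close> supplies it for r \<ge> 0; h agrees with the solution there.\<close>
  define h where "h r = exp (- symb n * r) *\<^sub>R z n + (LINT s:{0..r}|lborel. exp (- symb n * (r - s)) *\<^sub>R conv n s)" for r
  have h: "h r = sol n r" if "0 \<le> r" for r
    unfolding h_def sol_eq[OF that] dominated_iterated[OF dominated_sol that] conv_def ..
  note d = duhamel_integral[OF c t h_def]
  have si: "set_integrable lborel {0..t} (sol n)"
    using d(1) by (subst set_integrable_cong[OF refl refl h[symmetric]]) auto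
  have "(LINT r:{0..t}|lborel. h r) = (LINT r:{0..t}|lborel. sol n r)"
    by (intro set_lebesgue_integral_cong) (auto simp: h)
  then have "sol n t = z n + ((LINT s:{0..t}|lborel. conv n s) - of_real (symb n) * (LINT s:{0..t}|lborel. sol n s))"
    using d(2) h[OF t] by (simp add: scaleR_conv_of_real algebra_simps)
  also have "(LINT s:{0..t}|lborel. conv n s) - of_real (symb n) * (LINT s:{0..t}|lborel. sol n s) = (LINT s:{0..t}|lborel. rate n s)"
    unfolding rate_def[abs_def]
    by (subst set_integral_diff(2)[OF c set_integrable_mult_right[OF si]]) simp
  finally show ?thesis .
qed

text \<open>The rates are jointly summable in n and integrable in time, so the integrated equation
  can be summed at each fixed x. This yields integration by parts in time for every x.\<close>

lemma fser_sol_integral: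
  assumes t: "0 \<le> t"
  shows "set_integrable lborel {0..t} (\<lambda>s. fser (\<lambda>n. rate n s) x)"
    and "fser (\<lambda>n. sol n t) x = fser z x + (LINT s:{0..t}|lborel. fser (\<lambda>n. rate n s) x)"
proof -
  interpret pair_sigma_finite lborel "count_space (UNIV::int set)"
    by (rule pair_sigma_finite_lborel_int)
  let ?F = "\<lambda>(s, n). indicator {0..t} s *\<^sub>R (rate n s * cis (of_int n * x))"
  have int: "integrable (lborel \<Otimes>\<^sub>M count_space UNIV) ?F"
  proof (rule integrableI_bounded)
    show F: "?F \<in> borel_measurable (lborel \<Otimes>\<^sub>M count_space UNIV)"
      by (rule measurable_pair_int) simp
    have "(\<integral>\<^sup>+p. ennreal (norm (?F p)) \<partial>(lborel \<Otimes>\<^sub>M count_space UNIV))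
      = (\<integral>\<^sup>+s. (\<integral>\<^sup>+n. ennreal (norm (?F (s, n))) \<partial>count_space UNIV) \<partial>lborel)"
      by (rule M2.nn_integral_fst[symmetric]) (rule measurable_compose[OF F], simp)
    also have "\<dots> \<le> (\<integral>\<^sup>+s\<in>{0..t}. ennreal (2 * \<epsilon> * \<beta> * S0 + \<beta>) * Maj4 s \<partial>lborel)"
      using rate_sum by (intro nn_integral_mono) (auto simp: indicator_def norm_mult)
    also have "\<dots> < \<infinity>" using Maj4_cmult_integral[OF t] by simp
    finally show "(\<integral>\<^sup>+p. ennreal (norm (?F p)) \<partial>(lborel \<Otimes>\<^sub>M count_space UNIV)) < \<infinity>" .
  qed
  have eq: "(LINT n|count_space UNIV. ?F (s, n)) = indicator {0..t} s *\<^sub>R fser (\<lambda>n. rate n s) x" for s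
    by (simp add: fser_def)
  show "set_integrable lborel {0..t} (\<lambda>s. fser (\<lambda>n. rate n s) x)"
    using integrable_fst[OF int] unfolding eq[unfolded prod.case] prod.case set_integrable_def .
  have eq2: "(LINT s|lborel. ?F (s, n)) = (sol n t - z n) * cis (of_int n * x)" for n
    unfolding sol_integral[OF t] set_lebesgue_integral_def by (simp flip: mult_scaleR_left)
  have "(LINT s:{0..t}|lborel. fser (\<lambda>n. rate n s) x) = (LINT s|lborel. (LINT n|count_space UNIV. ?F (s, n)))"
    unfolding eq set_lebesgue_integral_def ..
  also have "\<dots> = (LINT n|count_space UNIV. (LINT s|lborel. ?F (s, n)))"
    using int by (intro Fubini_integral[symmetric]) simp
  also have "\<dots> = fser (\<lambda>n. sol n t) x - fser z x"
    unfolding eq2 fser_def left_diff_distrib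
    by (rule Bochner_Integration.integral_diff[OF fser_integrable[OF sol_summable[OF t]] fser_integrable[OF z_summable]])
  finally show "fser (\<lambda>n. sol n t) x = fser z x + (LINT s:{0..t}|lborel. fser (\<lambda>n. rate n s) x)"
    by simp
qed

text \<open>flx and flux are the Fourier coefficients of \<zeta>_x + \<beta> \<zeta>_xxx and of (1 + \<epsilon> \<zeta>) (\<zeta>_x + \<beta> \<zeta>_xxx).\<close>

definition flx :: "int \<Rightarrow> real \<Rightarrow> complex" where
  "flx n s = \<i> * of_int n * sol n s + of_real \<beta> * ((\<i> * of_int n) ^ 3 * sol n s)"

definition flux :: "int \<Rightarrow> real \<Rightarrow> complex" where
  "flux n s = flx n s + of_real \<epsilon> * (LINT m|count_space UNIV. sol (n - m) s * flx m s)"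

lemma flx_summable:
  assumes "Maj4 s < top" "0 \<le> s"
  shows "integrable (count_space UNIV) (\<lambda>n. flx n s)"
  using sol_pow_summable[OF assms(1) _ assms(2), of 1] sol_pow_summable[OF assms(1) _ assms(2), of 3]
  by (simp add: flx_def[abs_def])

lemma flux_summable:
  assumes "Maj4 s < top" "0 \<le> s"
  shows "integrable (count_space UNIV) (\<lambda>n. flux n s)"
  unfolding flux_def
  by (intro Bochner_Integration.integrable_add integrable_mult_right integrable_conv_fst flx_summable sol_summable assms)

text \<open>The conservation form, mode by mode: the outer factor n of \<open>coef\<close> and one
  factor of \<open>symb\<close> are the divergence. It is algebra under the sum sign and holds at
  every s, including times without summability.\<close>

lemma rate_eq_flux: "\<i> * of_int n * flux n s = - rate n s"
proof -
  have flx: "flx m s = \<i> * of_real (of_int m - \<beta> * of_int m ^ 3) * sol m s" for m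
    by (simp add: flx_def power_mult_distrib algebra_simps power3_eq_cube)
  have "\<i> * of_int n * (of_real \<epsilon> * (LINT m|count_space UNIV. sol (n - m) s * flx m s))
     = (LINT m|count_space UNIV. - (of_real (coef n m) * (sol (n - m) s * sol m s)))"
    unfolding flx integral_mult_right_zero[symmetric]
    by (intro Bochner_Integration.integral_cong refl) (simp add: coef_def algebra_simps)
  then have 1: "\<i> * of_int n * (of_real \<epsilon> * (LINT m|count_space UNIV. sol (n - m) s * flx m s)) = - conv n s"
    by (simp add: conv_def)
  have 2: "\<i> * of_int n * flx n s = of_real (symb n) * sol n s"
    unfolding flx by (simp add: symb_def algebra_simps power2_eq_square power3_eq_cube power4_eq_xxxx)
  show ?thesis
    unfolding flux_def distrib_left 1 2 rate_def by simp
qed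

lemma rate_summable:
  assumes "Maj4 s < top" "0 \<le> s"
  shows "integrable (count_space UNIV) (\<lambda>n. rate n s)"
  unfolding integrable_int_iff
  using assms by (intro le_less_trans[OF rate_sum]) (auto simp: ennreal_mult_less_top)

lemma fser_flux:
  assumes good: "Maj4 s < top" and s: "0 \<le> s"
  shows "Re (fser (\<lambda>n. flux n s) x) = (1 + \<epsilon> * drv 0 s x) * (drv 1 s x + \<beta> * drv 3 s x)"
proof -
  have f: "fser (\<lambda>n. flx n s) x = of_real (drv 1 s x + \<beta> * drv 3 s x)"
  proof -
    have "fser (\<lambda>n. flx n s) x = fser (\<lambda>n. (\<i> * of_int n) ^ 1 * sol n s) x + fser (\<lambda>n. of_real \<beta> * ((\<i> * of_int n) ^ 3 * sol n s)) x"
      unfolding flx_def using sol_pow_summable[OF good _ s, of 1] sol_pow_summable[OF good _ s, of 3]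
      by (subst fser_add[symmetric]) simp_all
    then show ?thesis
      unfolding fser_cmult drv_real[OF s, symmetric] by simp
  qed
  have "fser (\<lambda>n. flux n s) x = fser (\<lambda>n. flx n s) x +
      fser (\<lambda>n. of_real \<epsilon> * (LINT m|count_space UNIV. sol (n - m) s * flx m s)) x"
    unfolding flux_def
    by (intro fser_add flx_summable good s integrable_mult_right integrable_conv_fst sol_summable)
  also have "\<dots> = fser (\<lambda>n. flx n s) x + of_real \<epsilon> * (fser (\<lambda>n. sol n s) x * fser (\<lambda>n. flx n s) x)"
    by (simp only: fser_cmult fser_mult[OF sol_summable[OF s] flx_summable[OF good s]])
  also have "fser (\<lambda>n. sol n s) x = of_real (drv 0 s x)"
    using drv_real[OF s, of 0 x] by simp
  finally show ?thesis
    unfolding f by (simp add: algebra_simps flip: of_real_mult of_real_add)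
qed

end

section \<open>The solution and its decay\<close>

lemma powr_0_int: "(1 + real_of_int \<bar>n\<bar>) powr 0 = 1"
  by (simp add: add_nonneg_eq_0_iff)

lemma fourier_coeff_cis:
  "(LINT x:{0..2*pi}|lborel. f x *\<^sub>R cis (of_int n * x)) = 2 * of_real pi * fourier_coeff f (- n)"
proof -
  have "complex_of_real (f x) * exp (- \<i> * of_int (- n) * complex_of_real x) = f x *\<^sub>R cis (of_int n * x)" for x
    by (simp add: cis_conv_exp scaleR_conv_of_real mult.assoc)
  then show ?thesis
    by (simp only: fourier_coeff_def) simp
qed

lemma fourier_coeff_minus: "fourier_coeff f (- n) = cnj (fourier_coeff f n)"
proof -
  have "exp (- \<i> * of_int (- n) * complex_of_real x) = cnj (exp (- \<i> * of_int n * complex_of_real x))" for x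
    by (simp add: exp_cnj)
  then have "complex_of_real (f x) * exp (- \<i> * of_int (- n) * complex_of_real x)
      = cnj (complex_of_real (f x) * exp (- \<i> * of_int n * complex_of_real x))" for x
    by simp
  then show ?thesis
    by (simp only: fourier_coeff_def set_lebesgue_integral_def complex_cnj_mult complex_cnj_complex_of_real
        Bochner_Integration.integral_cnj[symmetric] complex_cnj_scaleR)
qed

context thin_film
begin

text \<open>The left side is treated with x outside and time inside, the right side with the order
  reversed. The link is the double integral of \<phi> times the time derivative, over which the two
  orders are exchanged.\<close>

lemma weak_identity:
  assumes \<phi>: "test_fun \<phi>" and t: "0 \<le> t"
  shows "(LINT x:{0..2*pi}|lborel. drv 0 t x * \<phi> t x) - (LINT x:{0..2*pi}|lborel. Re (fser z x) * \<phi> 0 x)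
       - (LINT p:{0..t}\<times>{0..2*pi}|lborel. drv 0 (fst p) (snd p) * dt \<phi> (fst p) (snd p))
       = (LINT p:{0..t}\<times>{0..2*pi}|lborel. (1 + \<epsilon> * drv 0 (fst p) (snd p)) * drv 1 (fst p) (snd p) * dx \<phi> (fst p) (snd p))
         + \<beta> * (LINT p:{0..t}\<times>{0..2*pi}|lborel. (1 + \<epsilon> * drv 0 (fst p) (snd p)) * drv 3 (fst p) (snd p) * dx \<phi> (fst p) (snd p))"
proof -
  note sm = deriv_smooth2[OF conjunct1[OF \<phi>[unfolded test_fun_def]]]
  have cx: "continuous_on UNIV (\<lambda>x. f s x)" if "continuous_on UNIV (\<lambda>p. f (fst p) (snd p))" for f :: "real \<Rightarrow> real \<Rightarrow> real" and s
    using continuous_on_compose2[OF that, of UNIV "\<lambda>x. (s, x)"] by (simp add: continuous_on_Pair)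
  have cs: "continuous_on UNIV (\<lambda>s. f s x)" if "continuous_on UNIV (\<lambda>p. f (fst p) (snd p))" for f :: "real \<Rightarrow> real \<Rightarrow> real" and x
    using continuous_on_compose2[OF that, of UNIV "\<lambda>s. (s, x)"] by (simp add: continuous_on_Pair)
  note meas = sm(1-3)[THEN borel_measurable_continuous_onI]
  define rt where "rt s x = Re (fser (\<lambda>n. rate n s) x)" for s x
  have mrt: "(\<lambda>p. rt (fst p) (snd p)) \<in> borel_measurable borel"
  proof -
    have [measurable]: "(\<lambda>p. fser (\<lambda>n. rate n (fst p)) (snd p)) \<in> borel_measurable (borel \<Otimes>\<^sub>M borel)"
      by (rule measurable_fser) measurable
    show ?thesis unfolding rt_def borel_prod[symmetric] by measurable
  qed
  define C where "C = 2 * \<epsilon> * \<beta> * S0 + \<beta>"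
  have rt_le: "ennreal \<bar>rt s x\<bar> \<le> ennreal C * Maj4 s" if "0 \<le> s" for s x
  proof -
    have "ennreal \<bar>rt s x\<bar> \<le> ennreal (cmod (fser (\<lambda>n. rate n s) x))"
      unfolding rt_def by (simp add: abs_Re_le_cmod ennreal_leI)
    also have "\<dots> \<le> ennreal C * Maj4 s"
      unfolding C_def by (rule order_trans[OF norm_fser_le_nn rate_sum[OF that]])
    finally show ?thesis .
  qed
  obtain B where B: "0 \<le> B" "\<And>s x. s \<in> {0..t} \<Longrightarrow> x \<in> {0..2*pi} \<Longrightarrow> \<bar>\<phi> s x\<bar> \<le> B"
    by (rule continuous_bounded_rectangle[OF sm(1), where a=0 and b=t and c=0 and d="2*pi"]) blast
  obtain Bt where Bt: "0 \<le> Bt" "\<And>s x. s \<in> {0..t} \<Longrightarrow> x \<in> {0..2*pi} \<Longrightarrow> \<bar>dt \<phi> s x\<bar> \<le> Bt"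
    by (rule continuous_bounded_rectangle[OF sm(2), where a=0 and b=t and c=0 and d="2*pi"]) blast
  obtain Bx where Bx: "0 \<le> Bx" "\<And>s x. s \<in> {0..t} \<Longrightarrow> x \<in> {0..2*pi} \<Longrightarrow> \<bar>dx \<phi> s x\<bar> \<le> Bx"
    by (rule continuous_bounded_rectangle[OF sm(3), where a=0 and b=t and c=0 and d="2*pi"]) blast
  have int_t: "set_integrable lborel ({0..t} \<times> {0..2*pi}) (\<lambda>p. drv 0 (fst p) (snd p) * dt \<phi> (fst p) (snd p))"
  proof (rule set_integrable_prod_bound[where G="\<lambda>s. ennreal Bt * Maj4 s" and f="\<lambda>s x. drv 0 s x * dt \<phi> s x"])
    show "ennreal \<bar>drv 0 s x * dt \<phi> s x\<bar> \<le> ennreal Bt * Maj4 s" if "s \<in> {0..t}" "x \<in> {0..2*pi}" for s x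
      using mult_mono[OF ennreal_leI[OF Bt(2)[OF that]] drv_le[of s 0 x]] that by (simp add: abs_mult ennreal_mult mult.commute)
  qed (intro borel_measurable_times measurable_drv meas measurable_Maj4 borel_measurable_times_ennreal Maj4_cmult_integral t; simp)+
  have int_r: "set_integrable lborel ({0..t} \<times> {0..2*pi}) (\<lambda>p. \<phi> (fst p) (snd p) * rt (fst p) (snd p))"
  proof (rule set_integrable_prod_bound[where G="\<lambda>s. ennreal (B * C) * Maj4 s" and f="\<lambda>s x. \<phi> s x * rt s x"])
    have "0 \<le> C" using eps beta S0_nonneg by (simp add: C_def)
    then show "ennreal \<bar>\<phi> s x * rt s x\<bar> \<le> ennreal (B * C) * Maj4 s" if "s \<in> {0..t}" "x \<in> {0..2*pi}" for s x
      using mult_mono[OF ennreal_leI[OF B(2)[OF that]] rt_le[of s x]] that B(1) by (simp add: abs_mult ennreal_mult mult.assoc)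
  qed (intro borel_measurable_times mrt meas measurable_Maj4 borel_measurable_times_ennreal Maj4_cmult_integral t; simp)+
  have int_k: "set_integrable lborel ({0..t} \<times> {0..2*pi}) (\<lambda>p. (1 + \<epsilon> * drv 0 (fst p) (snd p)) * drv k (fst p) (snd p) * dx \<phi> (fst p) (snd p))"
    if k: "k \<le> 4" for k
  proof (rule set_integrable_prod_bound[where G="\<lambda>s. ennreal ((1 + \<epsilon> * S0) * Bx) * Maj4 s"
        and f="\<lambda>s x. (1 + \<epsilon> * drv 0 s x) * drv k s x * dx \<phi> s x"])
    show "ennreal \<bar>(1 + \<epsilon> * drv 0 s x) * drv k s x * dx \<phi> s x\<bar> \<le> ennreal ((1 + \<epsilon> * S0) * Bx) * Maj4 s"
      if "s \<in> {0..t}" "x \<in> {0..2*pi}" for s x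
    proof -
      have "\<bar>\<epsilon> * drv 0 s x\<bar> \<le> \<epsilon> * S0"
        using drv_0_le[of s x] that eps by (simp add: abs_mult)
      then have "\<bar>1 + \<epsilon> * drv 0 s x\<bar> \<le> 1 + \<epsilon> * S0" by linarith
      then have "\<bar>1 + \<epsilon> * drv 0 s x\<bar> * \<bar>dx \<phi> s x\<bar> \<le> (1 + \<epsilon> * S0) * Bx"
        using Bx(2)[OF that] by (intro mult_mono) auto
      from mult_mono[OF ennreal_leI[OF this] drv_le[of s k x]] show ?thesis
        using that k by (simp add: abs_mult ennreal_mult[symmetric] mult_ac)
    qed
  qed (intro borel_measurable_times borel_measurable_add borel_measurable_const measurable_drv meas measurable_Maj4
      borel_measurable_times_ennreal Maj4_cmult_integral t; simp)+

  have int_f: "set_integrable lborel ({0..t} \<times> {0..2*pi}) (\<lambda>p. (1 + \<epsilon> * drv 0 (fst p) (snd p)) * drv 1 (fst p) (snd p) * dx \<phi> (fst p) (snd p)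
      + \<beta> * ((1 + \<epsilon> * drv 0 (fst p) (snd p)) * drv 3 (fst p) (snd p) * dx \<phi> (fst p) (snd p)))"
    by (rule set_integral_add(1)[OF int_k set_integrable_mult_right[OF int_k]]) simp_all
  have pointwise: "\<phi> t x * drv 0 t x - \<phi> 0 x * Re (fser z x) - (LINT r:{0..t}|lborel. drv 0 r x * dt \<phi> r x)
      = (LINT s:{0..t}|lborel. \<phi> s x * rt s x)" for x
  proof -
    have "fser (\<lambda>n. sol n r) x = fser z x + (LINT s:{0..r}|lborel. fser (\<lambda>n. rate n s) x)" if "r \<in> {0..t}" for r
      using fser_sol_integral(2)[of r x] that by simp
    note tb = time_by_parts[OF fser_sol_integral(1)[OF t] t this sm(4)[where x=x] cs[OF sm(2)]]
    have e: "Re (dt \<phi> r x *\<^sub>R fser (\<lambda>n. sol n r) x) = drv 0 r x * dt \<phi> r x" for r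
      by (simp add: drv_def)
    have "Re (\<phi> t x *\<^sub>R fser (\<lambda>n. sol n t) x - \<phi> 0 x *\<^sub>R fser z x - (LINT r:{0..t}|lborel. dt \<phi> r x *\<^sub>R fser (\<lambda>n. sol n r) x))
       = Re (LINT s:{0..t}|lborel. \<phi> s x *\<^sub>R fser (\<lambda>n. rate n s) x)"
      using tb(3) by simp
    moreover have "Re (LINT r:{0..t}|lborel. dt \<phi> r x *\<^sub>R fser (\<lambda>n. sol n r) x) = (LINT r:{0..t}|lborel. drv 0 r x * dt \<phi> r x)"
      using Re_set_integral[OF tb(1)] by (simp only: e)
    moreover have "Re (LINT s:{0..t}|lborel. \<phi> s x *\<^sub>R fser (\<lambda>n. rate n s) x) = (LINT s:{0..t}|lborel. \<phi> s x * rt s x)"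
      using Re_set_integral[OF tb(2)] by (simp add: rt_def)
    ultimately show ?thesis
      by (simp add: drv_def)
  qed
  have iA: "set_integrable lborel {0..2*pi} (\<lambda>x. \<phi> s x * Re (fser c x))" if "integrable (count_space UNIV) c" for s c
    using set_integrable_Re[OF fser_fubini(1)[OF that set_integrable_continuous[OF continuous_on_of_real[OF cx[OF sm(1)]]]], of 0 "2*pi" s]
    by (simp add: mult.commute)
  have A: "set_integrable lborel {0..2*pi} (\<lambda>x. \<phi> t x * drv 0 t x)"
    using iA[OF sol_summable[OF t], of t] by (simp add: drv_def)
  note Bi = iA[OF z_summable, of 0]
  note Ci = set_integral_prod(3)[OF int_t]
  have "(LINT x:{0..2*pi}|lborel. drv 0 t x * \<phi> t x) - (LINT x:{0..2*pi}|lborel. Re (fser z x) * \<phi> 0 x)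
       - (LINT p:{0..t}\<times>{0..2*pi}|lborel. drv 0 (fst p) (snd p) * dt \<phi> (fst p) (snd p))
     = (LINT x:{0..2*pi}|lborel. \<phi> t x * drv 0 t x - \<phi> 0 x * Re (fser z x) - (LINT r:{0..t}|lborel. drv 0 r x * dt \<phi> r x))"
    unfolding set_integral_prod(2)[OF int_t] set_integral_diff(2)[OF set_integral_diff(1)[OF A Bi] Ci] set_integral_diff(2)[OF A Bi]
    by (simp only: mult.commute[of _ "\<phi> _ _"])
  also have "\<dots> = (LINT x:{0..2*pi}|lborel. LINT s:{0..t}|lborel. \<phi> s x * rt s x)"
    by (simp only: pointwise)
  also have "\<dots> = (LINT s:{0..t}|lborel. LINT x:{0..2*pi}|lborel. \<phi> s x * rt s x)"
    using set_integral_prod(1,2)[OF int_r] by simp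
  also have "\<dots> = (LINT s:{0..t}|lborel. LINT x:{0..2*pi}|lborel. (1 + \<epsilon> * drv 0 s x) * drv 1 s x * dx \<phi> s x
      + \<beta> * ((1 + \<epsilon> * drv 0 s x) * drv 3 s x * dx \<phi> s x))"
  proof -
    let ?f = "\<lambda>s x. (1 + \<epsilon> * drv 0 s x) * drv 1 s x * dx \<phi> s x + \<beta> * ((1 + \<epsilon> * drv 0 s x) * drv 3 s x * dx \<phi> s x)"
    \<comment> \<open>The flux is known to have summable coefficients only at good times; the
      remaining times form a null set.\<close>
    have good: "AE s in lborel. s \<in> {0..t} \<longrightarrow> Maj4 s < top"
      by (rule nn_integral_enn2real(3)[OF measurable_Maj4 Maj4_integral[OF t]]) simp
    have "(LINT x:{0..2*pi}|lborel. \<phi> s x * rt s x) = (LINT x:{0..2*pi}|lborel. ?f s x)" if s: "0 \<le> s" and g: "Maj4 s < top" for s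
    proof -
      have irate: "integrable (count_space UNIV) (\<lambda>n. \<i> * of_int n * flux n s)"
        unfolding rate_eq_flux using rate_summable[OF g s] by simp
      have i: "set_integrable lborel {0..2*pi} (\<lambda>x. fser c x * complex_of_real (f x))"
        if "integrable (count_space UNIV) c" "continuous_on UNIV f" for c f
        by (intro fser_fubini(1) that set_integrable_continuous continuous_on_of_real)
      \<comment> \<open>Two signs cancel: one from integrating by parts and one from
        \<open>rate_eq_flux\<close>.\<close>
      have "(LINT x:{0..2*pi}|lborel. fser (\<lambda>n. flux n s) x * complex_of_real (dx \<phi> s x))
          = - (LINT x:{0..2*pi}|lborel. fser (\<lambda>n. \<i> * of_int n * flux n s) x * complex_of_real (\<phi> s x))"
      proof (rule fser_by_parts[OF flux_summable[OF g s] irate])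
        show "((\<lambda>x. complex_of_real (\<phi> s x)) has_vector_derivative of_real (dx \<phi> s x)) (at x)" for x
          by (rule has_vector_derivative_of_real[OF sm(5)])
        show "continuous_on UNIV (\<lambda>x. complex_of_real (dx \<phi> s x))"
          by (intro continuous_on_of_real cx sm(3))
        show "complex_of_real (\<phi> s (2 * pi)) = of_real (\<phi> s 0)"
          using \<phi> by (simp add: test_fun_def periodic2pi_def) (metis add_0)
      qed
      also have "(\<lambda>x. fser (\<lambda>n. \<i> * of_int n * flux n s) x * complex_of_real (\<phi> s x))
          = (\<lambda>x. - (fser (\<lambda>n. rate n s) x * complex_of_real (\<phi> s x)))"
        unfolding rate_eq_flux using fser_cmult[of "- 1" "\<lambda>n. rate n s"] by simp
      finally have eq: "(LINT x:{0..2*pi}|lborel. fser (\<lambda>n. flux n s) x * complex_of_real (dx \<phi> s x))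
          = (LINT x:{0..2*pi}|lborel. fser (\<lambda>n. rate n s) x * complex_of_real (\<phi> s x))"
        by (simp add: set_lebesgue_integral_def)
      have "\<phi> s x * rt s x = Re (fser (\<lambda>n. rate n s) x * complex_of_real (\<phi> s x))" for x
        by (simp add: rt_def)
      then have "(LINT x:{0..2*pi}|lborel. \<phi> s x * rt s x) = (LINT x:{0..2*pi}|lborel. Re (fser (\<lambda>n. rate n s) x * complex_of_real (\<phi> s x)))"
        by (simp only:)
      also have "\<dots> = Re (LINT x:{0..2*pi}|lborel. fser (\<lambda>n. rate n s) x * complex_of_real (\<phi> s x))"
        by (rule Re_set_integral[OF i[OF rate_summable[OF g s] cx[OF sm(1)]], symmetric])
      also have "\<dots> = Re (LINT x:{0..2*pi}|lborel. fser (\<lambda>n. flux n s) x * complex_of_real (dx \<phi> s x))"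
        by (simp only: eq)
      also have "\<dots> = (LINT x:{0..2*pi}|lborel. Re (fser (\<lambda>n. flux n s) x * complex_of_real (dx \<phi> s x)))"
        by (rule Re_set_integral[OF i[OF flux_summable[OF g s] cx[OF sm(3)]]])
      also have "(\<lambda>x. Re (fser (\<lambda>n. flux n s) x * complex_of_real (dx \<phi> s x))) = ?f s"
      proof
        fix x
        have "Re (fser (\<lambda>n. flux n s) x * complex_of_real (dx \<phi> s x)) = Re (fser (\<lambda>n. flux n s) x) * dx \<phi> s x"
          by simp
        also have "\<dots> = ?f s x"
          unfolding fser_flux[OF g s] by (simp add: algebra_simps)
        finally show "Re (fser (\<lambda>n. flux n s) x * complex_of_real (dx \<phi> s x)) = ?f s x" .
      qed
      finally show ?thesis .
    qed
    note inner = this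
    have ae: "AE s in lborel. indicator {0..t} s *\<^sub>R (LINT x:{0..2*pi}|lborel. \<phi> s x * rt s x)
       = indicator {0..t} s *\<^sub>R (LINT x:{0..2*pi}|lborel. ?f s x)"
      using good
    proof eventually_elim
      case (elim s)
      then show ?case using inner[of s] by (cases "s \<in> {0..t}") simp_all
    qed
    show ?thesis
      unfolding set_lebesgue_integral_def[of lborel "{0..t}"]
    proof (rule Bochner_Integration.integral_cong_AE[OF _ _ ae])
      show "(\<lambda>s. indicator {0..t} s *\<^sub>R (LINT x:{0..2*pi}|lborel. \<phi> s x * rt s x)) \<in> borel_measurable lborel"
        by (rule borel_measurable_integrable[OF set_integral_prod(4)[OF int_r, unfolded set_integrable_def]])
      show "(\<lambda>s. indicator {0..t} s *\<^sub>R (LINT x:{0..2*pi}|lborel. ?f s x)) \<in> borel_measurable lborel"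
        by (rule borel_measurable_integrable[OF set_integral_prod(4)[OF int_f, unfolded set_integrable_def]])
    qed
  qed
  also have "\<dots> = (LINT p:{0..t}\<times>{0..2*pi}|lborel. (1 + \<epsilon> * drv 0 (fst p) (snd p)) * drv 1 (fst p) (snd p) * dx \<phi> (fst p) (snd p)
      + \<beta> * ((1 + \<epsilon> * drv 0 (fst p) (snd p)) * drv 3 (fst p) (snd p) * dx \<phi> (fst p) (snd p)))"
    by (rule set_integral_prod(1)[OF int_f, symmetric])
  also have "\<dots> = (LINT p:{0..t}\<times>{0..2*pi}|lborel. (1 + \<epsilon> * drv 0 (fst p) (snd p)) * drv 1 (fst p) (snd p) * dx \<phi> (fst p) (snd p))
         + \<beta> * (LINT p:{0..t}\<times>{0..2*pi}|lborel. (1 + \<epsilon> * drv 0 (fst p) (snd p)) * drv 3 (fst p) (snd p) * dx \<phi> (fst p) (snd p))"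
    by (subst set_integral_add(2)[OF int_k set_integrable_mult_right[OF int_k]]) simp_all
  finally show ?thesis .
qed

lemma fourier_coeff_drv:
  assumes "0 \<le> t"
  shows "fourier_coeff (drv 0 t) n = sol n t"
  by (rule fourier_coeff_fser[OF sol_summable[OF assms]]) (use drv_real[OF assms, of 0] in simp)

text \<open>The datum is an arbitrary integrable representative, whereas the construction starts
  from its Fourier series. Equality against continuous periodic functions is enough for the weak
  formulation, and follows because the difference has vanishing Fourier coefficients.\<close>

lemma initial_integral:
  assumes \<zeta>0: "set_integrable lborel {0..2*pi} \<zeta>0" "\<And>n. fourier_coeff \<zeta>0 n = z n"
    and f: "periodic2pi f" "continuous_on UNIV f"
  shows "(LINT x:{0..2*pi}|lborel. \<zeta>0 x * f x) = (LINT x:{0..2*pi}|lborel. Re (fser z x) * f x)"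
proof -
  have r: "complex_of_real (Re (fser z x)) = fser z x" for x
    by (rule fser_real[symmetric]) (rule z_minus)
  have i: "set_integrable lborel {0..2*pi} (\<lambda>x. Re (fser z x))"
    using set_integrable_Re[OF fser_fubini(1)[OF z_summable set_integrable_continuous[OF continuous_on_const, of _ _ 1]]] by simp
  have "null_coeffs (\<lambda>x. \<zeta>0 x - Re (fser z x))"
    unfolding null_coeffs_def
  proof (intro conjI allI set_integral_diff \<zeta>0 i)
    fix n :: int
    have c: "set_integrable lborel {0..2*pi} (\<lambda>x. g x *\<^sub>R cis (of_int n * x))" if "set_integrable lborel {0..2*pi} g" for g
      by (intro set_integrable_mult_continuous that continuous_intros)
    show "(LINT x:{0..2*pi}|lborel. (\<zeta>0 x - Re (fser z x)) *\<^sub>R cis (of_int n * x)) = 0"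
      unfolding scaleR_diff_left set_integral_diff(2)[OF c[OF \<zeta>0(1)] c[OF i]] fourier_coeff_cis
        \<zeta>0(2) fourier_coeff_fser[OF z_summable r] by simp
  qed
  from null_coeffs_integral[OF this f]
  have "(LINT x:{0..2*pi}|lborel. \<zeta>0 x * f x - Re (fser z x) * f x) = 0"
    by (simp add: left_diff_distrib)
  then show ?thesis
    using set_integrable_mult_continuous[OF \<zeta>0(1) f(2)] set_integrable_mult_continuous[OF i f(2)]
    by (simp add: set_integral_diff(2))
qed

lemma weak_solution_drv:
  assumes \<zeta>0: "set_integrable lborel {0..2*pi} \<zeta>0" "\<And>n. fourier_coeff \<zeta>0 n = z n"
    and Bo: "\<beta> = 1 / Bo" and T: "0 < T"
  shows "weak_solution \<epsilon> Bo T \<zeta>0 (drv 0)"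
  unfolding weak_solution_def
proof (intro conjI)
  show "\<forall>t\<in>{0..T}. periodic2pi (drv 0 t)" by (simp add: drv_periodic)
  show "(\<lambda>p. drv 0 (fst p) (snd p)) \<in> borel_measurable lborel"
    using measurable_drv by simp
  show "\<exists>C. AE p in lborel. p \<in> {0..T} \<times> UNIV \<longrightarrow> \<bar>drv 0 (fst p) (snd p)\<bar> \<le> C"
    by (intro exI[of _ S0] AE_I2) (auto intro: drv_0_le)
  \<comment> \<open>One function dominates all orders k \<le> 3; it is the true bound at good times,
    hence almost everywhere.\<close>
  let ?M = "\<lambda>t. enn2real (Maj4 t)"
  have T0: "0 \<le> T" using T by simp
  note Maj4_real = nn_integral_enn2real[OF measurable_Maj4 Maj4_integral[OF T0]]
  have ae: "AE t in lborel. t \<in> {0..T} \<longrightarrow> (\<forall>k\<le>3. weak_deriv k (drv 0 t) (drv k t)) \<and>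
      (AE x in lborel. \<forall>k\<le>3. \<bar>drv k t x\<bar> \<le> ?M t)"
  proof -
    have "AE t in lborel. t \<in> {0..T} \<longrightarrow> Maj4 t < top"
      by (rule Maj4_real(3)) simp
    then show ?thesis
    proof eventually_elim
      case (elim t)
      show ?case
      proof (intro impI)
        assume t: "t \<in> {0..T}"
        then have t0: "0 \<le> t" and good: "Maj4 t < top" using elim by auto
        have "\<bar>drv k t x\<bar> \<le> ?M t" if "k \<le> 3" for k x
        proof -
          have "ennreal \<bar>drv k t x\<bar> \<le> ennreal (?M t)"
            using drv_le[OF t0, of k x] that good by simp
          then show ?thesis by simp
        qed
        then show "(\<forall>k\<le>3. weak_deriv k (drv 0 t) (drv k t)) \<and> (AE x in lborel. \<forall>k\<le>3. \<bar>drv k t x\<bar> \<le> ?M t)"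
          using weak_deriv_drv[OF good t0] by auto
      qed
    qed
  qed
  have eq: "(LINT x:{0..2*pi}|lborel. drv 0 t x * \<phi> t x) - (LINT x:{0..2*pi}|lborel. \<zeta>0 x * \<phi> 0 x)
       - (LINT p:{0..t}\<times>{0..2*pi}|lborel. drv 0 (fst p) (snd p) * dt \<phi> (fst p) (snd p))
       = (LINT p:{0..t}\<times>{0..2*pi}|lborel. (1 + \<epsilon> * drv 0 (fst p) (snd p)) * drv 1 (fst p) (snd p) * dx \<phi> (fst p) (snd p))
         + 1 / Bo * (LINT p:{0..t}\<times>{0..2*pi}|lborel. (1 + \<epsilon> * drv 0 (fst p) (snd p)) * drv 3 (fst p) (snd p) * dx \<phi> (fst p) (snd p))"
    if "test_fun \<phi> \<and> t \<in> {0..T}" for \<phi> t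
  proof -
    have "continuous_on UNIV (\<phi> 0)"
      using that deriv_smooth2(5)[of \<phi> 0] by (intro continuous_at_imp_continuous_on ballI DERIV_isCont) (auto simp: test_fun_def)
    then have "(LINT x:{0..2*pi}|lborel. \<zeta>0 x * \<phi> 0 x) = (LINT x:{0..2*pi}|lborel. Re (fser z x) * \<phi> 0 x)"
      using that by (intro initial_integral \<zeta>0) (auto simp: test_fun_def)
    then show ?thesis
      using weak_identity[of \<phi> t] that unfolding Bo by simp
  qed
  show "\<exists>D M. D 0 = drv 0 \<and> (\<forall>k\<le>3. (\<lambda>p. D k (fst p) (snd p)) \<in> borel_measurable lborel) \<and>
        set_integrable lborel {0..T} M \<and>
        (AE t in lborel. t \<in> {0..T} \<longrightarrow>
            (\<forall>k\<le>3. weak_deriv k (drv 0 t) (D k t)) \<and>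
            (AE x in lborel. \<forall>k\<le>3. \<bar>D k t x\<bar> \<le> M t)) \<and>
        (\<forall>\<phi> t. test_fun \<phi> \<and> t \<in> {0..T} \<longrightarrow>
           (LINT x:{0..2*pi}|lborel. drv 0 t x * \<phi> t x)
           - (LINT x:{0..2*pi}|lborel. \<zeta>0 x * \<phi> 0 x)
           - (LINT p:{0..t}\<times>{0..2*pi}|lborel. drv 0 (fst p) (snd p) * dt \<phi> (fst p) (snd p))
           = (LINT p:{0..t}\<times>{0..2*pi}|lborel.
                (1 + \<epsilon> * drv 0 (fst p) (snd p)) * D 1 (fst p) (snd p) * dx \<phi> (fst p) (snd p))
             + 1 / Bo * (LINT p:{0..t}\<times>{0..2*pi}|lborel.
                (1 + \<epsilon> * drv 0 (fst p) (snd p)) * D 3 (fst p) (snd p) * dx \<phi> (fst p) (snd p)))"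
  proof (rule exI[of _ drv], rule exI[of _ ?M], intro conjI)
    show "\<forall>k\<le>3. (\<lambda>p. drv k (fst p) (snd p)) \<in> borel_measurable lborel"
      using measurable_drv by simp
    show "set_integrable lborel {0..T} ?M" by (rule Maj4_real(1)) simp
  qed (use ae eq in blast)+
qed

lemma wnorm_drv:
  assumes "0 \<le> t"
  shows "wnorm s lam (drv 0 t) = (\<integral>\<^sup>+n. ennreal ((1 + real_of_int \<bar>n\<bar>) powr s * exp (lam * real_of_int \<bar>n\<bar>) * cmod (sol n t)) \<partial>count_space UNIV)"
  unfolding wnorm_def infsum_int_ennreal fourier_coeff_drv[OF assms] ..

text \<open>Both bounds are inherited from \<open>Maj\<close> through \<open>cmod (sol n t)\<close>
  \<le> \<open>Maj n t\<close>; no energy estimate is made on the solution itself.\<close>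

lemma wnorm_bounds:
  assumes nu: "0 \<le> \<nu>" "\<nu> < (\<beta> - 1) / 2" and t: "0 \<le> t"
  shows "wnorm 0 (\<nu> * t) (drv 0 t) + ennreal ((\<beta> - 1) / 64) * (\<integral>\<^sup>+s\<in>{0..t}. wnorm 4 (\<nu> * s) (drv 0 s) \<partial>lborel) \<le> ennreal S0"
    and "wnorm 0 (\<nu> * t) (drv 0 t) \<le> ennreal S0 * ennreal (exp (- t / 64 * (\<beta> - 1)))"
proof -
  define A4 where "A4 s = (\<integral>\<^sup>+n. ennreal (of_int n ^ 4) * (ennreal (wgt \<nu> 0 n s) * Maj n s) \<partial>count_space UNIV)" for s
  have mA4: "A4 \<in> borel_measurable borel"
  proof -
    interpret sigma_finite_measure "count_space (UNIV::int set)" by (rule sigma_finite_int)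
    show ?thesis unfolding A4_def[abs_def] wgt_def by measurable
  qed
  have w0: "wnorm 0 (\<nu> * s) (drv 0 s) \<le> (\<integral>\<^sup>+n. ennreal (wgt \<nu> 0 n s) * Maj n s \<partial>count_space UNIV)" if "0 \<le> s" for s
    unfolding wnorm_drv[OF that]
  proof (rule nn_integral_mono)
    fix n :: int
    have "ennreal ((1 + real_of_int \<bar>n\<bar>) powr 0 * exp (\<nu> * s * real_of_int \<bar>n\<bar>) * cmod (sol n s)) =
        ennreal (wgt \<nu> 0 n s) * ennreal (cmod (sol n s))"
      by (simp only: powr_0_int) (simp add: wgt_def ennreal_mult mult_ac)
    also have "\<dots> \<le> ennreal (wgt \<nu> 0 n s) * Maj n s"
      by (intro mult_left_mono norm_sol_le that) simp
    finally show "ennreal ((1 + real_of_int \<bar>n\<bar>) powr 0 * exp (\<nu> * s * real_of_int \<bar>n\<bar>) * cmod (sol n s))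
        \<le> ennreal (wgt \<nu> 0 n s) * Maj n s" .
  qed
  have w4: "wnorm 4 (\<nu> * s) (drv 0 s) \<le> ennreal 16 * A4 s" if s: "0 \<le> s" for s
  proof -
    have "ennreal ((1 + real_of_int \<bar>n\<bar>) powr 4 * exp (\<nu> * s * real_of_int \<bar>n\<bar>) * cmod (sol n s))
       \<le> ennreal 16 * (ennreal (of_int n ^ 4) * (ennreal (wgt \<nu> 0 n s) * Maj n s))" for n
    proof (cases "n = 0")
      case True
      then show ?thesis using sol_zero[OF s] by simp
    next
      case False
      \<comment> \<open>Source of the factor 16 that turns the constant 1/4 into 1/64.\<close>
      have "(1 + \<bar>real_of_int n\<bar>) ^ 4 \<le> (2 * \<bar>real_of_int n\<bar>) ^ 4"
        using one_le_abs_int[OF False] by (intro power_mono) auto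
      then have "(1 + real_of_int \<bar>n\<bar>) powr 4 \<le> 16 * of_int n ^ 4"
        by (simp add: power_mult_distrib)
      then have "(1 + real_of_int \<bar>n\<bar>) powr 4 * exp (\<nu> * s * real_of_int \<bar>n\<bar>) * cmod (sol n s)
          \<le> (16 * of_int n ^ 4) * wgt \<nu> 0 n s * cmod (sol n s)"
        by (intro mult_right_mono) (auto simp: wgt_def mult_ac intro!: mult_right_mono)
      then have "ennreal ((1 + real_of_int \<bar>n\<bar>) powr 4 * exp (\<nu> * s * real_of_int \<bar>n\<bar>) * cmod (sol n s))
          \<le> ennreal ((16 * of_int n ^ 4) * wgt \<nu> 0 n s * cmod (sol n s))"
        by (rule ennreal_leI)
      also have "\<dots> = ennreal 16 * (ennreal (of_int n ^ 4) * (ennreal (wgt \<nu> 0 n s) * ennreal (cmod (sol n s))))"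
        by (simp add: ennreal_mult wgt_def mult.assoc)
      also have "\<dots> \<le> ennreal 16 * (ennreal (of_int n ^ 4) * (ennreal (wgt \<nu> 0 n s) * Maj n s))"
        by (intro mult_left_mono norm_sol_le s) auto
      finally show ?thesis .
    qed
    then show ?thesis
      unfolding wnorm_drv[OF s] A4_def
      by (subst nn_integral_cmult[symmetric]) (auto intro: nn_integral_mono)
  qed
  have "ennreal ((\<beta> - 1) / 64) * (\<integral>\<^sup>+s\<in>{0..t}. wnorm 4 (\<nu> * s) (drv 0 s) \<partial>lborel)
      \<le> ennreal ((\<beta> - 1) / 64) * (\<integral>\<^sup>+s. ennreal 16 * (A4 s * indicator {0..t} s) \<partial>lborel)"
    using w4 by (intro mult_left_mono nn_integral_mono) (auto simp: indicator_def)
  also have "\<dots> = ennreal ((\<beta> - 1) / 64) * (ennreal 16 * (\<integral>\<^sup>+s\<in>{0..t}. A4 s \<partial>lborel))"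
    using mA4 by (subst nn_integral_cmult) auto
  also have "\<dots> = ennreal ((\<beta> - 1) / 4) * (\<integral>\<^sup>+s\<in>{0..t}. A4 s \<partial>lborel)"
  proof -
    have "ennreal ((\<beta> - 1) / 64) * ennreal 16 = ennreal ((\<beta> - 1) / 4)"
      using beta by (subst ennreal_mult[symmetric]) auto
    then show ?thesis by (simp only: mult.assoc[symmetric])
  qed
  \<comment> \<open>The restriction \<nu> < (\<beta> - 1) / 2 leaves a quarter of \<beta> - 1. The
    subtracted 0 is the value of \<gamma>, kept to match \<open>Maj_bound\<close>.\<close>
  also have "\<dots> \<le> ennreal (3 / 4 * (\<beta> - 1) - 0 - \<nu>) * (\<integral>\<^sup>+s\<in>{0..t}. A4 s \<partial>lborel)"
  proof (intro mult_right_mono ennreal_leI)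
    show "(\<beta> - 1) / 4 \<le> 3 / 4 * (\<beta> - 1) - 0 - \<nu>"
      using nu(2) by (simp add: field_simps)
  qed simp
  finally have "wnorm 0 (\<nu> * t) (drv 0 t) + ennreal ((\<beta> - 1) / 64) * (\<integral>\<^sup>+s\<in>{0..t}. wnorm 4 (\<nu> * s) (drv 0 s) \<partial>lborel)
     \<le> (\<integral>\<^sup>+n. ennreal (wgt \<nu> 0 n t) * Maj n t \<partial>count_space UNIV) + ennreal (3 / 4 * (\<beta> - 1) - 0 - \<nu>) * (\<integral>\<^sup>+s\<in>{0..t}. A4 s \<partial>lborel)"
    by (intro add_mono w0 t)
  also have "\<dots> \<le> ennreal S0"
    unfolding A4_def by (rule Maj_bound[OF nu(1) _ _ t]) (use nu beta in auto)
  finally show "wnorm 0 (\<nu> * t) (drv 0 t) + ennreal ((\<beta> - 1) / 64) * (\<integral>\<^sup>+s\<in>{0..t}. wnorm 4 (\<nu> * s) (drv 0 s) \<partial>lborel) \<le> ennreal S0" .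
  \<comment> \<open>The factor exp (\<gamma> t) is moved exactly from the weight to the other side,
    so \<gamma> is the decay rate; being below (\<beta> - 1) / 4, it keeps \<gamma> + \<nu>
    admissible.\<close>
  define \<gamma> where "\<gamma> = (\<beta> - 1) / 64"
  have "ennreal (wgt \<nu> 0 n t) * Maj n t = ennreal (exp (- t / 64 * (\<beta> - 1))) * (ennreal (wgt \<nu> \<gamma> n t) * Maj n t)" for n
  proof -
    have "- t / 64 * (\<beta> - 1) + t * (\<gamma> + \<nu> * \<bar>of_int n\<bar>) = t * (0 + \<nu> * \<bar>of_int n\<bar>)"
      by (simp add: \<gamma>_def field_simps)
    then have "wgt \<nu> 0 n t = exp (- t / 64 * (\<beta> - 1)) * wgt \<nu> \<gamma> n t"
      unfolding wgt_def exp_add[symmetric] by (simp only:)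
    then show ?thesis
      by (simp only: ennreal_mult[OF exp_ge_zero] wgt_def exp_ge_zero mult.assoc)
  qed
  then have "(\<integral>\<^sup>+n. ennreal (wgt \<nu> 0 n t) * Maj n t \<partial>count_space UNIV)
      = ennreal (exp (- t / 64 * (\<beta> - 1))) * (\<integral>\<^sup>+n. ennreal (wgt \<nu> \<gamma> n t) * Maj n t \<partial>count_space UNIV)"
    by (simp only:) (rule nn_integral_cmult, simp)
  also have "\<dots> \<le> ennreal (exp (- t / 64 * (\<beta> - 1))) * ennreal S0"
  proof (intro mult_left_mono order_trans[OF add_increasing2[OF zero_le order_refl] Maj_bound[of \<nu> \<gamma> t]] t nu)
    show "0 \<le> \<gamma>" using beta by (simp add: \<gamma>_def)
    have "\<gamma> < (\<beta> - 1) / 4" using beta by (simp add: \<gamma>_def)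
    from this nu(2) have "\<gamma> + \<nu> < (\<beta> - 1) / 4 + (\<beta> - 1) / 2" by (rule add_strict_mono)
    then show "\<gamma> + \<nu> < 3 / 4 * (\<beta> - 1)" by (simp add: field_simps)
  qed simp
  finally show "wnorm 0 (\<nu> * t) (drv 0 t) \<le> ennreal S0 * ennreal (exp (- t / 64 * (\<beta> - 1)))"
    using order_trans[OF w0[OF t]] by (simp add: mult.commute)
qed

lemma measurable_wnorm_drv:
  "(\<lambda>t. wnorm s (\<nu> * t) (drv 0 t)) \<in> borel_measurable (restrict_space lborel {0..T})"
proof -
  interpret sigma_finite_measure "count_space (UNIV::int set)" by (rule sigma_finite_int)
  have "(\<lambda>t. \<integral>\<^sup>+n. ennreal ((1 + real_of_int \<bar>n\<bar>) powr s * exp (\<nu> * t * real_of_int \<bar>n\<bar>) * cmod (sol n t)) \<partial>count_space UNIV) \<in> borel_measurable lborel"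
    by measurable
  then have "(\<lambda>t. \<integral>\<^sup>+n. ennreal ((1 + real_of_int \<bar>n\<bar>) powr s * exp (\<nu> * t * real_of_int \<bar>n\<bar>) * cmod (sol n t)) \<partial>count_space UNIV)
      \<in> borel_measurable (restrict_space lborel {0..T})"
    by (rule measurable_restrict_space1)
  then show ?thesis
    by (rule measurable_cong[THEN iffD1, rotated]) (simp add: space_restrict_space wnorm_drv)
qed

end

theorem theorem4p2:
  fixes \<epsilon> Bo :: real and \<zeta>0 :: "real \<Rightarrow> real"
  assumes "0 < \<epsilon>" "\<epsilon> \<le> 1" "0 < Bo" "Bo < 1"
    and "wiener 0 0 \<zeta>0"
    and "(LINT x:{0..2*pi}|lborel. \<zeta>0 x) = 0"
    and "wnorm 0 0 \<zeta>0 < ennreal ((1/Bo - 1) / (8 * \<epsilon> * (1/Bo + 1)))"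
  shows "\<exists>\<zeta> :: real \<Rightarrow> real \<Rightarrow> real.
     (\<forall>T>0. weak_solution \<epsilon> Bo T \<zeta>0 \<zeta>) \<and>
     (\<forall>\<nu> T. 0 \<le> \<nu> \<and> \<nu> < (1/Bo - 1) / 2 \<and> 0 < T \<longrightarrow>
        (SUP t\<in>{0..T}. wnorm 0 (\<nu> * t) (\<zeta> t)) < \<infinity> \<and>
        (\<lambda>t. wnorm 4 (\<nu> * t) (\<zeta> t)) \<in> borel_measurable (restrict_space lborel {0..T}) \<and>
        (\<integral>\<^sup>+ t\<in>{0..T}. wnorm 4 (\<nu> * t) (\<zeta> t) \<partial>lborel) < \<infinity> \<and>
        (\<forall>t\<in>{0..T}.
           wnorm 0 (\<nu> * t) (\<zeta> t)
             + ennreal ((1/Bo - 1) / 64) * (\<integral>\<^sup>+ t'\<in>{0..t}. wnorm 4 (\<nu> * t') (\<zeta> t') \<partial>lborel)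
             \<le> wnorm 0 0 \<zeta>0 \<and>
           wnorm 0 (\<nu> * t) (\<zeta> t) \<le> wnorm 0 0 \<zeta>0 * ennreal (exp (- t / 64 * (1/Bo - 1)))))"
proof -
  define S0 where "S0 = enn2real (wnorm 0 0 \<zeta>0)"
  have wn: "wnorm 0 0 \<zeta>0 = ennreal S0"
    using assms(5) by (simp add: S0_def wiener_def)
  interpret thin_film "1 / Bo" \<epsilon> S0 "fourier_coeff \<zeta>0"
  proof
    show "1 < 1 / Bo" "0 < \<epsilon>" using assms(1-4) by auto
    show "fourier_coeff \<zeta>0 0 = 0"
      using assms(6) by (simp add: fourier_coeff_def set_integral_complex_of_real)
    show "fourier_coeff \<zeta>0 (- n) = cnj (fourier_coeff \<zeta>0 n)" for n
      by (rule fourier_coeff_minus)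
    show "(\<integral>\<^sup>+n. ennreal (cmod (fourier_coeff \<zeta>0 n)) \<partial>count_space UNIV) = ennreal S0"
      unfolding wn[symmetric] wnorm_def infsum_int_ennreal by (simp only: powr_0_int) simp
    show "0 \<le> S0" by (simp add: S0_def)
    then show "S0 < (1 / Bo - 1) / (8 * \<epsilon> * (1 / Bo + 1))"
      using assms(7) unfolding wn by (simp add: ennreal_less_iff)
  qed
  show ?thesis
  \<comment> \<open>One witness serves every \<nu> and T: the weights occur only in the estimates,
    never in the iteration.\<close>
  proof (intro exI[of _ "drv 0"] conjI allI impI ballI)
    show "weak_solution \<epsilon> Bo T \<zeta>0 (drv 0)" if "0 < T" for T
      using assms(5) that by (intro weak_solution_drv) (auto simp: wiener_def)
    fix \<nu> T :: real
    assume "0 \<le> \<nu> \<and> \<nu> < (1 / Bo - 1) / 2 \<and> 0 < T"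
    then have nu: "0 \<le> \<nu>" "\<nu> < (1 / Bo - 1) / 2" and T: "0 \<le> T" by auto
    note b = wnorm_bounds[OF nu]
    show "wnorm 0 (\<nu> * t) (drv 0 t) + ennreal ((1/Bo - 1) / 64) * (\<integral>\<^sup>+ t'\<in>{0..t}. wnorm 4 (\<nu> * t') (drv 0 t') \<partial>lborel) \<le> wnorm 0 0 \<zeta>0"
      "wnorm 0 (\<nu> * t) (drv 0 t) \<le> wnorm 0 0 \<zeta>0 * ennreal (exp (- t / 64 * (1/Bo - 1)))" if "t \<in> {0..T}" for t
      using b that unfolding wn by auto
    show "(\<lambda>t. wnorm 4 (\<nu> * t) (drv 0 t)) \<in> borel_measurable (restrict_space lborel {0..T})"
      by (rule measurable_wnorm_drv)
    have "(SUP t\<in>{0..T}. wnorm 0 (\<nu> * t) (drv 0 t)) \<le> ennreal S0"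
      using order_trans[OF add_increasing2[OF zero_le order_refl] b(1)] by (intro SUP_least) auto
    then show "(SUP t\<in>{0..T}. wnorm 0 (\<nu> * t) (drv 0 t)) < \<infinity>"
      by (rule le_less_trans) simp
    \<comment> \<open>Since 1/Bo > 1 the factor is positive, so a finite product forces a finite
      integral.\<close>
    have "ennreal ((1/Bo - 1) / 64) * (\<integral>\<^sup>+ t\<in>{0..T}. wnorm 4 (\<nu> * t) (drv 0 t) \<partial>lborel) < top"
      using order_trans[OF add_increasing[OF zero_le order_refl] b(1)[OF T]] by (rule le_less_trans) simp
    then show "(\<integral>\<^sup>+ t\<in>{0..T}. wnorm 4 (\<nu> * t) (drv 0 t) \<partial>lborel) < \<infinity>"
      using beta by (auto simp: ennreal_mult_less_top)
  qed
qed

end
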